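(* Let $M=\Gamma\backslash G$ be a Hyperelliptic surface in the first isomorphism class, regarded as a compact smooth $4$-manifold (explicit description in the context). On $M$ there exist two non integrable almost Hermitian structures $(J_1,\omega_1)$ and $(J_2,\omega_2)$ which are not locally conformally almost Kähler and which satisfy $$h^{1,1}_{\bar\partial}(M,J_1,\omega_1)=2=b^-+1,\qquad h^{1,1}_{\bar\partial}(M,J_2,\omega_2)=1=b^-.$$
   Context: The manifold $M$: let $G$ be $\mathbb{C}^2$ with the group law $(w^1,w^2)\cdot(z^1,z^2)=(w^1+e^{i\pi\frac{w^2+\overline{w^2}}{2}}z^1,\;w^2+z^2)$, let $\Gamma=(\mathbb{Z}+i\mathbb{Z})^2$, a discrete subgroup of $G$, and let $M=\Gamma\backslash G$ (a compact solvmanifold; this is a hyperelliptic surface in the first isomorphism class of Hasegawa's description). An almost Hermitian structure $(J,\omega)$ on a $4$-manifold consists of an almost complex structure $J$ and the fundamental form $\omega$ of a $J$-Hermitian Riemannian metric $g$ (a positive real $(1,1)$-form; if $\psi^1,\psi^2$ is a suitably normalized unitary $(1,0)$-coframe then $\omega=\frac i2(\psi^1\wedge\overline{\psi^1}+\psi^2\wedge\overline{\psi^2})$). The structure is non integrable if $J$ is not induced by a complex manifold structure. There is a unique real $1$-form $\theta$ with $d\omega=\theta\wedge\omega$; $\omega$ is locally conformally almost Kähler if $d\theta=0$ (either $\theta$ exact or closed non exact). The space of complex $(p,q)$-forms with respect to $J$ is $A^{p,q}$; the exterior derivative decomposes as $d=\mu+\partial+\bar\partial+\bar\mu$, where $\mu,\partial,\bar\partial,\bar\mu$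 are the components of bidegree $(2,-1),(1,0),(0,1),(-1,2)$. The Hodge operator $*$ is the $\mathbb{C}$-linear extension of the real Hodge operator of $g$ for the orientation induced by $J$ (volume form $\omega^2/2$). Put $\bar\partial^*=-*\partial*$, $\Delta_{\bar\partial}=\bar\partial\bar\partial^*+\bar\partial^*\bar\partial$, $\mathcal{H}^{p,q}_{\bar\partial}=\ker\Delta_{\bar\partial}\cap A^{p,q}$, and $h^{p,q}_{\bar\partial}(M,J,\omega)=\dim_{\mathbb{C}}\mathcal{H}^{p,q}_{\bar\partial}$. $b^-$ is the dimension of the space of real anti-self-dual $d$-harmonic $2$-forms (a topological invariant of the oriented manifold, with the orientation induced by the almost complex structure). *)

theory Defs
  imports "HOL-Analysis.Analysis" "HOL-Library.Function_Algebras"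
begin

text \<open>
  \<^bold>\<open>Conventions.\<close> \<open>M = \<Gamma>\G\<close> is the quotient of \<open>G = \<complex>\<^sup>2\<close> by the free and properly discontinuous
  left action of \<open>\<Gamma>\<close>, so \<open>G \<rightarrow> M\<close> is a smooth covering with deck group \<open>\<Gamma>\<close>. Smooth tensor fields
  on \<open>M\<close> are represented by their lifts: the smooth tensor fields on \<open>G\<close> invariant under all left
  translations by elements of \<open>\<Gamma>\<close> (not necessarily of \<open>G\<close>). All tangent spaces of \<open>G\<close> are
  identified with \<open>\<complex>\<^sup>2 = \<real>\<^sup>4\<close>.
\<close>

type_synonym pt = "complex \<times> complex"

definition gmul :: "pt \<Rightarrow> pt \<Rightarrow> pt" where
  "gmul w z = (fst w + exp (\<i> * of_real pi * ((snd w + cnj (snd w)) / 2)) * fst z, snd w + snd z)"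

definition Gamma :: "pt set" where
  "Gamma = {w. Re (fst w) \<in> \<int> \<and> Im (fst w) \<in> \<int> \<and> Re (snd w) \<in> \<int> \<and> Im (snd w) \<in> \<int>}"


section \<open>Smooth maps and differential forms\<close>

primrec Ck_on :: "nat \<Rightarrow> 'a::euclidean_space set \<Rightarrow> ('a \<Rightarrow> 'b::real_normed_vector) \<Rightarrow> bool" where
  "Ck_on 0 U f \<longleftrightarrow> continuous_on U f"
| "Ck_on (Suc k) U f \<longleftrightarrow>
     (\<forall>x\<in>U. f differentiable (at x)) \<and> (\<forall>v. Ck_on k U (\<lambda>x. frechet_derivative f (at x) v))"

text \<open>Used for open \<open>U\<close> only.\<close>

definition smooth_on :: "'a::euclidean_space set \<Rightarrow> ('a \<Rightarrow> 'b::real_normed_vector) \<Rightarrow> bool" where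
  "smooth_on U f \<longleftrightarrow> (\<forall>k. Ck_on k U f)"

text \<open>
  Complex-valued forms of all degrees live in one type: the argument list collects the tangent
  vectors at the point, and a \<open>k\<close>-form vanishes on lists of length other than \<open>k\<close>. Hence all the
  operators below act on forms of arbitrary degree, and equality of forms is equality in HOL.
\<close>

type_synonym form = "pt \<Rightarrow> pt list \<Rightarrow> complex"

type_synonym endo = "pt \<Rightarrow> pt \<Rightarrow> pt"

definition kform :: "nat \<Rightarrow> form \<Rightarrow> bool" where
  "kform k \<alpha> \<longleftrightarrow>
     (\<forall>x vs. length vs \<noteq> k \<longrightarrow> \<alpha> x vs = 0) \<and>
     (\<forall>x vs i. length vs = k \<longrightarrow> i < k \<longrightarrow> linear (\<lambda>v. \<alpha> x (vs[i := v]))) \<and>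
     (\<forall>x vs i j. length vs = k \<longrightarrow> i < j \<longrightarrow> j < k \<longrightarrow> vs ! i = vs ! j \<longrightarrow> \<alpha> x vs = 0) \<and>
     (\<forall>vs. smooth_on UNIV (\<lambda>x. \<alpha> x vs))"

definition pullback :: "(pt \<Rightarrow> pt) \<Rightarrow> form \<Rightarrow> form" where
  "pullback \<phi> \<alpha> = (\<lambda>x vs. \<alpha> (\<phi> x) (map (frechet_derivative \<phi> (at x)) vs))"

definition M_form :: "nat \<Rightarrow> form \<Rightarrow> bool" where
  "M_form k \<alpha> \<longleftrightarrow> kform k \<alpha> \<and> (\<forall>\<gamma>\<in>Gamma. pullback (gmul \<gamma>) \<alpha> = \<alpha>)"

definition real_form :: "form \<Rightarrow> bool" where
  "real_form \<alpha> \<longleftrightarrow> (\<forall>x vs. \<alpha> x vs \<in> \<real>)"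

text \<open>
  The invariant formula for \<open>d\<alpha>\<close> on constant vector fields, whose brackets vanish.
\<close>

definition ext_d :: "form \<Rightarrow> form" where
  "ext_d \<alpha> = (\<lambda>x vs. \<Sum>i<length vs. (-1) ^ i *
     frechet_derivative (\<lambda>y. \<alpha> y (take i vs @ drop (Suc i) vs)) (at x) (vs ! i))"

text \<open>
  The shuffle form of the wedge product, so that \<open>(\<alpha> \<and> \<beta>)(u,v) = \<alpha>(u)\<beta>(v) - \<alpha>(v)\<beta>(u)\<close> for
  \<open>1\<close>-forms; \<open>A\<close> is the set of positions of the arguments passed to \<open>\<alpha>\<close>.
\<close>

definition wedge :: "form \<Rightarrow> form \<Rightarrow> form" where
  "wedge \<alpha> \<beta> = (\<lambda>x vs. \<Sum>A\<in>Pow {..<length vs}.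
     (-1) ^ card {(i, j). i \<in> A \<and> j \<in> {..<length vs} - A \<and> j < i} *
     \<alpha> x (nths vs A) * \<beta> x (nths vs ({..<length vs} - A)))"


section \<open>Almost complex structures and bidegree\<close>

definition almost_complex :: "endo \<Rightarrow> bool" where
  "almost_complex J \<longleftrightarrow>
     (\<forall>x. linear (J x)) \<and> (\<forall>x v. J x (J x v) = - v) \<and>
     (\<forall>v. smooth_on UNIV (\<lambda>x. J x v)) \<and>
     (\<forall>\<gamma>\<in>Gamma. \<forall>x v. J (gmul \<gamma> x) (frechet_derivative (gmul \<gamma>) (at x) v)
                       = frechet_derivative (gmul \<gamma>) (at x) (J x v))"

text \<open>
  \<open>J\<close> is induced by a complex manifold structure: every point lies in the domain of a smooth chart
  into \<open>\<complex>\<^sup>2\<close> whose differential takes \<open>J\<close> to multiplication by \<open>\<i>\<close>. Transition maps between such charts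
  are then automatically holomorphic. As \<open>G \<rightarrow> M\<close> is a local diffeomorphism, it is the same
  to ask for such charts around the points of \<open>G\<close> or of \<open>M\<close>.
\<close>

definition integrable_acs :: "endo \<Rightarrow> bool" where
  "integrable_acs J \<longleftrightarrow>
     (\<forall>x. \<exists>U (\<phi> :: pt \<Rightarrow> pt). open U \<and> x \<in> U \<and> inj_on \<phi> U \<and> open (\<phi> ` U) \<and>
        smooth_on U \<phi> \<and> smooth_on (\<phi> ` U) (inv_into U \<phi>) \<and>
        (\<forall>y\<in>U. \<forall>v. frechet_derivative \<phi> (at y) (J y v) =
           (\<i> * fst (frechet_derivative \<phi> (at y) v), \<i> * snd (frechet_derivative \<phi> (at y) v))))"

text \<open>
  A pair \<open>(u, v)\<close> encodes the vector \<open>u + \<i> v\<close> of the complexified tangent space; \<open>cx_ext \<alpha>\<close> is the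
  complex multilinear extension of \<open>\<alpha>\<close>.
\<close>

definition cx_ext :: "form \<Rightarrow> pt \<Rightarrow> (pt \<times> pt) list \<Rightarrow> complex" where
  "cx_ext \<alpha> x ws = (\<Sum>B\<in>Pow {..<length ws}. \<i> ^ card B *
     \<alpha> x (map (\<lambda>j. if j \<in> B then snd (ws ! j) else fst (ws ! j)) [0..<length ws]))"

text \<open>The \<open>(1,0)\<close>-part \<open>(v - \<i> J v)/2\<close> and the \<open>(0,1)\<close>-part \<open>(v + \<i> J v)/2\<close> of a real tangent vector.\<close>

definition part10 :: "endo \<Rightarrow> pt \<Rightarrow> pt \<Rightarrow> pt \<times> pt" where
  "part10 J x v = ((1 / 2) *\<^sub>R v, - (1 / 2) *\<^sub>R J x v)"

definition part01 :: "endo \<Rightarrow> pt \<Rightarrow> pt \<Rightarrow> pt \<times> pt" where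
  "part01 J x v = ((1 / 2) *\<^sub>R v, (1 / 2) *\<^sub>R J x v)"

text \<open>The component of bidegree \<open>(p, q)\<close>; \<open>A\<close> ranges over the possible positions of the \<open>(1,0)\<close>-parts.\<close>

definition bideg_proj :: "endo \<Rightarrow> nat \<Rightarrow> nat \<Rightarrow> form \<Rightarrow> form" where
  "bideg_proj J p q \<alpha> = (\<lambda>x vs. if length vs = p + q then
     (\<Sum>A | A \<subseteq> {..<p + q} \<and> card A = p.
        cx_ext \<alpha> x (map (\<lambda>j. if j \<in> A then part10 J x (vs ! j) else part01 J x (vs ! j)) [0..<p + q]))
     else 0)"

definition A_forms :: "endo \<Rightarrow> nat \<Rightarrow> nat \<Rightarrow> form set" where
  "A_forms J p q = {\<alpha>. M_form (p + q) \<alpha> \<and> bideg_proj J p q \<alpha> = \<alpha>}"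

definition del :: "endo \<Rightarrow> form \<Rightarrow> form" where
  "del J \<alpha> = (\<Sum>p\<le>2. \<Sum>q\<le>2. bideg_proj J (p + 1) q (ext_d (bideg_proj J p q \<alpha>)))"

definition delbar :: "endo \<Rightarrow> form \<Rightarrow> form" where
  "delbar J \<alpha> = (\<Sum>p\<le>2. \<Sum>q\<le>2. bideg_proj J p (q + 1) (ext_d (bideg_proj J p q \<alpha>)))"


section \<open>Almost Hermitian structures\<close>

text \<open>
  The metric of \<open>(J, \<omega>)\<close>, normalised by \<open>\<omega>(u, v) = g(J u, v)\<close>; this is the convention under which
  \<open>\<omega> = \<i>/2 (\<psi>\<^sup>1 \<and> cnj \<psi>\<^sup>1 + \<psi>\<^sup>2 \<and> cnj \<psi>\<^sup>2)\<close> is positive.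
\<close>

definition metric :: "endo \<Rightarrow> form \<Rightarrow> pt \<Rightarrow> pt \<Rightarrow> pt \<Rightarrow> real" where
  "metric J \<omega> x u v = Re (\<omega> x [u, J x v])"

definition almost_hermitian :: "endo \<Rightarrow> form \<Rightarrow> bool" where
  "almost_hermitian J \<omega> \<longleftrightarrow>
     almost_complex J \<and> \<omega> \<in> A_forms J 1 1 \<and> real_form \<omega> \<and>
     (\<forall>x v. v \<noteq> 0 \<longrightarrow> metric J \<omega> x v v > 0)"

text \<open>The form \<open>\<theta>\<close> below is uniquely determined by \<open>d\<omega> = \<theta> \<and> \<omega>\<close>.\<close>

definition loc_conf_almost_kaehler :: "form \<Rightarrow> bool" where
  "loc_conf_almost_kaehler \<omega> \<longleftrightarrow>
     (\<exists>\<theta>. M_form 1 \<theta> \<and> real_form \<theta> \<and> ext_d \<omega> = wedge \<theta> \<omega> \<and> ext_d \<theta> = 0)"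

definition vol :: "form \<Rightarrow> form" where
  "vol \<omega> = (\<lambda>x vs. wedge \<omega> \<omega> x vs / 2)"

definition orthonormal_frame :: "endo \<Rightarrow> form \<Rightarrow> pt \<Rightarrow> pt list \<Rightarrow> bool" where
  "orthonormal_frame J \<omega> x e \<longleftrightarrow> length e = 4 \<and>
     (\<forall>i<4. \<forall>j<4. metric J \<omega> x (e ! i) (e ! j) = (if i = j then 1 else 0))"

text \<open>
  In terms of any orthonormal frame, the complex linear Hodge operator (determined by
  \<open>\<beta> \<and> *\<alpha> = g(\<beta>, \<alpha>) vol\<close> with \<open>g\<close> extended complex bilinearly) sends a \<open>k\<close>-form \<open>\<alpha>\<close> to
  \<open>\<Sum> \<alpha>(e\<^bsub>i1\<^esub>,\<dots>,e\<^bsub>ik\<^esub>) vol(e\<^bsub>i1\<^esub>,\<dots>,e\<^bsub>ik\<^esub>, \<cdot>)\<close>, summed over \<open>i1 < \<dots> < ik\<close>. The value does not depend on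
  the frame; in the sum over all \<open>I\<close> only the sets with \<open>k\<close> elements contribute.
\<close>

definition hodge :: "endo \<Rightarrow> form \<Rightarrow> form \<Rightarrow> form" where
  "hodge J \<omega> \<alpha> = (\<lambda>x vs. let e = (SOME e. orthonormal_frame J \<omega> x e) in
     \<Sum>I\<in>Pow {..<4}. \<alpha> x (nths e I) * vol \<omega> x (nths e I @ vs))"

definition delbar_adj :: "endo \<Rightarrow> form \<Rightarrow> form \<Rightarrow> form" where
  "delbar_adj J \<omega> \<alpha> = - hodge J \<omega> (del J (hodge J \<omega> \<alpha>))"

definition delbar_laplacian :: "endo \<Rightarrow> form \<Rightarrow> form \<Rightarrow> form" where
  "delbar_laplacian J \<omega> \<alpha> = delbar J (delbar_adj J \<omega> \<alpha>) + delbar_adj J \<omega> (delbar J \<alpha>)"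

definition ext_d_adj :: "endo \<Rightarrow> form \<Rightarrow> form \<Rightarrow> form" where
  "ext_d_adj J \<omega> \<alpha> = - hodge J \<omega> (ext_d (hodge J \<omega> \<alpha>))"

definition d_laplacian :: "endo \<Rightarrow> form \<Rightarrow> form \<Rightarrow> form" where
  "d_laplacian J \<omega> \<alpha> = ext_d (ext_d_adj J \<omega> \<alpha>) + ext_d_adj J \<omega> (ext_d \<alpha>)"


section \<open>Dimensions of spaces of harmonic forms\<close>

text \<open>
  Note that \<^const>\<open>vector_space.dim\<close> is \<open>0\<close> for infinite-dimensional spaces.
\<close>

definition cscale :: "complex \<Rightarrow> form \<Rightarrow> form" where
  "cscale c \<alpha> = (\<lambda>x vs. c * \<alpha> x vs)"

definition rscale :: "real \<Rightarrow> form \<Rightarrow> form" where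
  "rscale c \<alpha> = (\<lambda>x vs. of_real c * \<alpha> x vs)"

lemma vector_space_cscale: "vector_space cscale"
  by unfold_locales (auto simp: cscale_def fun_eq_iff algebra_simps)

lemma vector_space_rscale: "vector_space rscale"
  by unfold_locales (auto simp: rscale_def fun_eq_iff algebra_simps)

definition harmonic_delbar :: "endo \<Rightarrow> form \<Rightarrow> nat \<Rightarrow> nat \<Rightarrow> form set" where
  "harmonic_delbar J \<omega> p q = {\<alpha> \<in> A_forms J p q. delbar_laplacian J \<omega> \<alpha> = 0}"

definition h_delbar :: "nat \<Rightarrow> nat \<Rightarrow> endo \<Rightarrow> form \<Rightarrow> nat" where
  "h_delbar p q J \<omega> = vector_space.dim cscale (harmonic_delbar J \<omega> p q)"

text \<open>
  \<open>b\<^sup>-\<close> of \<open>M\<close> with the orientation induced by \<open>J\<close>, computed with the metric of \<open>(J, \<omega>)\<close>.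
\<close>

definition b_minus :: "endo \<Rightarrow> form \<Rightarrow> nat" where
  "b_minus J \<omega> = vector_space.dim rscale
     {\<alpha>. M_form 2 \<alpha> \<and> real_form \<alpha> \<and> hodge J \<omega> \<alpha> = - \<alpha> \<and> d_laplacian J \<omega> \<alpha> = 0}"

end

theory Submission imports Defs begin

text \<open>
  In the real coordinates \<open>t\<^sub>1, t\<^sub>2, t\<^sub>3, t\<^sub>4\<close> with \<open>z\<^sup>1 = t\<^sub>1 + \<i> t\<^sub>2\<close> and \<open>z\<^sup>2 = t\<^sub>3 + \<i> t\<^sub>4\<close>, an element \<open>\<gamma>\<close> of \<open>\<Gamma>\<close> acts on \<open>G\<close>
  by a translation combined with the change of sign \<open>(-1)\<^bsup>Re \<gamma>\<^sup>2\<^esup>\<close> of \<open>(t\<^sub>1, t\<^sub>2)\<close>. So the Euclidean metric descends to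
  \<open>M\<close>, and \<open>M\<close> is finitely covered by a flat torus. Both structures have this metric. The self-dual
  forms \<open>\<Omega>\<^sub>1 = dt\<^sub>1\<^sub>2 + dt\<^sub>3\<^sub>4\<close> and \<open>\<Omega>\<^sub>2 = dt\<^sub>1\<^sub>3 - dt\<^sub>2\<^sub>4\<close>, where \<open>dt\<^sub>i\<^sub>j = dt\<^sub>i \<and> dt\<^sub>j\<close>, are respectively invariant and invariant
  up to the sign. For \<open>k = 0, 1\<close> put \<open>s = 2\<pi>k t\<^sub>1 + sin 2\<pi>t\<^sub>1\<close> and \<open>\<omega> = cos s \<Omega>\<^sub>1 + sin s \<Omega>\<^sub>2\<close>. An element of
  \<open>\<Gamma>\<close> changes \<open>s\<close> by the same sign and by a multiple of \<open>2\<pi>\<close>, so \<open>\<omega>\<close> descends to \<open>M\<close>. It is the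
  fundamental form of an orthogonal almost complex structure \<open>J\<close>, which is not integrable as \<open>s' \<noteq> 0\<close> at
  the origin. Solving \<open>d\<omega> = \<theta> \<and> \<omega>\<close> gives \<open>\<theta> = - s' dt\<^sub>4\<close>, which is not closed because \<open>s'\<close> is not constant.

  A \<open>(1,1)\<close>-form is \<open>\<alpha> = f \<omega> + \<gamma>\<close> with \<open>\<gamma>\<close> anti-self-dual. By integration by parts (\<open>energy_zero\<close>), \<open>\<alpha>\<close> is
  harmonic for the \<open>delbar\<close>-Laplacian iff \<open>delbar \<alpha> = 0\<close> and \<open>del (* \<alpha>) = 0\<close>. As the type decomposition of
  \<open>1\<close>-forms is that into eigenspaces of \<open>J\<close>, the two conditions together amount to the single equation
  \<open>div \<gamma> = \<i> (df - f s' dt\<^sub>4)\<close> (\<open>delbar_harmonic_iff\<close>). The left-hand side is divergence free, hence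
  \<open>\<Delta>f = s' \<partial>\<^sub>4f\<close>, and \<open>f\<close> is constant (\<open>trace_part_constant\<close>). The coefficient \<open>w\<close> of \<open>dt\<^sub>1\<^sub>4 - dt\<^sub>2\<^sub>3\<close> in \<open>\<gamma>\<close>
  then satisfies \<open>\<partial>\<^sub>1w + \<partial>\<^sub>2v - \<partial>\<^sub>3u = - \<i> f s'\<close> with periodic \<open>u, v, w\<close>. Integrating over a period shows that
  \<open>f = 0\<close> unless \<open>s'\<close> has mean zero, that is, unless \<open>k = 0\<close>; in that case \<open>w = - \<i> f s\<close> is a solution.
  What remains is a closed anti-self-dual form. Its coefficients are harmonic functions on a torus and so
  constant (\<open>closed_asd_constant\<close>), and the sign in the action of \<open>\<Gamma>\<close> leaves only the multiples of \<open>dt\<^sub>1\<^sub>2 - dt\<^sub>3\<^sub>4\<close>.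
  So \<open>b\<^sup>-\<close> is \<open>1\<close>, and the number in question is \<open>2\<close> for \<open>k = 0\<close> and \<open>1\<close> for \<open>k = 1\<close>.

  The only analysis in the proof is the divergence theorem on the torus, in the form that a non-negative
  divergence of a periodic vector field vanishes (\<open>divergence_nonneg_zero\<close>).
\<close>

section \<open>Smooth functions and their partial derivatives\<close>

definition pd :: "'a::euclidean_space \<Rightarrow> ('a \<Rightarrow> 'b::real_normed_vector) \<Rightarrow> 'a \<Rightarrow> 'b" where
  "pd v f = (\<lambda>x. frechet_derivative f (at x) v)"

lemma pd_eqI: "(f has_derivative f') (at x) \<Longrightarrow> pd v f x = f' v"
  by (metis frechet_derivative_at pd_def)

lemma has_derivative_pd: "f differentiable (at x) \<Longrightarrow> (f has_derivative (\<lambda>v. pd v f x)) (at x)"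
  using frechet_derivative_works[of f "at x"] by (simp add: pd_def eta_contract_eq)

lemma Ck_on_Suc_pd:
  "Ck_on (Suc k) U f \<longleftrightarrow> (\<forall>x\<in>U. f differentiable (at x)) \<and> (\<forall>v. Ck_on k U (pd v f))"
  by (simp add: pd_def)

declare Ck_on.simps(2) [simp del]

lemma Ck_on_lower: "Ck_on (Suc k) U f \<Longrightarrow> Ck_on k U f"
proof (induction k arbitrary: f)
  case 0
  then show ?case
    by (auto simp: Ck_on_Suc_pd intro!: differentiable_imp_continuous_on differentiable_at_imp_differentiable_on)
next
  case (Suc k)
  then show ?case by (subst Ck_on_Suc_pd) (auto simp: Ck_on_Suc_pd[of "Suc k"])
qed

lemma pd_const: "pd v (\<lambda>x. c) = (\<lambda>x. 0)"
  by (rule ext) (rule pd_eqI, rule has_derivative_const)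

lemma pd_add_at: "f differentiable (at x) \<Longrightarrow> g differentiable (at x) \<Longrightarrow> pd v (\<lambda>x. f x + g x) x = pd v f x + pd v g x"
  by (rule pd_eqI) (intro has_derivative_add has_derivative_pd)

lemma pd_bilinear_at:
  assumes "bounded_bilinear p" "f differentiable (at x)" "g differentiable (at x)"
  shows "pd v (\<lambda>x. p (f x) (g x)) x = p (f x) (pd v g x) + p (pd v f x) (g x)"
  by (rule pd_eqI) (rule bounded_bilinear.FDERIV[OF assms(1) has_derivative_pd has_derivative_pd, OF assms(2,3)])

lemma pd_linear_at:
  assumes "bounded_linear L" "f differentiable (at x)"
  shows "pd v (\<lambda>x. L (f x)) x = L (pd v f x)"
  by (rule pd_eqI) (rule bounded_linear.has_derivative[OF assms(1) has_derivative_pd, OF assms(2)])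

lemma Ck_const: "Ck_on k UNIV (\<lambda>x. c)"
  by (induction k arbitrary: c) (auto simp: Ck_on_Suc_pd pd_const)

lemma Ck_add: "Ck_on k UNIV f \<Longrightarrow> Ck_on k UNIV g \<Longrightarrow> Ck_on k UNIV (\<lambda>x. f x + g x)"
proof (induction k arbitrary: f g)
  case (Suc k)
  then have "pd v (\<lambda>x. f x + g x) = (\<lambda>x. pd v f x + pd v g x)" for v
    by (auto simp: Ck_on_Suc_pd pd_add_at)
  with Suc show ?case by (auto simp: Ck_on_Suc_pd)
qed (auto intro: continuous_intros)

lemma Ck_bilinear:
  assumes "bounded_bilinear p"
  shows "Ck_on k UNIV f \<Longrightarrow> Ck_on k UNIV g \<Longrightarrow> Ck_on k UNIV (\<lambda>x. p (f x) (g x))"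
proof (induction k arbitrary: f g)
  case 0
  then show ?case using bounded_bilinear.continuous_on[OF assms] by auto
next
  case (Suc k)
  then have *: "pd v (\<lambda>x. p (f x) (g x)) = (\<lambda>x. p (f x) (pd v g x) + p (pd v f x) (g x))" for v
    by (auto simp: Ck_on_Suc_pd pd_bilinear_at assms)
  have "Ck_on k UNIV (pd v (\<lambda>x. p (f x) (g x)))" for v
    unfolding * using Suc Ck_on_lower[OF Suc.prems(1)] Ck_on_lower[OF Suc.prems(2)]
    by (auto intro!: Ck_add simp: Ck_on_Suc_pd)
  moreover have "(\<lambda>x. p (f x) (g x)) differentiable (at x)" for x
    using bounded_bilinear.FDERIV[OF assms has_derivative_pd has_derivative_pd, of f x g] Suc.prems
    by (auto simp: Ck_on_Suc_pd intro: differentiableI)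
  ultimately show ?case by (auto simp: Ck_on_Suc_pd)
qed

lemma Ck_linear:
  assumes "bounded_linear L"
  shows "Ck_on k UNIV f \<Longrightarrow> Ck_on k UNIV (\<lambda>x. L (f x))"
proof (induction k arbitrary: f)
  case 0
  then show ?case using bounded_linear.continuous_on[OF assms] by auto
next
  case (Suc k)
  then have "pd v (\<lambda>x. L (f x)) = (\<lambda>x. L (pd v f x))" for v
    by (auto simp: Ck_on_Suc_pd pd_linear_at assms)
  moreover have "(\<lambda>x. L (f x)) differentiable (at x)" for x
    using bounded_linear.has_derivative[OF assms has_derivative_pd, of f x] Suc.prems
    by (auto simp: Ck_on_Suc_pd intro: differentiableI)
  ultimately show ?case using Suc by (auto simp: Ck_on_Suc_pd)
qed

lemma Ck_id_linear:
  assumes "bounded_linear L"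
  shows "Ck_on k UNIV L"
proof (cases k)
  case 0
  then show ?thesis by (auto intro: linear_continuous_on assms)
next
  case (Suc k)
  have "(L has_derivative L) (at x)" for x
    using assms bounded_linear_imp_has_derivative by blast
  then have "pd v L = (\<lambda>x. L v)" "L differentiable (at x)" for v x
    using pd_eqI differentiableI by blast+
  then show ?thesis using Suc Ck_const by (auto simp: Ck_on_Suc_pd)
qed

lemma pd_sin_cos_at:
  fixes g :: "'a::euclidean_space \<Rightarrow> real"
  assumes "g differentiable (at x)"
  shows "pd v (\<lambda>x. sin (g x)) x = cos (g x) * pd v g x"
    "pd v (\<lambda>x. cos (g x)) x = - (sin (g x) * pd v g x)"
proof -
  note g = has_derivative_pd[OF assms]
  show "pd v (\<lambda>x. sin (g x)) x = cos (g x) * pd v g x"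
    by (rule pd_eqI) (auto intro!: derivative_eq_intros g simp: mult.commute)
  show "pd v (\<lambda>x. cos (g x)) x = - (sin (g x) * pd v g x)"
    by (rule pd_eqI) (auto intro!: derivative_eq_intros g simp: mult.commute)
qed

text \<open>
  Up to sign, each of the two functions is the factor that differentiation of the other one produces, so
  the induction treats them together.
\<close>

lemma Ck_sin_cos:
  fixes g :: "'a::euclidean_space \<Rightarrow> real"
  shows "Ck_on k UNIV g \<Longrightarrow> Ck_on k UNIV (\<lambda>x. sin (g x)) \<and> Ck_on k UNIV (\<lambda>x. cos (g x))"
proof (induction k arbitrary: g)
  case (Suc k)
  then have g: "g differentiable (at x)" "Ck_on k UNIV (pd v g)" for x v
    by (auto simp: Ck_on_Suc_pd)
  have "pd v (\<lambda>x. sin (g x)) = (\<lambda>x. cos (g x) * pd v g x)"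
    "pd v (\<lambda>x. cos (g x)) = (\<lambda>x. - (sin (g x) * pd v g x))" for v
    using g pd_sin_cos_at by blast+
  moreover have "(\<lambda>x. sin (g x)) differentiable (at x)" "(\<lambda>x. cos (g x)) differentiable (at x)" for x
    by (auto intro!: differentiableI derivative_eq_intros has_derivative_pd g)
  ultimately show ?case
    using Suc.IH[OF Ck_on_lower[OF Suc.prems]] g
    by (auto simp: Ck_on_Suc_pd
        intro!: Ck_bilinear[OF bounded_bilinear_mult] Ck_linear[OF bounded_linear_minus[OF bounded_linear_ident]])
qed (auto intro!: continuous_intros)

abbreviation smooth :: "('a::euclidean_space \<Rightarrow> 'b::real_normed_vector) \<Rightarrow> bool" where
  "smooth f \<equiv> smooth_on UNIV f"

lemma smooth_differentiable: "smooth f \<Longrightarrow> f differentiable (at x)"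
  unfolding smooth_on_def by (metis Ck_on_Suc_pd UNIV_I)

lemma smooth_pd: "smooth f \<Longrightarrow> smooth (pd v f)"
  unfolding smooth_on_def by (metis Ck_on_Suc_pd)

lemma smooth_continuous: "smooth f \<Longrightarrow> continuous_on A f"
  unfolding smooth_on_def by (metis Ck_on.simps(1) continuous_on_subset subset_UNIV)

lemma smooth_const: "smooth (\<lambda>x. c)"
  by (simp add: smooth_on_def Ck_const)

lemma smooth_add: "smooth f \<Longrightarrow> smooth g \<Longrightarrow> smooth (\<lambda>x. f x + g x)"
  by (simp add: smooth_on_def Ck_add)

lemma smooth_linear: "bounded_linear L \<Longrightarrow> smooth f \<Longrightarrow> smooth (\<lambda>x. L (f x))"
  by (simp add: smooth_on_def Ck_linear)

lemma smooth_id_linear: "bounded_linear L \<Longrightarrow> smooth L"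
  by (simp add: smooth_on_def Ck_id_linear)

lemma smooth_bilinear: "bounded_bilinear p \<Longrightarrow> smooth f \<Longrightarrow> smooth g \<Longrightarrow> smooth (\<lambda>x. p (f x) (g x))"
  by (simp add: smooth_on_def Ck_bilinear)

lemma smooth_mult:
  fixes f g :: "'a::euclidean_space \<Rightarrow> 'b::real_normed_algebra"
  shows "smooth f \<Longrightarrow> smooth g \<Longrightarrow> smooth (\<lambda>x. f x * g x)"
  by (rule smooth_bilinear[OF bounded_bilinear_mult])

lemma smooth_uminus: "smooth f \<Longrightarrow> smooth (\<lambda>x. - f x)"
  by (rule smooth_linear[OF bounded_linear_minus[OF bounded_linear_ident]])

lemma smooth_diff: "smooth f \<Longrightarrow> smooth g \<Longrightarrow> smooth (\<lambda>x. f x - g x)"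
  using smooth_add[OF _ smooth_uminus] by fastforce

lemma smooth_cnj: "smooth f \<Longrightarrow> smooth (\<lambda>x. cnj (f x))"
  by (rule smooth_linear[OF bounded_linear_cnj])

lemma smooth_of_real: "smooth f \<Longrightarrow> smooth (\<lambda>x. of_real (f x) :: complex)"
  by (rule smooth_linear[OF bounded_linear_of_real])

lemma smooth_sin: "smooth (g :: 'a::euclidean_space \<Rightarrow> real) \<Longrightarrow> smooth (\<lambda>x. sin (g x))"
  and smooth_cos: "smooth (g :: 'a::euclidean_space \<Rightarrow> real) \<Longrightarrow> smooth (\<lambda>x. cos (g x))"
  by (simp_all add: smooth_on_def Ck_sin_cos)

lemmas smooth_intros = smooth_const smooth_add smooth_mult smooth_uminus smooth_diff smooth_cnj
  smooth_of_real smooth_sin smooth_cos smooth_pd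

lemma pd_add: "smooth f \<Longrightarrow> smooth g \<Longrightarrow> pd v (\<lambda>x. f x + g x) = (\<lambda>x. pd v f x + pd v g x)"
  by (rule ext) (simp add: pd_add_at smooth_differentiable)

lemma pd_linear: "bounded_linear L \<Longrightarrow> smooth f \<Longrightarrow> pd v (\<lambda>x. L (f x)) = (\<lambda>x. L (pd v f x))"
  by (rule ext) (simp add: pd_linear_at smooth_differentiable)

lemma pd_uminus: "smooth f \<Longrightarrow> pd v (\<lambda>x. - f x) = (\<lambda>x. - pd v f x)"
  by (rule pd_linear[OF bounded_linear_minus[OF bounded_linear_ident]])

lemma pd_diff: "smooth f \<Longrightarrow> smooth g \<Longrightarrow> pd v (\<lambda>x. f x - g x) = (\<lambda>x. pd v f x - pd v g x)"
  using pd_add[of f "\<lambda>x. - g x" v] by (simp add: smooth_uminus pd_uminus)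

lemma pd_mult:
  fixes f g :: "'a::euclidean_space \<Rightarrow> 'b::real_normed_algebra"
  shows "smooth f \<Longrightarrow> smooth g \<Longrightarrow> pd v (\<lambda>x. f x * g x) = (\<lambda>x. f x * pd v g x + pd v f x * g x)"
  by (rule ext) (simp add: pd_bilinear_at[OF bounded_bilinear_mult] smooth_differentiable)

lemma pd_cnj: "smooth f \<Longrightarrow> pd v (\<lambda>x. cnj (f x)) = (\<lambda>x. cnj (pd v f x))"
  by (rule pd_linear[OF bounded_linear_cnj])

lemma pd_of_real: "smooth f \<Longrightarrow> pd v (\<lambda>x. of_real (f x) :: complex) = (\<lambda>x. of_real (pd v f x))"
  by (rule pd_linear[OF bounded_linear_of_real])

lemma pd_sin: "smooth (g :: 'a::euclidean_space \<Rightarrow> real) \<Longrightarrow> pd v (\<lambda>x. sin (g x)) = (\<lambda>x. cos (g x) * pd v g x)"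
  and pd_cos: "smooth (g :: 'a::euclidean_space \<Rightarrow> real) \<Longrightarrow> pd v (\<lambda>x. cos (g x)) = (\<lambda>x. - (sin (g x) * pd v g x))"
  by (rule ext, simp add: pd_sin_cos_at smooth_differentiable)+

lemmas pd_simps = pd_const pd_add pd_uminus pd_diff pd_mult pd_cnj pd_of_real pd_sin pd_cos

text \<open>
  The mean value theorem, used once in each direction. Exchanging \<open>u\<close> and \<open>v\<close> does not change the second
  difference, which is what relates the two mixed derivatives.
\<close>

lemma second_difference_mean_value:
  fixes f :: "'a::euclidean_space \<Rightarrow> real"
  assumes U: "\<And>s t. 0 \<le> s \<Longrightarrow> s \<le> h \<Longrightarrow> 0 \<le> t \<Longrightarrow> t \<le> h \<Longrightarrow> x + s *\<^sub>R u + t *\<^sub>R v \<in> U"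
    and f: "\<And>y. y \<in> U \<Longrightarrow> f differentiable (at y)"
    and f': "\<And>y. y \<in> U \<Longrightarrow> pd u f differentiable (at y)" and h: "0 < h"
  shows "\<exists>s t. 0 \<le> s \<and> s \<le> h \<and> 0 \<le> t \<and> t \<le> h \<and>
    f (x + h *\<^sub>R u + h *\<^sub>R v) - f (x + h *\<^sub>R u) - f (x + h *\<^sub>R v) + f x
      = h * h * pd v (pd u f) (x + s *\<^sub>R u + t *\<^sub>R v)"
proof -
  have line: "((\<lambda>s. g (a + s *\<^sub>R w)) has_real_derivative pd w g (a + s *\<^sub>R w)) (at s)"
    if "g differentiable (at (a + s *\<^sub>R w))" for g :: "'a \<Rightarrow> real" and a w s
  proof -
    have "((\<lambda>s. g (a + s *\<^sub>R w)) has_derivative (\<lambda>r. pd (r *\<^sub>R w) g (a + s *\<^sub>R w))) (at s)"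
      by (rule has_derivative_compose[where f = "\<lambda>s. a + s *\<^sub>R w" and g = g and f' = "\<lambda>r. r *\<^sub>R w"])
         (auto intro!: derivative_eq_intros has_derivative_pd[OF that])
    moreover have "pd (r *\<^sub>R w) g (a + s *\<^sub>R w) = pd w g (a + s *\<^sub>R w) * r" for r
      using has_derivative_linear[OF has_derivative_pd[OF that]] linear_cmul by fastforce
    ultimately show ?thesis by (simp add: has_field_derivative_def)
  qed
  define \<phi> where "\<phi> s = f (x + h *\<^sub>R v + s *\<^sub>R u) - f (x + s *\<^sub>R u)" for s
  have "\<exists>s>0. s < h \<and> \<phi> h - \<phi> 0 = (h - 0) * (pd u f (x + h *\<^sub>R v + s *\<^sub>R u) - pd u f (x + s *\<^sub>R u))"
  proof (rule MVT2[OF h])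
    fix s assume s: "0 \<le> s" "s \<le> h"
    show "(\<phi> has_real_derivative pd u f (x + h *\<^sub>R v + s *\<^sub>R u) - pd u f (x + s *\<^sub>R u)) (at s)"
      unfolding \<phi>_def
      using U[OF s, of h] U[OF s, of 0] h by (intro DERIV_diff line f) (auto simp: algebra_simps)
  qed
  then obtain s where s: "0 < s" "s < h"
    and 1: "\<phi> h - \<phi> 0 = h * (pd u f (x + s *\<^sub>R u + h *\<^sub>R v) - pd u f (x + s *\<^sub>R u))"
    by (auto simp: algebra_simps)
  define \<psi> where "\<psi> t = pd u f (x + s *\<^sub>R u + t *\<^sub>R v)" for t
  have "\<exists>t>0. t < h \<and> \<psi> h - \<psi> 0 = (h - 0) * pd v (pd u f) (x + s *\<^sub>R u + t *\<^sub>R v)"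
    unfolding \<psi>_def using s by (intro MVT2[OF h] line f' U) auto
  then obtain t where t: "0 < t" "t < h" and 2: "\<psi> h - \<psi> 0 = h * pd v (pd u f) (x + s *\<^sub>R u + t *\<^sub>R v)"
    by auto
  have "f (x + h *\<^sub>R u + h *\<^sub>R v) - f (x + h *\<^sub>R u) - f (x + h *\<^sub>R v) + f x = \<phi> h - \<phi> 0"
    by (simp add: \<phi>_def algebra_simps)
  also have "\<dots> = h * h * pd v (pd u f) (x + s *\<^sub>R u + t *\<^sub>R v)"
    using 1 2 by (simp add: \<psi>_def)
  finally show ?thesis using s t by (intro exI[of _ s] exI[of _ t]) auto
qed

text \<open>
  Second differences over parallelograms shrinking to \<open>x\<close> determine both mixed derivatives at \<open>x\<close>, by the
  previous lemma and continuity.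
\<close>

lemma pd_commute_real:
  fixes f :: "'a::euclidean_space \<Rightarrow> real"
  assumes U: "open U" "x \<in> U" and f: "Ck_on 2 U f"
  shows "pd u (pd v f) x = pd v (pd u f) x"
proof (rule ccontr)
  assume ne: "pd u (pd v f) x \<noteq> pd v (pd u f) x"
  define e where "e = \<bar>pd u (pd v f) x - pd v (pd u f) x\<bar> / 2"
  have e: "e > 0" using ne by (simp add: e_def)
  have C: "f differentiable (at y)" "pd w f differentiable (at y)" "continuous_on U (pd w' (pd w f))"
    if "y \<in> U" for y w w'
    using f that by (auto simp: numeral_2_eq_2 Ck_on_Suc_pd)
  have near: "\<exists>d>0. \<forall>y. dist y x < d \<longrightarrow> y \<in> U \<and> \<bar>pd w' (pd w f) y - pd w' (pd w f) x\<bar> < e" for w w'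
  proof -
    obtain d1 where d1: "d1 > 0" "\<And>y. dist y x < d1 \<Longrightarrow> y \<in> U"
      using U by (metis dist_commute mem_ball openE subset_iff)
    obtain d2 where d2: "d2 > 0" "\<And>y. y \<in> U \<Longrightarrow> dist y x < d2 \<Longrightarrow> dist (pd w' (pd w f) y) (pd w' (pd w f) x) < e"
      using C(3)[OF U(2), of w' w] e U(2) unfolding continuous_on_iff by meson
    show ?thesis using d1 d2 by (intro exI[of _ "min d1 d2"]) (auto simp: dist_real_def)
  qed
  obtain d1 where d1: "d1 > 0" "\<And>y. dist y x < d1 \<Longrightarrow> y \<in> U \<and> \<bar>pd u (pd v f) y - pd u (pd v f) x\<bar> < e"
    using near by blast
  obtain d2 where d2: "d2 > 0" "\<And>y. dist y x < d2 \<Longrightarrow> y \<in> U \<and> \<bar>pd v (pd u f) y - pd v (pd u f) x\<bar> < e"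
    using near by blast
  \<comment> \<open>so small that the whole parallelogram lies within the distances \<open>d1\<close> and \<open>d2\<close> of \<open>x\<close>\<close>
  define h where "h = min d1 d2 / (2 * (norm u + norm v + 1))"
  have h: "h > 0" using d1(1) d2(1) by (auto simp: h_def intro!: divide_pos_pos add_nonneg_pos)
  have small: "dist (x + s *\<^sub>R p + t *\<^sub>R q) x < min d1 d2"
    if "0 \<le> s" "s \<le> h" "0 \<le> t" "t \<le> h" "norm p + norm q = norm u + norm v" for s t p q
  proof -
    have "dist (x + s *\<^sub>R p + t *\<^sub>R q) x \<le> norm (s *\<^sub>R p) + norm (t *\<^sub>R q)"
      using norm_triangle_ineq[of "s *\<^sub>R p" "t *\<^sub>R q"] by (simp add: dist_norm add.assoc)
    also have "\<dots> \<le> h * norm p + h * norm q"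
      using that by (auto intro!: add_mono mult_right_mono)
    also have "\<dots> = h * (norm u + norm v)"
      using that by (metis distrib_left)
    also have "\<dots> \<le> h * (norm u + norm v + 1)" using h by simp
    also have "\<dots> = min d1 d2 / 2"
    proof -
      have "norm u + norm v + 1 > 0" by (intro add_nonneg_pos) auto
      then show ?thesis unfolding h_def by (simp add: field_simps)
    qed
    also have "\<dots> < min d1 d2" using d1(1) d2(1) by auto
    finally show ?thesis .
  qed
  obtain s t where st: "0 \<le> s" "s \<le> h" "0 \<le> t" "t \<le> h"
    "f (x + h *\<^sub>R u + h *\<^sub>R v) - f (x + h *\<^sub>R u) - f (x + h *\<^sub>R v) + f x
      = h * h * pd v (pd u f) (x + s *\<^sub>R u + t *\<^sub>R v)"
  proof -
    have "x + s *\<^sub>R u + t *\<^sub>R v \<in> U" if "0 \<le> s" "s \<le> h" "0 \<le> t" "t \<le> h" for s t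
      using d1(2) small[OF that, of u v] by auto
    from second_difference_mean_value[OF this C(1) C(2) h] show thesis using that by blast
  qed
  obtain s' t' where st': "0 \<le> s'" "s' \<le> h" "0 \<le> t'" "t' \<le> h"
    "f (x + h *\<^sub>R v + h *\<^sub>R u) - f (x + h *\<^sub>R v) - f (x + h *\<^sub>R u) + f x
      = h * h * pd u (pd v f) (x + s' *\<^sub>R v + t' *\<^sub>R u)"
  proof -
    have "x + s *\<^sub>R v + t *\<^sub>R u \<in> U" if "0 \<le> s" "s \<le> h" "0 \<le> t" "t \<le> h" for s t
      using d1(2) small[OF that, of v u] by auto
    from second_difference_mean_value[OF this C(1) C(2) h] show thesis using that by blast
  qed
  have "x + h *\<^sub>R v + h *\<^sub>R u = x + h *\<^sub>R u + h *\<^sub>R v" by simp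
  then have "h * h * pd v (pd u f) (x + s *\<^sub>R u + t *\<^sub>R v) = h * h * pd u (pd v f) (x + s' *\<^sub>R v + t' *\<^sub>R u)"
    using st(5) st'(5) by (simp add: algebra_simps)
  then have "pd v (pd u f) (x + s *\<^sub>R u + t *\<^sub>R v) = pd u (pd v f) (x + s' *\<^sub>R v + t' *\<^sub>R u)"
    using h by simp
  moreover have "\<bar>pd v (pd u f) (x + s *\<^sub>R u + t *\<^sub>R v) - pd v (pd u f) x\<bar> < e"
    using d2(2) small[OF st(1-4)] by auto
  moreover have "\<bar>pd u (pd v f) (x + s' *\<^sub>R v + t' *\<^sub>R u) - pd u (pd v f) x\<bar> < e"
    using d1(2) small[OF st'(1-4)] by auto
  moreover have "2 * e = \<bar>pd u (pd v f) x - pd v (pd u f) x\<bar>" by (simp add: e_def)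
  ultimately show False by linarith
qed

text \<open>
  Applied to each coordinate of \<open>f\<close>, the real case gives the general one.
\<close>

lemma pd_commute_on:
  fixes f :: "'a::euclidean_space \<Rightarrow> 'b::euclidean_space"
  assumes U: "open U" "x \<in> U" and f: "Ck_on 2 U f"
  shows "pd u (pd v f) x = pd v (pd u f) x"
proof (rule euclidean_eqI)
  fix b :: 'b
  have C: "f differentiable (at y)" "pd w f differentiable (at y)" "continuous_on U (pd w' (pd w f))"
    if "y \<in> U" for y w w'
    using f that by (auto simp: numeral_2_eq_2 Ck_on_Suc_pd)
  have L: "bounded_linear (\<lambda>z. z \<bullet> b)" by (rule bounded_linear_inner_left)
  let ?g = "\<lambda>y. f y \<bullet> b"
  have 1: "pd w ?g y = pd w f y \<bullet> b" if "y \<in> U" for w y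
    using pd_linear_at[OF L C(1)[OF that]] .
  have loc: "(pd w ?g has_derivative (\<lambda>w'. pd w' (pd w f) y \<bullet> b)) (at y)" if "y \<in> U" for w y
    using bounded_linear.has_derivative[OF L has_derivative_pd[OF C(2)[OF that, of w]]]
    by (rule has_derivative_transform_within_open[OF _ U(1) that]) (simp add: 1)
  have 2: "pd w' (pd w ?g) y = pd w' (pd w f) y \<bullet> b" if "y \<in> U" for w w' y
    by (rule pd_eqI[OF loc[OF that]])
  have "Ck_on 2 U ?g"
    unfolding numeral_2_eq_2 Ck_on_Suc_pd Ck_on.simps(1)
  proof (intro conjI allI ballI)
    fix y w w' assume y: "y \<in> U"
    show "?g differentiable (at y)"
      using bounded_linear.has_derivative[OF L has_derivative_pd[OF C(1)[OF y]]] differentiableI by blast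
    show "pd w ?g differentiable (at y)" using loc[OF y] differentiableI by blast
  next
    fix w w'
    have "continuous_on U (\<lambda>y. pd w' (pd w f) y \<bullet> b)"
      by (intro continuous_intros C(3)[OF U(2)])
    then show "continuous_on U (pd w' (pd w ?g))"
      by (rule continuous_on_eq) (simp add: 2)
  qed
  from pd_commute_real[OF U this] show "pd u (pd v f) x \<bullet> b = pd v (pd u f) x \<bullet> b"
    by (simp add: 2[OF U(2)])
qed

lemma pd_commute:
  fixes f :: "'a::euclidean_space \<Rightarrow> 'b::euclidean_space"
  shows "smooth f \<Longrightarrow> pd u (pd v f) = pd v (pd u f)"
  by (rule ext) (auto simp: smooth_on_def intro!: pd_commute_on[of UNIV])

section \<open>Periodic functions and the divergence theorem on a torus\<close>

definition e1 :: pt where "e1 = (1, 0)"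
definition e2 :: pt where "e2 = (\<i>, 0)"
definition e3 :: pt where "e3 = (0, 1)"
definition e4 :: pt where "e4 = (0, \<i>)"

text \<open>
  The translations by \<open>2e\<^sub>i\<close> generate a lattice of finite index in \<open>\<Gamma>\<close> which acts without twisting, so
  the coefficients of the lift of a form on \<open>M\<close> in the coordinate frame are periodic in this sense.
\<close>

definition periodic :: "(pt \<Rightarrow> 'b::real_normed_vector) \<Rightarrow> bool" where
  "periodic f \<longleftrightarrow> smooth f \<and> (\<forall>x. \<forall>e\<in>{e1, e2, e3, e4}. f (x + 2 *\<^sub>R e) = f x)"

lemma periodic_smooth: "periodic f \<Longrightarrow> smooth f"
  by (simp add: periodic_def)

lemma periodicD: "periodic f \<Longrightarrow> e \<in> {e1, e2, e3, e4} \<Longrightarrow> f (x + 2 *\<^sub>R e) = f x"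
  unfolding periodic_def by blast

lemma periodic_const: "periodic (\<lambda>x. c)"
  by (simp add: periodic_def smooth_const)

lemma periodic_add: "periodic f \<Longrightarrow> periodic g \<Longrightarrow> periodic (\<lambda>x. f x + g x)"
  by (simp add: periodic_def smooth_add)

lemma periodic_diff: "periodic f \<Longrightarrow> periodic g \<Longrightarrow> periodic (\<lambda>x. f x - g x)"
  by (simp add: periodic_def smooth_diff)

lemma periodic_uminus: "periodic f \<Longrightarrow> periodic (\<lambda>x. - f x)"
  by (simp add: periodic_def smooth_uminus)

lemma periodic_mult:
  fixes f g :: "pt \<Rightarrow> 'b::real_normed_algebra"
  shows "periodic f \<Longrightarrow> periodic g \<Longrightarrow> periodic (\<lambda>x. f x * g x)"
  by (simp add: periodic_def smooth_mult)

lemma periodic_linear: "bounded_linear L \<Longrightarrow> periodic f \<Longrightarrow> periodic (\<lambda>x. L (f x))"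
  by (simp add: periodic_def smooth_linear)

lemma periodic_cnj: "periodic f \<Longrightarrow> periodic (\<lambda>x. cnj (f x))"
  by (rule periodic_linear[OF bounded_linear_cnj])

lemma periodic_of_real: "periodic f \<Longrightarrow> periodic (\<lambda>x. of_real (f x) :: complex)"
  by (rule periodic_linear[OF bounded_linear_of_real])

lemma pd_translate:
  assumes "smooth f" "\<And>x. f (x + a) = f x"
  shows "pd v f (x + a) = pd v f x"
proof -
  have "((\<lambda>y. f (y + a)) has_derivative (\<lambda>v. pd v f (x + a))) (at x)"
    by (rule has_derivative_compose[where f = "\<lambda>y. y + a" and g = f and f' = "\<lambda>r. r"])
       (auto intro!: derivative_eq_intros has_derivative_pd smooth_differentiable assms(1))
  then show ?thesis
    using pd_eqI[of "\<lambda>y. f (y + a)" "\<lambda>v. pd v f (x + a)" x v] assms(2) by simp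
qed

lemma periodic_pd: "periodic f \<Longrightarrow> periodic (pd v f)"
  using pd_translate unfolding periodic_def by (metis smooth_pd)

lemmas periodic_intros = periodic_const periodic_add periodic_diff periodic_uminus periodic_mult
  periodic_cnj periodic_of_real periodic_pd

text \<open>The parametrisation of \<open>G\<close> by four real coordinates; the product type makes Fubini applicable.\<close>

definition R4_pt :: "real \<times> real \<times> real \<times> real \<Rightarrow> pt" where
  "R4_pt = (\<lambda>(a, b, c, d). (Complex a b, Complex c d))"

lemma R4_pt_expand: "R4_pt (a, b, c, d) = a *\<^sub>R e1 + b *\<^sub>R e2 + c *\<^sub>R e3 + d *\<^sub>R e4"
  by (simp add: R4_pt_def e1_def e2_def e3_def e4_def complex_eq_iff)

lemma continuous_R4_pt: "continuous_on A R4_pt"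
proof -
  have *: "R4_pt = (\<lambda>z. fst z *\<^sub>R e1 + fst (snd z) *\<^sub>R e2 + fst (snd (snd z)) *\<^sub>R e3 + snd (snd (snd z)) *\<^sub>R e4)"
    by (rule ext) (metis R4_pt_expand prod.collapse)
  show ?thesis unfolding * by (intro continuous_intros)
qed

lemma integral_prod_zero_right:
  fixes F :: "'a::euclidean_space \<times> 'b::euclidean_space \<Rightarrow> real"
  assumes "continuous_on UNIV F" "\<And>x. integral (cbox c d) (\<lambda>y. F (x, y)) = 0"
  shows "integral (cbox (a, c) (b, d)) F = 0"
  using integral_prod_continuous[OF continuous_on_subset[OF assms(1)], of a c b d] assms(2) by simp

lemma integral_prod_zero_left:
  fixes F :: "'a::euclidean_space \<times> 'b::euclidean_space \<Rightarrow> real"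
  assumes "continuous_on UNIV F" "\<And>y. integral (cbox a b) (\<lambda>x. F (x, y)) = 0"
  shows "integral (cbox (a, c) (b, d)) F = 0"
proof -
  have "integral (cbox (a, c) (b, d)) F = integral (cbox a b) (\<lambda>x. integral (cbox c d) (\<lambda>y. F (x, y)))"
    using integral_prod_continuous[OF continuous_on_subset[OF assms(1)], of a c b d] by simp
  also have "\<dots> = integral (cbox c d) (\<lambda>y. integral (cbox a b) (\<lambda>x. F (x, y)))"
    using integral_swap_continuous[of a c b d "\<lambda>x y. F (x, y)"] continuous_on_subset[OF assms(1)] by auto
  finally show ?thesis using assms(2) by simp
qed

lemma integral_pd_line_zero:
  fixes V :: "pt \<Rightarrow> real"
  assumes V: "smooth V" and per: "V (a + 2 *\<^sub>R w) = V a"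
  shows "integral (cbox 0 2) (\<lambda>t. pd w V (a + t *\<^sub>R w)) = 0"
proof -
  have "((\<lambda>t. V (a + t *\<^sub>R w)) has_vector_derivative pd w V (a + t *\<^sub>R w)) (at t within {0..2})" for t
  proof -
    have "((\<lambda>s. V (a + s *\<^sub>R w)) has_derivative (\<lambda>r. pd (r *\<^sub>R w) V (a + t *\<^sub>R w))) (at t within {0..2})"
      by (rule has_derivative_compose[where f = "\<lambda>s. a + s *\<^sub>R w" and g = V and f' = "\<lambda>r. r *\<^sub>R w"])
         (auto intro!: derivative_eq_intros has_derivative_pd smooth_differentiable V)
    moreover have "pd (r *\<^sub>R w) V (a + t *\<^sub>R w) = r *\<^sub>R pd w V (a + t *\<^sub>R w)" for r
      using has_derivative_linear[OF has_derivative_pd[OF smooth_differentiable[OF V]]] linear_cmul by fastforce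
    ultimately show ?thesis by (simp add: has_vector_derivative_def)
  qed
  then have "((\<lambda>t. pd w V (a + t *\<^sub>R w)) has_integral (V (a + 2 *\<^sub>R w) - V (a + 0 *\<^sub>R w))) {0..2}"
    by (intro fundamental_theorem_of_calculus) auto
  then show ?thesis using per by (simp add: integral_unique)
qed

abbreviation "cell \<equiv> cbox (0 :: real, 0 :: real, 0 :: real, 0 :: real) (2, 2, 2, 2)"

lemma integral_pd_cell:
  fixes V :: "pt \<Rightarrow> real"
  assumes V: "periodic V" and e: "e \<in> {e1, e2, e3, e4}"
  shows "integral cell (\<lambda>z. pd e V (R4_pt z)) = 0"
proof -
  have line: "integral (cbox 0 2) (\<lambda>t. pd e V (a + t *\<^sub>R e)) = 0" for a
    by (intro integral_pd_line_zero periodic_smooth[OF V] periodicD[OF V e])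
  have cont: "continuous_on UNIV (\<lambda>z. pd e V (R4_pt (g z)))" if "continuous_on UNIV g"
    for g :: "'c::topological_space \<Rightarrow> _"
    by (rule continuous_on_compose2[OF smooth_continuous[OF smooth_pd[OF periodic_smooth[OF V]]]
            continuous_on_compose2[OF continuous_R4_pt that]]) auto
  have c0: "continuous_on UNIV (\<lambda>z. pd e V (R4_pt z))"
    by (rule cont[of "\<lambda>z. z"]) (rule continuous_on_id)
  have c1: "continuous_on UNIV (\<lambda>z. pd e V (R4_pt (a, z)))" for a
    by (rule cont) (intro continuous_intros)
  have c2: "continuous_on UNIV (\<lambda>z. pd e V (R4_pt (a, b, z)))" for a b
    by (rule cont) (intro continuous_intros)
  consider "e = e1" | "e = e2" | "e = e3" | "e = e4" using e by auto
  then show ?thesis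
  proof cases
    case 1
    have *: "R4_pt (t, y) = R4_pt (0, y) + t *\<^sub>R e" for t y
      by (cases y) (simp add: R4_pt_expand 1)
    show ?thesis
      by (rule integral_prod_zero_left[OF c0]) (subst *, rule line)
  next
    case 2
    have *: "R4_pt (a, t, y) = R4_pt (a, 0, y) + t *\<^sub>R e" for a t y
      by (cases y) (simp add: R4_pt_expand 2)
    show ?thesis
      by (rule integral_prod_zero_right[OF c0], rule integral_prod_zero_left[OF c1]) (subst *, rule line)
  next
    case 3
    have *: "R4_pt (a, b, t, d) = R4_pt (a, b, 0, d) + t *\<^sub>R e" for a b t d
      by (simp add: R4_pt_expand 3)
    show ?thesis
      by (rule integral_prod_zero_right[OF c0], rule integral_prod_zero_right[OF c1],
          rule integral_prod_zero_left[OF c2]) (subst *, rule line)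
  next
    case 4
    have *: "R4_pt (a, b, c, t) = R4_pt (a, b, c, 0) + t *\<^sub>R e" for a b c t
      by (simp add: R4_pt_expand 4)
    show ?thesis
      by (rule integral_prod_zero_right[OF c0], rule integral_prod_zero_right[OF c1],
          rule integral_prod_zero_right[OF c2]) (subst *, rule line)
  qed
qed

lemma periodic_int:
  assumes "periodic f" "e \<in> {e1, e2, e3, e4}"
  shows "f (x + (2 * of_int n) *\<^sub>R e) = f x"
proof (induction n rule: int_induct[of _ 0])
  case (step1 i)
  have "x + (2 * of_int (i + 1)) *\<^sub>R e = (x + (2 * of_int i) *\<^sub>R e) + 2 *\<^sub>R e"
    by (simp add: algebra_simps)
  then show ?case using step1 assms by (metis periodic_def)
next
  case (step2 i)
  have "(x + (2 * of_int (i - 1)) *\<^sub>R e) + 2 *\<^sub>R e = x + (2 * of_int i) *\<^sub>R e"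
    by (simp add: algebra_simps)
  then show ?case using step2 assms by (metis periodic_def)
qed simp

lemma periodic_determined_on_cell:
  assumes f: "periodic f" and P: "\<And>z. z \<in> cell \<Longrightarrow> f (R4_pt z) = c"
  shows "f x = c"
proof -
  define r :: "real \<Rightarrow> real" where "r t = t + 2 * of_int (- \<lfloor>t / 2\<rfloor>)" for t
  have r: "0 \<le> r t" "r t \<le> 2" for t unfolding r_def by (auto simp: field_simps) linarith+
  obtain a b c' d where x: "x = R4_pt (a, b, c', d)"
    by (cases x) (metis R4_pt_def case_prod_conv complex_surj)
  have "f x = f (R4_pt (a, b, c', d) + (2 * of_int (- \<lfloor>a / 2\<rfloor>)) *\<^sub>R e1 + (2 * of_int (- \<lfloor>b / 2\<rfloor>)) *\<^sub>R e2
    + (2 * of_int (- \<lfloor>c' / 2\<rfloor>)) *\<^sub>R e3 + (2 * of_int (- \<lfloor>d / 2\<rfloor>)) *\<^sub>R e4)"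
    by (simp only: x periodic_int[OF f] insert_iff simp_thms)
  also have "\<dots> = f (R4_pt (r a, r b, r c', r d))"
    by (rule arg_cong[of _ _ f]) (simp add: R4_pt_expand r_def algebra_simps)
  also have "\<dots> = c" by (rule P) (simp add: r)
  finally show ?thesis .
qed

text \<open>
  Each of the four terms integrates to \<open>0\<close> over a period cell, by the fundamental theorem of calculus
  along its own coordinate; a continuous non-negative function with integral \<open>0\<close> vanishes.
\<close>

lemma divergence_nonneg_zero_real:
  fixes V1 V2 V3 V4 :: "pt \<Rightarrow> real"
  assumes V: "periodic V1" "periodic V2" "periodic V3" "periodic V4"
    and nonneg: "\<And>x. 0 \<le> pd e1 V1 x + pd e2 V2 x + pd e3 V3 x + pd e4 V4 x"
  shows "pd e1 V1 x + pd e2 V2 x + pd e3 V3 x + pd e4 V4 x = 0"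
proof -
  let ?q = "\<lambda>x. pd e1 V1 x + pd e2 V2 x + pd e3 V3 x + pd e4 V4 x"
  have cont: "continuous_on A (\<lambda>z. pd e V (R4_pt z))" if "periodic V" for A e and V :: "pt \<Rightarrow> real"
    by (rule continuous_on_compose2[OF smooth_continuous[OF smooth_pd[OF periodic_smooth[OF that]]] continuous_R4_pt]) auto
  have int: "(\<lambda>z. pd e V (R4_pt z)) integrable_on cell" if "periodic V" for e and V :: "pt \<Rightarrow> real"
    by (rule integrable_continuous[OF cont[OF that]])
  have zero: "((\<lambda>z. pd e V (R4_pt z)) has_integral 0) cell" if "periodic V" "e \<in> {e1, e2, e3, e4}"
    for e and V :: "pt \<Rightarrow> real"
    using integral_pd_cell[OF that] int[OF that(1)] by (metis has_integral_integrable_integral)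
  have "((\<lambda>z. pd e1 V1 (R4_pt z) + pd e2 V2 (R4_pt z) + pd e3 V3 (R4_pt z) + pd e4 V4 (R4_pt z))
      has_integral 0 + 0 + 0 + 0) cell"
    by (intro has_integral_add zero V) auto
  then have I: "((\<lambda>z. ?q (R4_pt z)) has_integral 0) cell" by simp
  have "?q (R4_pt z) = 0" if "z \<in> cell" for z
  proof (rule has_integral_0_cbox_imp_0[OF _ _ I _ that])
    show "continuous_on cell (\<lambda>z. ?q (R4_pt z))" by (intro continuous_intros cont V)
    have "(1, 1, 1, 1) \<in> box (0 :: real, 0 :: real, 0 :: real, 0 :: real) (2, 2, 2, 2)"
      by (simp add: mem_box Basis_prod_def)
    then show "box (0 :: real, 0 :: real, 0 :: real, 0 :: real) (2, 2, 2, 2) \<noteq> {}" by blast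
  qed (rule nonneg)
  moreover have "periodic ?q" using V by (intro periodic_intros)
  ultimately show ?thesis using periodic_determined_on_cell[of ?q 0 x] by blast
qed

text \<open>
  Every vanishing result below is an instance of this lemma: a sum of squares that can be written as
  the divergence of a periodic vector field has integral \<open>0\<close> over a period, hence vanishes.
\<close>

lemma divergence_nonneg_zero:
  fixes V1 V2 V3 V4 :: "pt \<Rightarrow> complex"
  assumes V: "periodic V1" "periodic V2" "periodic V3" "periodic V4"
    and eq: "\<And>x. Re (pd e1 V1 x + pd e2 V2 x + pd e3 V3 x + pd e4 V4 x) = q x" and nonneg: "\<And>x. 0 \<le> q x"
  shows "q x = 0"
proof -
  have R: "pd e (\<lambda>x. Re (V x)) x = Re (pd e V x)" if "periodic V" for e V x
    using pd_linear[OF bounded_linear_Re periodic_smooth[OF that]] by meson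
  show ?thesis
    using divergence_nonneg_zero_real[of "\<lambda>x. Re (V1 x)" "\<lambda>x. Re (V2 x)" "\<lambda>x. Re (V3 x)" "\<lambda>x. Re (V4 x)" x]
    by (simp add: R V periodic_linear[OF bounded_linear_Re] nonneg eq[simplified])
qed

section \<open>Forms in coordinates\<close>

definition X1 :: "pt \<Rightarrow> real" where "X1 v = Re (fst v)"
definition X2 :: "pt \<Rightarrow> real" where "X2 v = Im (fst v)"
definition X3 :: "pt \<Rightarrow> real" where "X3 v = Re (snd v)"
definition X4 :: "pt \<Rightarrow> real" where "X4 v = Im (snd v)"

lemma X_linear [simp]:
  "X1 (u + v) = X1 u + X1 v" "X2 (u + v) = X2 u + X2 v" "X3 (u + v) = X3 u + X3 v" "X4 (u + v) = X4 u + X4 v"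
  "X1 (r *\<^sub>R v) = r * X1 v" "X2 (r *\<^sub>R v) = r * X2 v" "X3 (r *\<^sub>R v) = r * X3 v" "X4 (r *\<^sub>R v) = r * X4 v"
  "X1 (- v) = - X1 v" "X2 (- v) = - X2 v" "X3 (- v) = - X3 v" "X4 (- v) = - X4 v"
  by (simp_all add: X1_def X2_def X3_def X4_def)

lemma X_diff [simp]:
  "X1 (u - v) = X1 u - X1 v" "X2 (u - v) = X2 u - X2 v" "X3 (u - v) = X3 u - X3 v" "X4 (u - v) = X4 u - X4 v"
  by (simp_all add: X1_def X2_def X3_def X4_def)

lemma X_basis [simp]:
  "X1 e1 = 1" "X2 e1 = 0" "X3 e1 = 0" "X4 e1 = 0" "X1 e2 = 0" "X2 e2 = 1" "X3 e2 = 0" "X4 e2 = 0"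
  "X1 e3 = 0" "X2 e3 = 0" "X3 e3 = 1" "X4 e3 = 0" "X1 e4 = 0" "X2 e4 = 0" "X3 e4 = 0" "X4 e4 = 1"
  by (simp_all add: X1_def X2_def X3_def X4_def e1_def e2_def e3_def e4_def)

lemma pt_expand: "v = X1 v *\<^sub>R e1 + X2 v *\<^sub>R e2 + X3 v *\<^sub>R e3 + X4 v *\<^sub>R e4"
  by (simp add: X1_def X2_def X3_def X4_def e1_def e2_def e3_def e4_def complex_eq_iff prod_eq_iff)

lemma pt_eqI: "X1 u = X1 v \<Longrightarrow> X2 u = X2 v \<Longrightarrow> X3 u = X3 v \<Longrightarrow> X4 u = X4 v \<Longrightarrow> u = v"
  by (simp add: X1_def X2_def X3_def X4_def complex_eq_iff prod_eq_iff)

lemma linear_expand: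
  fixes f :: "pt \<Rightarrow> 'b::real_vector"
  assumes "linear f"
  shows "f v = X1 v *\<^sub>R f e1 + X2 v *\<^sub>R f e2 + X3 v *\<^sub>R f e3 + X4 v *\<^sub>R f e4"
  by (subst pt_expand[of v]) (simp only: linear_add[OF assms] linear_cmul[OF assms])

lemma linear_pd: "smooth f \<Longrightarrow> linear (\<lambda>v. pd v f x)"
  using has_derivative_linear[OF has_derivative_pd[OF smooth_differentiable]] .

lemma pd_expand:
  fixes f :: "pt \<Rightarrow> complex"
  assumes "smooth f"
  shows "pd v f x = of_real (X1 v) * pd e1 f x + of_real (X2 v) * pd e2 f x
    + of_real (X3 v) * pd e3 f x + of_real (X4 v) * pd e4 f x"
  using linear_expand[OF linear_pd[OF assms], of v x] by (simp add: scaleR_conv_of_real)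

text \<open>
  Alternating forms on one tangent space, by their coefficients. The coefficients of a \<open>3\<close>-form are
  those of the vector whose contraction with the volume form it is.
\<close>

definition minor2 :: "(pt \<Rightarrow> real) \<Rightarrow> (pt \<Rightarrow> real) \<Rightarrow> pt \<Rightarrow> pt \<Rightarrow> real" where
  "minor2 f g u v = f u * g v - f v * g u"

definition minor3 :: "(pt \<Rightarrow> real) \<Rightarrow> (pt \<Rightarrow> real) \<Rightarrow> (pt \<Rightarrow> real) \<Rightarrow> pt \<Rightarrow> pt \<Rightarrow> pt \<Rightarrow> real" where
  "minor3 f g h u v w = f u * minor2 g h v w - f v * minor2 g h u w + f w * minor2 g h u v"

definition alt1 :: "complex \<Rightarrow> complex \<Rightarrow> complex \<Rightarrow> complex \<Rightarrow> pt \<Rightarrow> complex" where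
  "alt1 b1 b2 b3 b4 u = b1 * X1 u + b2 * X2 u + b3 * X3 u + b4 * X4 u"

definition alt2 :: "complex \<Rightarrow> complex \<Rightarrow> complex \<Rightarrow> complex \<Rightarrow> complex \<Rightarrow> complex \<Rightarrow> pt \<Rightarrow> pt \<Rightarrow> complex" where
  "alt2 a12 a13 a14 a23 a24 a34 u v =
     a12 * minor2 X1 X2 u v + a13 * minor2 X1 X3 u v + a14 * minor2 X1 X4 u v
     + a23 * minor2 X2 X3 u v + a24 * minor2 X2 X4 u v + a34 * minor2 X3 X4 u v"

definition alt3 :: "complex \<Rightarrow> complex \<Rightarrow> complex \<Rightarrow> complex \<Rightarrow> pt \<Rightarrow> pt \<Rightarrow> pt \<Rightarrow> complex" where
  "alt3 t1 t2 t3 t4 u v w =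
     t1 * minor3 X2 X3 X4 u v w - t2 * minor3 X1 X3 X4 u v w
     + t3 * minor3 X1 X2 X4 u v w - t4 * minor3 X1 X2 X3 u v w"

type_synonym cfun = "pt \<Rightarrow> complex"

definition form1 :: "cfun \<Rightarrow> cfun \<Rightarrow> cfun \<Rightarrow> cfun \<Rightarrow> form" where
  "form1 b1 b2 b3 b4 = (\<lambda>x vs. if length vs = 1 then alt1 (b1 x) (b2 x) (b3 x) (b4 x) (vs ! 0) else 0)"

definition form2 :: "cfun \<Rightarrow> cfun \<Rightarrow> cfun \<Rightarrow> cfun \<Rightarrow> cfun \<Rightarrow> cfun \<Rightarrow> form" where
  "form2 a12 a13 a14 a23 a24 a34 = (\<lambda>x vs. if length vs = 2
     then alt2 (a12 x) (a13 x) (a14 x) (a23 x) (a24 x) (a34 x) (vs ! 0) (vs ! 1) else 0)"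

definition form3 :: "cfun \<Rightarrow> cfun \<Rightarrow> cfun \<Rightarrow> cfun \<Rightarrow> form" where
  "form3 t1 t2 t3 t4 = (\<lambda>x vs. if length vs = 3
     then alt3 (t1 x) (t2 x) (t3 x) (t4 x) (vs ! 0) (vs ! 1) (vs ! 2) else 0)"

lemmas alt_defs = alt1_def alt2_def alt3_def minor2_def minor3_def

lemma list_cases_length:
  "length vs = 1 \<Longrightarrow> \<exists>u. vs = [u]" "length vs = 2 \<Longrightarrow> \<exists>u v. vs = [u, v]"
  "length vs = 3 \<Longrightarrow> \<exists>u v w. vs = [u, v, w]" "length vs = 4 \<Longrightarrow> \<exists>u v w z. vs = [u, v, w, z]"
  by (auto simp: length_Suc_conv eval_nat_numeral)

lemma form_eval [simp]:
  "form1 b1 b2 b3 b4 x [u] = alt1 (b1 x) (b2 x) (b3 x) (b4 x) u"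
  "form2 a12 a13 a14 a23 a24 a34 x [u, v] = alt2 (a12 x) (a13 x) (a14 x) (a23 x) (a24 x) (a34 x) u v"
  "form3 t1 t2 t3 t4 x [u, v, w] = alt3 (t1 x) (t2 x) (t3 x) (t4 x) u v w"
  by (simp_all add: form1_def form2_def form3_def)

lemma form_wrong_length:
  "length vs \<noteq> 1 \<Longrightarrow> form1 b1 b2 b3 b4 x vs = 0"
  "length vs \<noteq> 2 \<Longrightarrow> form2 a12 a13 a14 a23 a24 a34 x vs = 0"
  "length vs \<noteq> 3 \<Longrightarrow> form3 t1 t2 t3 t4 x vs = 0"
  by (simp_all add: form1_def form2_def form3_def)

lemma form_eqI1:
  assumes "\<And>x vs. length vs \<noteq> 1 \<Longrightarrow> \<alpha> x vs = 0" "\<And>x u. \<alpha> x [u] = alt1 (b1 x) (b2 x) (b3 x) (b4 x) u"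
  shows "\<alpha> = form1 b1 b2 b3 b4"
proof (intro ext)
  fix x vs show "\<alpha> x vs = form1 b1 b2 b3 b4 x vs"
  proof (cases "length vs = 1")
    case True
    then obtain u where "vs = [u]" using list_cases_length(1) by blast
    then show ?thesis using assms(2) by simp
  qed (simp add: assms(1) form_wrong_length)
qed

lemma form_eqI2:
  assumes "\<And>x vs. length vs \<noteq> 2 \<Longrightarrow> \<alpha> x vs = 0"
    "\<And>x u v. \<alpha> x [u, v] = alt2 (a12 x) (a13 x) (a14 x) (a23 x) (a24 x) (a34 x) u v"
  shows "\<alpha> = form2 a12 a13 a14 a23 a24 a34"
proof (intro ext)
  fix x vs show "\<alpha> x vs = form2 a12 a13 a14 a23 a24 a34 x vs"
  proof (cases "length vs = 2")
    case True
    then obtain u v where "vs = [u, v]" using list_cases_length(2) by blast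
    then show ?thesis using assms(2) by simp
  qed (simp add: assms(1) form_wrong_length)
qed

lemma form_eqI3:
  assumes "\<And>x vs. length vs \<noteq> 3 \<Longrightarrow> \<alpha> x vs = 0"
    "\<And>x u v w. \<alpha> x [u, v, w] = alt3 (t1 x) (t2 x) (t3 x) (t4 x) u v w"
  shows "\<alpha> = form3 t1 t2 t3 t4"
proof (intro ext)
  fix x vs show "\<alpha> x vs = form3 t1 t2 t3 t4 x vs"
  proof (cases "length vs = 3")
    case True
    then obtain u v w where "vs = [u, v, w]" using list_cases_length(3) by blast
    then show ?thesis using assms(2) by simp
  qed (simp add: assms(1) form_wrong_length)
qed

lemma form2_coeffs:
  "form2 a12 a13 a14 a23 a24 a34 x [e1, e2] = a12 x" "form2 a12 a13 a14 a23 a24 a34 x [e1, e3] = a13 x"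
  "form2 a12 a13 a14 a23 a24 a34 x [e1, e4] = a14 x" "form2 a12 a13 a14 a23 a24 a34 x [e2, e3] = a23 x"
  "form2 a12 a13 a14 a23 a24 a34 x [e2, e4] = a24 x" "form2 a12 a13 a14 a23 a24 a34 x [e3, e4] = a34 x"
  by (simp_all add: alt_defs)

lemma form2_eq_iff:
  "form2 a12 a13 a14 a23 a24 a34 = form2 b12 b13 b14 b23 b24 b34 \<longleftrightarrow>
     a12 = b12 \<and> a13 = b13 \<and> a14 = b14 \<and> a23 = b23 \<and> a24 = b24 \<and> a34 = b34"
proof
  assume eq: "form2 a12 a13 a14 a23 a24 a34 = form2 b12 b13 b14 b23 b24 b34"
  show "a12 = b12 \<and> a13 = b13 \<and> a14 = b14 \<and> a23 = b23 \<and> a24 = b24 \<and> a34 = b34"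
    by (intro conjI ext) (metis eq form2_coeffs)+
qed simp

lemma form_zero:
  "form1 (\<lambda>x. 0) (\<lambda>x. 0) (\<lambda>x. 0) (\<lambda>x. 0) = 0"
  "form2 (\<lambda>x. 0) (\<lambda>x. 0) (\<lambda>x. 0) (\<lambda>x. 0) (\<lambda>x. 0) (\<lambda>x. 0) = 0"
  "form3 (\<lambda>x. 0) (\<lambda>x. 0) (\<lambda>x. 0) (\<lambda>x. 0) = 0"
  by (auto simp: form1_def form2_def form3_def alt1_def alt2_def alt3_def fun_eq_iff)

lemma form_uminus:
  "- form1 b1 b2 b3 b4 = form1 (\<lambda>x. - b1 x) (\<lambda>x. - b2 x) (\<lambda>x. - b3 x) (\<lambda>x. - b4 x)"
  "- form2 a12 a13 a14 a23 a24 a34 =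
     form2 (\<lambda>x. - a12 x) (\<lambda>x. - a13 x) (\<lambda>x. - a14 x) (\<lambda>x. - a23 x) (\<lambda>x. - a24 x) (\<lambda>x. - a34 x)"
  by (auto simp: form1_def form2_def alt1_def alt2_def fun_eq_iff)

lemma kform_length: "kform k \<alpha> \<Longrightarrow> length vs \<noteq> k \<Longrightarrow> \<alpha> x vs = 0"
  and kform_linear: "kform k \<alpha> \<Longrightarrow> length vs = k \<Longrightarrow> i < k \<Longrightarrow> linear (\<lambda>v. \<alpha> x (vs[i := v]))"
  and kform_alternating:
    "kform k \<alpha> \<Longrightarrow> length vs = k \<Longrightarrow> i < j \<Longrightarrow> j < k \<Longrightarrow> vs ! i = vs ! j \<Longrightarrow> \<alpha> x vs = 0"
  and kform_smooth: "kform k \<alpha> \<Longrightarrow> smooth (\<lambda>x. \<alpha> x vs)"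
  unfolding kform_def by blast+

text \<open>Polarisation turns the vanishing on repeated arguments into skew-symmetry.\<close>

lemma kform2_form2:
  assumes "kform 2 \<alpha>"
  shows "\<alpha> = form2 (\<lambda>x. \<alpha> x [e1, e2]) (\<lambda>x. \<alpha> x [e1, e3]) (\<lambda>x. \<alpha> x [e1, e4])
    (\<lambda>x. \<alpha> x [e2, e3]) (\<lambda>x. \<alpha> x [e2, e4]) (\<lambda>x. \<alpha> x [e3, e4])"
proof (rule form_eqI2)
  show "\<alpha> x vs = 0" if "length vs \<noteq> 2" for x vs
    using assms that by (rule kform_length)
  fix x u v
  have l: "linear (\<lambda>p. \<alpha> x [p, v])" for v using kform_linear[OF assms, of "[v, v]" 0 x] by simp
  have r: "linear (\<lambda>p. \<alpha> x [u, p])" for u using kform_linear[OF assms, of "[u, u]" 1 x] by simp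
  have alt: "\<alpha> x [p, p] = 0" for p using kform_alternating[OF assms, of "[p, p]" 0 1 x] by simp
  have skew: "\<alpha> x [p, q] = - \<alpha> x [q, p]" for p q
  proof -
    have "\<alpha> x [p + q, p + q] = (\<alpha> x [p, p] + \<alpha> x [p, q]) + (\<alpha> x [q, p] + \<alpha> x [q, q])"
      unfolding linear_add[OF l] linear_add[OF r] by (simp only: ac_simps)
    then have "0 = \<alpha> x [p, q] + \<alpha> x [q, p]" unfolding alt by simp
    then show ?thesis by (metis eq_neg_iff_add_eq_0)
  qed
  have L: "\<alpha> x [u, v] = X1 u *\<^sub>R \<alpha> x [e1, v] + X2 u *\<^sub>R \<alpha> x [e2, v] + X3 u *\<^sub>R \<alpha> x [e3, v] + X4 u *\<^sub>R \<alpha> x [e4, v]" for u v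
    by (rule linear_expand[OF l])
  have R: "\<alpha> x [u, v] = X1 v *\<^sub>R \<alpha> x [u, e1] + X2 v *\<^sub>R \<alpha> x [u, e2] + X3 v *\<^sub>R \<alpha> x [u, e3] + X4 v *\<^sub>R \<alpha> x [u, e4]" for u v
    by (rule linear_expand[OF r])
  show "\<alpha> x [u, v] = alt2 (\<alpha> x [e1, e2]) (\<alpha> x [e1, e3]) (\<alpha> x [e1, e4]) (\<alpha> x [e2, e3]) (\<alpha> x [e2, e4]) (\<alpha> x [e3, e4]) u v"
    unfolding L[of u v] R[of e1 v] R[of e2 v] R[of e3 v] R[of e4 v]
    by (simp add: alt skew[of e2 e1] skew[of e3 e1] skew[of e4 e1] skew[of e3 e2] skew[of e4 e2] skew[of e4 e3]
        alt2_def minor2_def scaleR_conv_of_real algebra_simps)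
qed

lemma kform_form2:
  assumes "smooth a12" "smooth a13" "smooth a14" "smooth a23" "smooth a24" "smooth a34"
  shows "kform 2 (form2 a12 a13 a14 a23 a24 a34)"
proof -
  let ?f = "form2 a12 a13 a14 a23 a24 a34"
  have sm: "smooth (\<lambda>x. ?f x vs)" for vs
    using assms by (cases "length vs = 2") (auto simp: form2_def alt2_def intro!: smooth_intros)
  have lin: "linear (\<lambda>v. ?f x (vs[i := v]))" if vs: "length vs = 2" "i < 2" for x vs i
  proof -
    obtain p q where "vs = [p, q]" using list_cases_length(2)[OF vs(1)] by blast
    moreover have "linear (\<lambda>v. ?f x [v, q])" "linear (\<lambda>v. ?f x [p, v])"
      by (rule linearI; simp add: alt_defs algebra_simps scaleR_conv_of_real)+
    moreover have "i = 0 \<or> i = 1" using vs(2) by auto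
    ultimately show ?thesis by auto
  qed
  have alt: "?f x vs = 0" if vs: "length vs = 2" "i < j" "j < 2" "vs ! i = vs ! j" for x vs i j
  proof -
    obtain p q where pq: "vs = [p, q]" using list_cases_length(2)[OF vs(1)] by blast
    have ij: "i = 0" "j = 1" using vs(2,3) by linarith+
    have "p = q" using vs(4) unfolding pq ij by simp
    then show ?thesis unfolding pq by (simp add: alt_defs)
  qed
  have len: "?f x vs = 0" if "length vs \<noteq> 2" for x vs by (rule form_wrong_length(2)[OF that])
  show ?thesis unfolding kform_def using sm lin alt len by blast
qed

lemma ext_d_pd: "ext_d \<alpha> x vs = (\<Sum>i<length vs. (-1) ^ i * pd (vs ! i) (\<lambda>y. \<alpha> y (take i vs @ drop (Suc i) vs)) x)"
  by (simp add: ext_d_def pd_def)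

lemma ext_d_degree:
  assumes "\<And>x vs. length vs \<noteq> k \<Longrightarrow> \<alpha> x vs = 0" "length vs \<noteq> Suc k"
  shows "ext_d \<alpha> x vs = 0"
  unfolding ext_d_pd
proof (rule sum.neutral, rule ballI)
  fix i assume "i \<in> {..<length vs}"
  then have "length (take i vs @ drop (Suc i) vs) \<noteq> k" using assms(2) by auto
  then have "(\<lambda>y. \<alpha> y (take i vs @ drop (Suc i) vs)) = (\<lambda>y. 0)" using assms(1) by blast
  then show "(-1) ^ i * pd (vs ! i) (\<lambda>y. \<alpha> y (take i vs @ drop (Suc i) vs)) x = 0" by (simp add: pd_const)
qed

lemma ext_d_eval1: "ext_d \<alpha> x [u, v] = pd u (\<lambda>y. \<alpha> y [v]) x - pd v (\<lambda>y. \<alpha> y [u]) x"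
  by (simp add: ext_d_pd lessThan_Suc eval_nat_numeral)

lemma ext_d_eval2:
  "ext_d \<alpha> x [u, v, w] = pd u (\<lambda>y. \<alpha> y [v, w]) x - pd v (\<lambda>y. \<alpha> y [u, w]) x + pd w (\<lambda>y. \<alpha> y [u, v]) x"
  by (simp add: ext_d_pd lessThan_Suc eval_nat_numeral)

lemma ext_d_zero: "ext_d 0 = 0"
  by (intro ext) (simp add: ext_d_pd pd_const)

lemma pd_mult_right: "smooth f \<Longrightarrow> pd v (\<lambda>y. f y * c) = (\<lambda>y. pd v f y * c)" for f :: cfun
  by (simp add: pd_mult smooth_const pd_const)

lemma ext_d_form1:
  assumes b: "smooth b1" "smooth b2" "smooth b3" "smooth b4"
  shows "ext_d (form1 b1 b2 b3 b4) = form2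
    (\<lambda>x. pd e1 b2 x - pd e2 b1 x) (\<lambda>x. pd e1 b3 x - pd e3 b1 x) (\<lambda>x. pd e1 b4 x - pd e4 b1 x)
    (\<lambda>x. pd e2 b3 x - pd e3 b2 x) (\<lambda>x. pd e2 b4 x - pd e4 b2 x) (\<lambda>x. pd e3 b4 x - pd e4 b3 x)"
proof (rule form_eqI2)
  show "ext_d (form1 b1 b2 b3 b4) x vs = 0" if "length vs \<noteq> 2" for x vs
    using that by (intro ext_d_degree[of 1]) (auto simp: form_wrong_length)
  have *: "pd u (\<lambda>y. form1 b1 b2 b3 b4 y [v]) x = alt1 (pd u b1 x) (pd u b2 x) (pd u b3 x) (pd u b4 x) v" for x u v
    by (simp add: alt1_def pd_add pd_mult_right b smooth_intros)
  show "ext_d (form1 b1 b2 b3 b4) x [u, v] = alt2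
    (pd e1 b2 x - pd e2 b1 x) (pd e1 b3 x - pd e3 b1 x) (pd e1 b4 x - pd e4 b1 x)
    (pd e2 b3 x - pd e3 b2 x) (pd e2 b4 x - pd e4 b2 x) (pd e3 b4 x - pd e4 b3 x) u v" for x u v
    unfolding ext_d_eval1 *
    unfolding pd_expand[OF b(1), of u] pd_expand[OF b(2), of u] pd_expand[OF b(3), of u] pd_expand[OF b(4), of u]
      pd_expand[OF b(1), of v] pd_expand[OF b(2), of v] pd_expand[OF b(3), of v] pd_expand[OF b(4), of v]
    by (simp add: alt_defs algebra_simps)
qed

lemma ext_d_form2:
  assumes a: "smooth a12" "smooth a13" "smooth a14" "smooth a23" "smooth a24" "smooth a34"
  shows "ext_d (form2 a12 a13 a14 a23 a24 a34) = form3
    (\<lambda>x. pd e2 a34 x - pd e3 a24 x + pd e4 a23 x) (\<lambda>x. - pd e1 a34 x + pd e3 a14 x - pd e4 a13 x)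
    (\<lambda>x. pd e1 a24 x - pd e2 a14 x + pd e4 a12 x) (\<lambda>x. - pd e1 a23 x + pd e2 a13 x - pd e3 a12 x)"
proof (rule form_eqI3)
  let ?f = "form2 a12 a13 a14 a23 a24 a34"
  show "ext_d ?f x vs = 0" if "length vs \<noteq> 3" for x vs
    using that by (intro ext_d_degree[of 2]) (auto simp: form_wrong_length)
  have *: "pd p (\<lambda>y. ?f y [u, v]) x =
      alt2 (pd p a12 x) (pd p a13 x) (pd p a14 x) (pd p a23 x) (pd p a24 x) (pd p a34 x) u v" for x p u v
    by (simp add: alt2_def pd_add pd_mult_right a smooth_intros)
  show "ext_d ?f x [u, v, w] = alt3
    (pd e2 a34 x - pd e3 a24 x + pd e4 a23 x) (- pd e1 a34 x + pd e3 a14 x - pd e4 a13 x)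
    (pd e1 a24 x - pd e2 a14 x + pd e4 a12 x) (- pd e1 a23 x + pd e2 a13 x - pd e3 a12 x) u v w" for x u v w
    unfolding ext_d_eval2 *
    unfolding pd_expand[OF a(1), of u] pd_expand[OF a(2), of u] pd_expand[OF a(3), of u]
      pd_expand[OF a(4), of u] pd_expand[OF a(5), of u] pd_expand[OF a(6), of u]
      pd_expand[OF a(1), of v] pd_expand[OF a(2), of v] pd_expand[OF a(3), of v]
      pd_expand[OF a(4), of v] pd_expand[OF a(5), of v] pd_expand[OF a(6), of v]
      pd_expand[OF a(1), of w] pd_expand[OF a(2), of w] pd_expand[OF a(3), of w]
      pd_expand[OF a(4), of w] pd_expand[OF a(5), of w] pd_expand[OF a(6), of w]
    by (simp add: alt_defs algebra_simps)
qed

section \<open>Bidegree in coordinates\<close>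

lemma sum_Pow_insert:
  assumes "finite A" "a \<notin> A"
  shows "(\<Sum>B\<in>Pow (insert a A). f B) = (\<Sum>B\<in>Pow A. f B) + (\<Sum>B\<in>Pow A. f (insert a B))"
proof -
  have "inj_on (insert a) (Pow A)" using assms(2) by (fastforce simp: inj_on_def)
  moreover have "Pow A \<inter> insert a ` Pow A = {}" using assms(2) by auto
  ultimately show ?thesis
    unfolding Pow_insert using assms(1) by (subst sum.union_disjoint) (auto simp: sum.reindex)
qed

lemma sum_card_eq:
  assumes "finite U"
  shows "(\<Sum>A | A \<subseteq> U \<and> card A = p. f A) = (\<Sum>A\<in>Pow U. if card A = p then f A else 0)"
  using sum.inter_filter[of "Pow U" f "\<lambda>A. card A = p"] assms by (simp add: Collect_conj_eq Pow_def)

lemmas small_set_simps = lessThan_Suc atMost_Suc sum_Pow_insert sum_card_eq card_insert_if eval_nat_numeral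

lemma cx_ext_eval:
  "cx_ext \<alpha> x [w] = \<alpha> x [fst w] + \<i> * \<alpha> x [snd w]"
  "cx_ext \<alpha> x [w, z] = \<alpha> x [fst w, fst z] + \<i> * \<alpha> x [snd w, fst z] + \<i> * \<alpha> x [fst w, snd z] - \<alpha> x [snd w, snd z]"
  "cx_ext \<alpha> x [w, z, y] = \<alpha> x [fst w, fst z, fst y]
     + \<i> * (\<alpha> x [snd w, fst z, fst y] + \<alpha> x [fst w, snd z, fst y] + \<alpha> x [fst w, fst z, snd y])
     - (\<alpha> x [snd w, snd z, fst y] + \<alpha> x [snd w, fst z, snd y] + \<alpha> x [fst w, snd z, snd y])
     - \<i> * \<alpha> x [snd w, snd z, snd y]"
  by (simp_all add: cx_ext_def small_set_simps upt_rec algebra_simps)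

lemma cx_ext_degree:
  assumes "\<And>x vs. length vs \<noteq> k \<Longrightarrow> \<alpha> x vs = 0" "length ws \<noteq> k"
  shows "cx_ext \<alpha> x ws = 0"
  using assms by (simp add: cx_ext_def)

lemma bideg_proj_degree:
  assumes "\<And>x vs. length vs \<noteq> k \<Longrightarrow> \<alpha> x vs = 0" "p + q \<noteq> k"
  shows "bideg_proj J p q \<alpha> = 0"
proof (intro ext)
  fix x vs
  have "cx_ext \<alpha> x (map f [0..<p + q]) = 0" for f
    using assms(2) by (intro cx_ext_degree[OF assms(1)]) simp_all
  then show "bideg_proj J p q \<alpha> x vs = 0 x vs" by (simp add: bideg_proj_def)
qed

lemma bideg_proj_zero: "bideg_proj J p q 0 = 0"
  by (intro ext) (simp add: bideg_proj_def cx_ext_def)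

lemma bideg_proj_length: "length vs \<noteq> p + q \<Longrightarrow> bideg_proj J p q \<alpha> x vs = 0"
  by (simp add: bideg_proj_def)

lemmas part_defs = part10_def part01_def

lemma alt_linear:
  "alt1 b1 b2 b3 b4 (r *\<^sub>R u) = r * alt1 b1 b2 b3 b4 u"
  "alt1 b1 b2 b3 b4 (- u) = - alt1 b1 b2 b3 b4 u"
  "alt2 a12 a13 a14 a23 a24 a34 (r *\<^sub>R u) v = r * alt2 a12 a13 a14 a23 a24 a34 u v"
  "alt2 a12 a13 a14 a23 a24 a34 u (r *\<^sub>R v) = r * alt2 a12 a13 a14 a23 a24 a34 u v"
  "alt2 a12 a13 a14 a23 a24 a34 (- u) v = - alt2 a12 a13 a14 a23 a24 a34 u v"
  "alt2 a12 a13 a14 a23 a24 a34 u (- v) = - alt2 a12 a13 a14 a23 a24 a34 u v"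
  "alt3 t1 t2 t3 t4 (r *\<^sub>R u) v w = r * alt3 t1 t2 t3 t4 u v w"
  "alt3 t1 t2 t3 t4 u (r *\<^sub>R v) w = r * alt3 t1 t2 t3 t4 u v w"
  "alt3 t1 t2 t3 t4 u v (r *\<^sub>R w) = r * alt3 t1 t2 t3 t4 u v w"
  "alt3 t1 t2 t3 t4 (- u) v w = - alt3 t1 t2 t3 t4 u v w"
  "alt3 t1 t2 t3 t4 u (- v) w = - alt3 t1 t2 t3 t4 u v w"
  "alt3 t1 t2 t3 t4 u v (- w) = - alt3 t1 t2 t3 t4 u v w"
  by (simp_all add: alt_defs algebra_simps)

lemma bideg_proj_form1:
  "bideg_proj J 1 0 (form1 b1 b2 b3 b4) x [u] =
     (alt1 (b1 x) (b2 x) (b3 x) (b4 x) u - \<i> * alt1 (b1 x) (b2 x) (b3 x) (b4 x) (J x u)) / 2"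
  "bideg_proj J 0 1 (form1 b1 b2 b3 b4) x [u] =
     (alt1 (b1 x) (b2 x) (b3 x) (b4 x) u + \<i> * alt1 (b1 x) (b2 x) (b3 x) (b4 x) (J x u)) / 2"
  by (simp_all add: bideg_proj_def small_set_simps upt_rec cx_ext_eval part_defs alt_linear field_simps)

lemma bideg_proj_form2:
  fixes a12 a13 a14 a23 a24 a34 x
  defines "A \<equiv> alt2 (a12 x) (a13 x) (a14 x) (a23 x) (a24 x) (a34 x)"
  shows
  "bideg_proj J 1 1 (form2 a12 a13 a14 a23 a24 a34) x [u, v] = (A u v + A (J x u) (J x v)) / 2"
  "bideg_proj J 2 0 (form2 a12 a13 a14 a23 a24 a34) x [u, v] =
     (A u v - A (J x u) (J x v) - \<i> * (A (J x u) v + A u (J x v))) / 4"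
  "bideg_proj J 0 2 (form2 a12 a13 a14 a23 a24 a34) x [u, v] =
     (A u v - A (J x u) (J x v) + \<i> * (A (J x u) v + A u (J x v))) / 4"
  unfolding A_def
  by (simp_all add: bideg_proj_def small_set_simps upt_rec cx_ext_eval part_defs alt_linear field_simps)

lemma bideg_proj_form3:
  fixes t1 t2 t3 t4 x
  defines "T \<equiv> alt3 (t1 x) (t2 x) (t3 x) (t4 x)"
  shows
  "bideg_proj J 1 2 (form3 t1 t2 t3 t4) x [u, v, w] =
     (3 * T u v w + \<i> * (T (J x u) v w + T u (J x v) w + T u v (J x w))
      + (T (J x u) (J x v) w + T (J x u) v (J x w) + T u (J x v) (J x w))
      + 3 * \<i> * T (J x u) (J x v) (J x w)) / 8"
  "bideg_proj J 2 1 (form3 t1 t2 t3 t4) x [u, v, w] =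
     (3 * T u v w - \<i> * (T (J x u) v w + T u (J x v) w + T u v (J x w))
      + (T (J x u) (J x v) w + T (J x u) v (J x w) + T u (J x v) (J x w))
      - 3 * \<i> * T (J x u) (J x v) (J x w)) / 8"
  unfolding T_def
  by (simp_all add: bideg_proj_def small_set_simps upt_rec cx_ext_eval part_defs alt_linear field_simps)

text \<open>
  A form of pure type has only one non-zero component, so the double sums that define \<open>del\<close> and \<open>delbar\<close>
  reduce to one term each.
\<close>

lemma del_delbar_of_type_11:
  assumes "\<And>x vs. length vs \<noteq> 2 \<Longrightarrow> \<alpha> x vs = 0"
    "bideg_proj J 1 1 \<alpha> = \<alpha>" "bideg_proj J 2 0 \<alpha> = 0" "bideg_proj J 0 2 \<alpha> = 0"
  shows "del J \<alpha> = bideg_proj J 2 1 (ext_d \<alpha>)" "delbar J \<alpha> = bideg_proj J 1 2 (ext_d \<alpha>)"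
proof -
  have z: "bideg_proj J p q \<alpha> = 0" if "p + q \<noteq> 2" for p q
    using bideg_proj_degree[OF assms(1) that] .
  note a = assms(2-4)[unfolded One_nat_def numeral_2_eq_2]
  show "del J \<alpha> = bideg_proj J 2 1 (ext_d \<alpha>)" "delbar J \<alpha> = bideg_proj J 1 2 (ext_d \<alpha>)"
    by (simp_all add: del_def delbar_def numeral_2_eq_2 z a ext_d_zero bideg_proj_zero)
qed

lemma delbar_of_type_10:
  assumes "\<And>x vs. length vs \<noteq> 1 \<Longrightarrow> \<beta> x vs = 0" "bideg_proj J 1 0 \<beta> = \<beta>" "bideg_proj J 0 1 \<beta> = 0"
  shows "delbar J \<beta> = bideg_proj J 1 1 (ext_d \<beta>)"
proof -
  have z: "bideg_proj J p q \<beta> = 0" if "p + q \<noteq> 1" for p q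
    using bideg_proj_degree[OF assms(1) that] .
  note a = assms(2,3)[unfolded One_nat_def]
  show ?thesis
    by (simp add: delbar_def numeral_2_eq_2 z a ext_d_zero bideg_proj_zero)
qed

lemma del_of_type_01:
  assumes "\<And>x vs. length vs \<noteq> 1 \<Longrightarrow> \<beta> x vs = 0" "bideg_proj J 0 1 \<beta> = \<beta>" "bideg_proj J 1 0 \<beta> = 0"
  shows "del J \<beta> = bideg_proj J 1 1 (ext_d \<beta>)"
proof -
  have z: "bideg_proj J p q \<beta> = 0" if "p + q \<noteq> 1" for p q
    using bideg_proj_degree[OF assms(1) that] .
  note a = assms(2,3)[unfolded One_nat_def]
  show ?thesis
    by (simp add: del_def numeral_2_eq_2 z a ext_d_zero bideg_proj_zero)
qed

lemma hodge_zero: "hodge J \<omega> 0 = 0"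
  by (intro ext) (simp add: hodge_def Let_def)

section \<open>A circle of orthogonal almost complex structures\<close>

text \<open>
  \<open>Jst c S\<close> is the combination \<open>c I + S K\<close> of two anticommuting orthogonal complex structures of \<open>\<real>\<^sup>4\<close>,
  multiplication by \<open>\<i>\<close> and \<open>K (z, w) = (- cnj w, cnj z)\<close>. It is an orthogonal almost complex structure where
  \<open>c\<^sup>2 + S\<^sup>2 = 1\<close>, and \<open>om c S\<close> is its fundamental form for the Euclidean metric.
\<close>

definition Jst :: "(pt \<Rightarrow> real) \<Rightarrow> (pt \<Rightarrow> real) \<Rightarrow> endo" where
  "Jst c S x v = (of_real (c x) * \<i> * fst v - of_real (S x) * cnj (snd v),
                  of_real (c x) * \<i> * snd v + of_real (S x) * cnj (fst v))"

definition om :: "(pt \<Rightarrow> real) \<Rightarrow> (pt \<Rightarrow> real) \<Rightarrow> form" where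
  "om c S = form2 (\<lambda>x. of_real (c x)) (\<lambda>x. of_real (S x)) (\<lambda>x. 0) (\<lambda>x. 0) (\<lambda>x. - of_real (S x)) (\<lambda>x. of_real (c x))"

lemma X_Jst [simp]:
  "X1 (Jst c S x v) = - (c x * X2 v) - S x * X3 v" "X2 (Jst c S x v) = c x * X1 v + S x * X4 v"
  "X3 (Jst c S x v) = S x * X1 v - c x * X4 v" "X4 (Jst c S x v) = c x * X3 v - S x * X2 v"
  by (simp_all add: Jst_def X1_def X2_def X3_def X4_def)

lemma minor2_Jst:
  fixes c S x u v
  defines "m f g \<equiv> minor2 f g u v" and "n f g \<equiv> minor2 f g (Jst c S x u) (Jst c S x v)"
  shows
  "n X1 X2 = (c x)\<^sup>2 * m X1 X2 + c x * S x * (m X1 X3 - m X2 X4) - (S x)\<^sup>2 * m X3 X4"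
  "n X1 X3 = (S x)\<^sup>2 * m X1 X3 + c x * S x * (m X1 X2 + m X3 X4) + (c x)\<^sup>2 * m X2 X4"
  "n X1 X4 = - ((c x)\<^sup>2 + (S x)\<^sup>2) * m X2 X3"
  "n X2 X3 = - ((c x)\<^sup>2 + (S x)\<^sup>2) * m X1 X4"
  "n X2 X4 = (c x)\<^sup>2 * m X1 X3 - c x * S x * (m X1 X2 + m X3 X4) + (S x)\<^sup>2 * m X2 X4"
  "n X3 X4 = (c x)\<^sup>2 * m X3 X4 + c x * S x * (m X1 X3 - m X2 X4) - (S x)\<^sup>2 * m X1 X2"
  unfolding m_def n_def by (simp_all add: minor2_def algebra_simps power2_eq_square)

lemma alt1_Jst:
  "alt1 b1 b2 b3 b4 (Jst c S x u) =
     alt1 (c x * b2 + S x * b3) (- (c x * b1) - S x * b4) (c x * b4 - S x * b1) (S x * b2 - c x * b3) u"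
  by (simp add: alt1_def algebra_simps)

lemma alt3_Jst_derivation:
  "alt3 t1 t2 t3 t4 (Jst c S x u) v w + alt3 t1 t2 t3 t4 u (Jst c S x v) w + alt3 t1 t2 t3 t4 u v (Jst c S x w) =
     alt3 (c x * t2 + S x * t3) (- (c x * t1) - S x * t4) (c x * t4 - S x * t1) (S x * t2 - c x * t3) u v w"
  by (simp add: alt_defs algebra_simps)


lemma Jst_Jst:
  assumes "(c x)\<^sup>2 + (S x)\<^sup>2 = 1"
  shows "Jst c S x (Jst c S x v) = - v"
proof -
  have SS: "S x * S x = 1 - c x * c x" using assms by (simp add: power2_eq_square algebra_simps)
  have SSy: "S x * (S x * y) = y - c x * (c x * y)" for y
    by (simp only: mult.assoc[symmetric] SS left_diff_distrib mult_1)
  show ?thesis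
    by (intro pt_eqI) (simp_all add: algebra_simps SS SSy)
qed

text \<open>
  The sum of \<open>f \<omega>\<close>, for \<open>\<omega> = om c S\<close>, and the anti-self-dual form with coefficients \<open>u, v, w\<close> with respect to
  \<open>dt\<^sub>1\<^sub>2 - dt\<^sub>3\<^sub>4\<close>, \<open>dt\<^sub>1\<^sub>3 + dt\<^sub>2\<^sub>4\<close>, \<open>dt\<^sub>1\<^sub>4 - dt\<^sub>2\<^sub>3\<close>. By \<open>bideg_form2\<close> below, these are the forms of type \<open>(1,1)\<close>.
\<close>

definition form11 :: "(pt \<Rightarrow> real) \<Rightarrow> (pt \<Rightarrow> real) \<Rightarrow> cfun \<Rightarrow> cfun \<Rightarrow> cfun \<Rightarrow> cfun \<Rightarrow> form" where
  "form11 c S f u v w = form2 (\<lambda>x. f x * c x + u x) (\<lambda>x. f x * S x + v x) w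
     (\<lambda>x. - w x) (\<lambda>x. v x - f x * S x) (\<lambda>x. f x * c x - u x)"

text \<open>
  The coefficients of \<open>(b + k (b \<circ> J)) / 2\<close> for a \<open>1\<close>-form \<open>b\<close>, which is its \<open>(1,0)\<close>-part for \<open>k = - \<i>\<close> and its
  \<open>(0,1)\<close>-part for \<open>k = \<i>\<close>. The same combinations serve for \<open>3\<close>-forms, written as contractions of the volume
  form.
\<close>

definition tp1 :: "complex \<Rightarrow> (pt \<Rightarrow> real) \<Rightarrow> (pt \<Rightarrow> real) \<Rightarrow> cfun \<Rightarrow> cfun \<Rightarrow> cfun \<Rightarrow> cfun \<Rightarrow> cfun" where
  "tp1 k c S b1 b2 b3 b4 = (\<lambda>x. (b1 x + k * (c x * b2 x + S x * b3 x)) / 2)"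
definition tp2 :: "complex \<Rightarrow> (pt \<Rightarrow> real) \<Rightarrow> (pt \<Rightarrow> real) \<Rightarrow> cfun \<Rightarrow> cfun \<Rightarrow> cfun \<Rightarrow> cfun \<Rightarrow> cfun" where
  "tp2 k c S b1 b2 b3 b4 = (\<lambda>x. (b2 x - k * (c x * b1 x + S x * b4 x)) / 2)"
definition tp3 :: "complex \<Rightarrow> (pt \<Rightarrow> real) \<Rightarrow> (pt \<Rightarrow> real) \<Rightarrow> cfun \<Rightarrow> cfun \<Rightarrow> cfun \<Rightarrow> cfun \<Rightarrow> cfun" where
  "tp3 k c S b1 b2 b3 b4 = (\<lambda>x. (b3 x + k * (c x * b4 x - S x * b1 x)) / 2)"
definition tp4 :: "complex \<Rightarrow> (pt \<Rightarrow> real) \<Rightarrow> (pt \<Rightarrow> real) \<Rightarrow> cfun \<Rightarrow> cfun \<Rightarrow> cfun \<Rightarrow> cfun \<Rightarrow> cfun" where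
  "tp4 k c S b1 b2 b3 b4 = (\<lambda>x. (b4 x + k * (S x * b2 x - c x * b3 x)) / 2)"

lemmas tp_defs = tp1_def tp2_def tp3_def tp4_def

definition form1_type :: "complex \<Rightarrow> (pt \<Rightarrow> real) \<Rightarrow> (pt \<Rightarrow> real) \<Rightarrow> cfun \<Rightarrow> cfun \<Rightarrow> cfun \<Rightarrow> cfun \<Rightarrow> form" where
  "form1_type k c S b1 b2 b3 b4 = form1 (tp1 k c S b1 b2 b3 b4) (tp2 k c S b1 b2 b3 b4)
     (tp3 k c S b1 b2 b3 b4) (tp4 k c S b1 b2 b3 b4)"

definition form3_type :: "complex \<Rightarrow> (pt \<Rightarrow> real) \<Rightarrow> (pt \<Rightarrow> real) \<Rightarrow> cfun \<Rightarrow> cfun \<Rightarrow> cfun \<Rightarrow> cfun \<Rightarrow> form" where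
  "form3_type k c S b1 b2 b3 b4 = form3 (tp1 k c S b1 b2 b3 b4) (tp2 k c S b1 b2 b3 b4)
     (tp3 k c S b1 b2 b3 b4) (tp4 k c S b1 b2 b3 b4)"

lemma bideg_form1:
  "bideg_proj (Jst c S) 1 0 (form1 b1 b2 b3 b4) = form1_type (- \<i>) c S b1 b2 b3 b4"
  "bideg_proj (Jst c S) 0 1 (form1 b1 b2 b3 b4) = form1_type \<i> c S b1 b2 b3 b4"
  unfolding form1_type_def
proof (rule_tac [!] form_eqI1)
  note s = tp_defs alt1_def algebra_simps add_divide_distrib diff_divide_distrib
  show "bideg_proj (Jst c S) 1 0 (form1 b1 b2 b3 b4) x [u] = alt1 (tp1 (- \<i>) c S b1 b2 b3 b4 x)
      (tp2 (- \<i>) c S b1 b2 b3 b4 x) (tp3 (- \<i>) c S b1 b2 b3 b4 x) (tp4 (- \<i>) c S b1 b2 b3 b4 x) u" for x u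
    unfolding bideg_proj_form1 alt1_Jst by (simp add: s)
  show "bideg_proj (Jst c S) 0 1 (form1 b1 b2 b3 b4) x [u] = alt1 (tp1 \<i> c S b1 b2 b3 b4 x)
      (tp2 \<i> c S b1 b2 b3 b4 x) (tp3 \<i> c S b1 b2 b3 b4 x) (tp4 \<i> c S b1 b2 b3 b4 x) u" for x u
    unfolding bideg_proj_form1 alt1_Jst by (simp add: s)
qed (simp_all add: bideg_proj_length)

context
  fixes c S :: "pt \<Rightarrow> real"
  assumes cs: "\<And>x. (c x)\<^sup>2 + (S x)\<^sup>2 = 1"
begin

lemma cs_complex:
  "complex_of_real (S x) * complex_of_real (S x) = 1 - complex_of_real (c x) * complex_of_real (c x)"
  "complex_of_real (S x) * (complex_of_real (S x) * y) = y - complex_of_real (c x) * (complex_of_real (c x) * y)"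
proof -
  show *: "complex_of_real (S x) * complex_of_real (S x) = 1 - complex_of_real (c x) * complex_of_real (c x)"
    using arg_cong[OF cs[of x], of complex_of_real] by (simp add: power2_eq_square algebra_simps)
  show "complex_of_real (S x) * (complex_of_real (S x) * y) = y - complex_of_real (c x) * (complex_of_real (c x) * y)"
    by (simp only: mult.assoc[symmetric] * left_diff_distrib mult_1)
qed

text \<open>
  As \<open>J\<^sup>2 = - 1\<close>, the maps \<open>b \<mapsto> (b + k (b \<circ> J)) / 2\<close> for \<open>k = \<i>\<close> and \<open>k = - \<i>\<close> are complementary projections.
\<close>

lemma tp_idem:
  fixes b1 b2 b3 b4 :: cfun
  assumes "k * k = - 1"
  defines "q1 \<equiv> tp1 k c S b1 b2 b3 b4" and "q2 \<equiv> tp2 k c S b1 b2 b3 b4"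
    and "q3 \<equiv> tp3 k c S b1 b2 b3 b4" and "q4 \<equiv> tp4 k c S b1 b2 b3 b4"
  shows "form1_type k c S q1 q2 q3 q4 = form1_type k c S b1 b2 b3 b4"
    "form1_type (- k) c S q1 q2 q3 q4 = 0"
proof -
  have k: "k * (k * y) = - y" for y using assms(1) by (simp only: mult.assoc[symmetric]) simp
  note s = tp_defs algebra_simps add_divide_distrib diff_divide_distrib k assms(1) cs_complex
  have "tp1 k c S q1 q2 q3 q4 x = q1 x" "tp2 k c S q1 q2 q3 q4 x = q2 x"
    "tp3 k c S q1 q2 q3 q4 x = q3 x" "tp4 k c S q1 q2 q3 q4 x = q4 x" for x
    unfolding q1_def q2_def q3_def q4_def by (simp_all add: s)
  then have *: "tp1 k c S q1 q2 q3 q4 = q1" "tp2 k c S q1 q2 q3 q4 = q2"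
    "tp3 k c S q1 q2 q3 q4 = q3" "tp4 k c S q1 q2 q3 q4 = q4" by blast+
  show "form1_type k c S q1 q2 q3 q4 = form1_type k c S b1 b2 b3 b4"
    unfolding form1_type_def * unfolding q1_def q2_def q3_def q4_def by (rule refl)
  have "tp1 (- k) c S q1 q2 q3 q4 x = 0" "tp2 (- k) c S q1 q2 q3 q4 x = 0"
    "tp3 (- k) c S q1 q2 q3 q4 x = 0" "tp4 (- k) c S q1 q2 q3 q4 x = 0" for x
    unfolding q1_def q2_def q3_def q4_def by (simp_all add: s)
  then have *: "tp1 (- k) c S q1 q2 q3 q4 = (\<lambda>x. 0)" "tp2 (- k) c S q1 q2 q3 q4 = (\<lambda>x. 0)"
    "tp3 (- k) c S q1 q2 q3 q4 = (\<lambda>x. 0)" "tp4 (- k) c S q1 q2 q3 q4 = (\<lambda>x. 0)" by blast+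
  show "form1_type (- k) c S q1 q2 q3 q4 = 0"
    unfolding form1_type_def * by (rule form_zero)
qed

text \<open>
  Let \<open>T'\<close> be the result of letting \<open>J\<close> act on the \<open>3\<close>-form \<open>T\<close> as a derivation. Among the types of
  \<open>3\<close>-forms in real dimension four, only \<open>(2,1)\<close> and \<open>(1,2)\<close> occur, and there the derivation acts as
  \<open>\<i>\<close> and \<open>- \<i>\<close>. Hence applying it twice gives \<open>- T\<close>, which with \<open>J\<^sup>2 = - 1\<close> expresses all terms of the projections by
  \<open>T\<close> and \<open>T'\<close>.
\<close>

lemma bideg_form3:
  "bideg_proj (Jst c S) 1 2 (form3 t1 t2 t3 t4) = form3_type \<i> c S t1 t2 t3 t4"
  "bideg_proj (Jst c S) 2 1 (form3 t1 t2 t3 t4) = form3_type (- \<i>) c S t1 t2 t3 t4"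
proof -
  have *: "bideg_proj (Jst c S) 1 2 (form3 t1 t2 t3 t4) x [u, v, w] =
      alt3 (tp1 \<i> c S t1 t2 t3 t4 x) (tp2 \<i> c S t1 t2 t3 t4 x) (tp3 \<i> c S t1 t2 t3 t4 x) (tp4 \<i> c S t1 t2 t3 t4 x) u v w \<and>
    bideg_proj (Jst c S) 2 1 (form3 t1 t2 t3 t4) x [u, v, w] =
      alt3 (tp1 (- \<i>) c S t1 t2 t3 t4 x) (tp2 (- \<i>) c S t1 t2 t3 t4 x) (tp3 (- \<i>) c S t1 t2 t3 t4 x)
        (tp4 (- \<i>) c S t1 t2 t3 t4 x) u v w" for x u v w
  proof -
    define T where "T = alt3 (t1 x) (t2 x) (t3 x) (t4 x)"
    define T' where "T' = alt3 (c x * t2 x + S x * t3 x) (- (c x * t1 x) - S x * t4 x) (c x * t4 x - S x * t1 x) (S x * t2 x - c x * t3 x)"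
    define J where "J = Jst c S x"
    have JJ: "J (J p) = - p" for p unfolding J_def by (rule Jst_Jst[OF cs])
    have D: "T (J p) q r + T p (J q) r + T p q (J r) = T' p q r" for p q r
      unfolding T_def T'_def J_def by (rule alt3_Jst_derivation)
    have D': "T' (J p) q r + T' p (J q) r + T' p q (J r) = - T p q r" for p q r
      unfolding T_def T'_def J_def alt3_Jst_derivation
      by (simp add: alt3_def algebra_simps cs_complex)
    have m: "T (- p) q r = - T p q r" "T p (- q) r = - T p q r" "T p q (- r) = - T p q r" for p q r
      by (simp_all add: T_def alt_linear)
    have JJJ: "T (J p) (J q) r + T (J p) q (J r) + T p (J q) (J r) = T p q r" for p q r
    proof -
      have "2 * (T (J p) (J q) r + T (J p) q (J r) + T p (J q) (J r)) = 2 * T p q r"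
        using D'[of p q r] by (simp add: D[symmetric] JJ m algebra_simps)
      then show ?thesis by (rule mult_left_cancel[THEN iffD1, rotated]) simp
    qed
    note 2 = JJJ[of u v w]
    have 3: "T (J u) (J v) (J w) = T' u v w"
    proof -
      have "3 * T (J u) (J v) (J w) - 2 * (T (J u) v w + T u (J v) w + T u v (J w)) = T (J u) v w + T u (J v) w + T u v (J w)"
        using JJJ[of "J u" v w] JJJ[of u "J v" w] JJJ[of u v "J w"] by (simp add: JJ m algebra_simps)
      then have "3 * T (J u) (J v) (J w) = 3 * T' u v w" unfolding D by (simp add: algebra_simps)
      then show ?thesis by simp
    qed
    show ?thesis
      unfolding bideg_proj_form3 T_def[symmetric] J_def[symmetric] D 2 3
      by (simp add: T_def T'_def alt3_def tp_defs algebra_simps add_divide_distrib diff_divide_distrib)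
  qed
  show "bideg_proj (Jst c S) 1 2 (form3 t1 t2 t3 t4) = form3_type \<i> c S t1 t2 t3 t4"
    "bideg_proj (Jst c S) 2 1 (form3 t1 t2 t3 t4) = form3_type (- \<i>) c S t1 t2 t3 t4"
    unfolding form3_type_def using * by (intro form_eqI3; simp add: bideg_proj_length)+
qed

text \<open>
  Averaging a \<open>2\<close>-form with its pullback by \<open>J\<close> is the orthogonal projection to the span of \<open>\<omega>\<close> and of the
  anti-self-dual forms, all of which are \<open>J\<close>-invariant.
\<close>

lemma bideg_form2:
  fixes a12 a13 a14 a23 a24 a34 :: cfun
  shows "bideg_proj (Jst c S) 1 1 (form2 a12 a13 a14 a23 a24 a34) = form11 c S
     (\<lambda>x. (c x * (a12 x + a34 x) + S x * (a13 x - a24 x)) / 2)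
     (\<lambda>x. (a12 x - a34 x) / 2) (\<lambda>x. (a13 x + a24 x) / 2) (\<lambda>x. (a14 x - a23 x) / 2)"
  unfolding form11_def
proof (rule form_eqI2)
  fix x u v
  have "alt2 (a12 x) (a13 x) (a14 x) (a23 x) (a24 x) (a34 x) (Jst c S x u) (Jst c S x v) =
    alt2 (c x * (c x * a12 x) + c x * (S x * (a13 x - a24 x)) - S x * (S x * a34 x))
      (S x * (S x * a13 x) + c x * (c x * a24 x) + c x * (S x * (a12 x + a34 x)))
      (- a23 x) (- a14 x)
      (c x * (c x * a13 x) - c x * (S x * (a12 x + a34 x)) + S x * (S x * a24 x))
      (c x * (c x * a34 x) + c x * (S x * (a13 x - a24 x)) - S x * (S x * a12 x)) u v"
    unfolding alt2_def minor2_Jst cs by (simp add: algebra_simps power2_eq_square)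
  moreover have "(alt2 a b d e f g u v + alt2 a' b' d' e' f' g' u v) / 2 =
    alt2 ((a + a') / 2) ((b + b') / 2) ((d + d') / 2) ((e + e') / 2) ((f + f') / 2) ((g + g') / 2) u v"
    for a b d e f g a' b' d' e' f' g'
    by (simp add: alt2_def algebra_simps add_divide_distrib)
  moreover note s = algebra_simps add_divide_distrib diff_divide_distrib cs_complex
  have "(a12 x + (c x * (c x * a12 x) + c x * (S x * (a13 x - a24 x)) - S x * (S x * a34 x))) / 2 =
      (c x * (a12 x + a34 x) + S x * (a13 x - a24 x)) / 2 * c x + (a12 x - a34 x) / 2"
    "(a13 x + (S x * (S x * a13 x) + c x * (c x * a24 x) + c x * (S x * (a12 x + a34 x)))) / 2 =
      (c x * (a12 x + a34 x) + S x * (a13 x - a24 x)) / 2 * S x + (a13 x + a24 x) / 2"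
    "(a14 x + - a23 x) / 2 = (a14 x - a23 x) / 2"
    "(a23 x + - a14 x) / 2 = - ((a14 x - a23 x) / 2)"
    "(a24 x + (c x * (c x * a13 x) - c x * (S x * (a12 x + a34 x)) + S x * (S x * a24 x))) / 2 =
      (a13 x + a24 x) / 2 - (c x * (a12 x + a34 x) + S x * (a13 x - a24 x)) / 2 * S x"
    "(a34 x + (c x * (c x * a34 x) + c x * (S x * (a13 x - a24 x)) - S x * (S x * a12 x))) / 2 =
      (c x * (a12 x + a34 x) + S x * (a13 x - a24 x)) / 2 * c x - (a12 x - a34 x) / 2"
    by (simp_all add: s)
  ultimately show "bideg_proj (Jst c S) 1 1 (form2 a12 a13 a14 a23 a24 a34) x [u, v] = alt2
     ((c x * (a12 x + a34 x) + S x * (a13 x - a24 x)) / 2 * c x + (a12 x - a34 x) / 2)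
     ((c x * (a12 x + a34 x) + S x * (a13 x - a24 x)) / 2 * S x + (a13 x + a24 x) / 2)
     ((a14 x - a23 x) / 2) (- ((a14 x - a23 x) / 2))
     ((a13 x + a24 x) / 2 - (c x * (a12 x + a34 x) + S x * (a13 x - a24 x)) / 2 * S x)
     ((c x * (a12 x + a34 x) + S x * (a13 x - a24 x)) / 2 * c x - (a12 x - a34 x) / 2) u v"
    unfolding bideg_proj_form2 by (simp only:)
qed (simp add: bideg_proj_length)

lemma form11_Jst_invariant:
  "form11 c S f u v w x [Jst c S x p, Jst c S x q] = form11 c S f u v w x [p, q]"
  unfolding form11_def form_eval alt2_def minor2_Jst cs
  by (simp add: algebra_simps power2_eq_square cs_complex)

lemma bideg_form11:
  "bideg_proj (Jst c S) 1 1 (form11 c S f u v w) = form11 c S f u v w"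
  "bideg_proj (Jst c S) 2 0 (form11 c S f u v w) = 0"
  "bideg_proj (Jst c S) 0 2 (form11 c S f u v w) = 0"
proof -
  let ?A = "\<lambda>x p q. form11 c S f u v w x [p, q]" and ?J = "Jst c S"
  have inv: "?A x (?J x p) (?J x q) = ?A x p q" for x p q by (rule form11_Jst_invariant)
  have skew: "?A x (?J x p) q = - ?A x p (?J x q)" for x p q
  proof -
    have "?A x (?J x p) q = ?A x (?J x (?J x p)) (?J x q)" by (simp only: inv)
    also have "\<dots> = - ?A x p (?J x q)" unfolding Jst_Jst[OF cs] by (simp add: form11_def alt_linear)
    finally show ?thesis .
  qed
  note inv' = inv[unfolded form11_def form_eval] and skew' = skew[unfolded form11_def form_eval]
  have "bideg_proj ?J 1 1 (form11 c S f u v w) x [p, q] = form11 c S f u v w x [p, q]"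
    "bideg_proj ?J 2 0 (form11 c S f u v w) x [p, q] = 0"
    "bideg_proj ?J 0 2 (form11 c S f u v w) x [p, q] = 0" for x p q
    unfolding form11_def bideg_proj_form2 inv' unfolding skew' form_eval by simp_all
  then show "bideg_proj ?J 1 1 (form11 c S f u v w) = form11 c S f u v w"
    "bideg_proj ?J 2 0 (form11 c S f u v w) = 0" "bideg_proj ?J 0 2 (form11 c S f u v w) = 0"
    unfolding form_zero(2)[symmetric] form11_def
    by (intro form_eqI2; simp add: bideg_proj_length; simp add: alt2_def)+
qed

end

section \<open>The Hodge operator in coordinates\<close>

definition dot4 :: "pt \<Rightarrow> pt \<Rightarrow> real" where
  "dot4 u v = X1 u * X1 v + X2 u * X2 v + X3 u * X3 v + X4 u * X4 v"

definition vol4 :: "pt \<Rightarrow> pt \<Rightarrow> pt \<Rightarrow> pt \<Rightarrow> real" where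
  "vol4 p q r s = minor2 X1 X2 p q * minor2 X3 X4 r s - minor2 X1 X3 p q * minor2 X2 X4 r s
     + minor2 X1 X4 p q * minor2 X2 X3 r s + minor2 X2 X3 p q * minor2 X1 X4 r s
     - minor2 X2 X4 p q * minor2 X1 X3 r s + minor2 X3 X4 p q * minor2 X1 X2 r s"

lemma card_inversions:
  assumes "finite A" "finite B"
  shows "card {(i, j). i \<in> A \<and> j \<in> B \<and> j < i} = (\<Sum>i\<in>A. \<Sum>j\<in>B. if j < (i::nat) then 1 else 0)"
proof -
  have "{(i, j). i \<in> A \<and> j \<in> B \<and> j < i} = (SIGMA i:A. {j \<in> B. j < i})" by auto
  then show ?thesis using assms by (simp add: card_SigmaI sum.inter_filter[symmetric] flip: card_eq_sum)
qed

lemma wedge_eval: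
  "wedge \<alpha> \<beta> x vs = (\<Sum>A\<in>Pow {..<length vs}.
     (-1) ^ (\<Sum>i\<in>A. \<Sum>j\<in>{..<length vs} - A. if j < i then 1 else 0)
       * \<alpha> x (nths vs A) * \<beta> x (nths vs ({..<length vs} - A)))"
  unfolding wedge_def
proof (rule sum.cong[OF refl])
  fix A assume "A \<in> Pow {..<length vs}"
  then have "finite A" using finite_subset by auto
  from card_inversions[OF this, of "{..<length vs} - A"]
  show "(- 1) ^ card {(i, j). i \<in> A \<and> j \<in> {..<length vs} - A \<and> j < i} * \<alpha> x (nths vs A) * \<beta> x (nths vs ({..<length vs} - A)) =
    (-1) ^ (\<Sum>i\<in>A. \<Sum>j\<in>{..<length vs} - A. if j < i then 1 else 0)
       * \<alpha> x (nths vs A) * \<beta> x (nths vs ({..<length vs} - A))"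
    by (simp only: finite_Diff finite_lessThan)
qed

lemma wedge_2_2:
  assumes "\<And>x vs. length vs \<noteq> 2 \<Longrightarrow> \<alpha> x vs = 0"
  shows "wedge \<alpha> \<alpha> x [p, q, r, s] =
    2 * (\<alpha> x [p, q] * \<alpha> x [r, s] - \<alpha> x [p, r] * \<alpha> x [q, s] + \<alpha> x [p, s] * \<alpha> x [q, r])"
proof -
  have *: "{..<length [p, q, r, s]} = {0, 1, 2, 3}" by auto
  show ?thesis
    unfolding wedge_eval *
    by (simp add: sum_Pow_insert nths_Cons insert_Diff_if assms algebra_simps)
qed

lemma wedge_1_2:
  assumes "\<And>x vs. length vs \<noteq> 1 \<Longrightarrow> \<theta> x vs = 0" "\<And>x vs. length vs \<noteq> 2 \<Longrightarrow> \<alpha> x vs = 0"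
  shows "wedge \<theta> \<alpha> x [p, q, r] = \<theta> x [p] * \<alpha> x [q, r] - \<theta> x [q] * \<alpha> x [p, r] + \<theta> x [r] * \<alpha> x [p, q]"
proof -
  have *: "{..<length [p, q, r]} = {0, 1, 2}" by auto
  show ?thesis
    unfolding wedge_eval *
    by (simp add: sum_Pow_insert nths_Cons insert_Diff_if assms algebra_simps)
qed

lemma wedge_2_2_length:
  assumes "\<And>x vs. length vs \<noteq> 2 \<Longrightarrow> \<alpha> x vs = 0" "length vs \<noteq> 4"
  shows "wedge \<alpha> \<alpha> x vs = 0"
  unfolding wedge_def
proof (rule sum.neutral, rule ballI)
  fix A assume "A \<in> Pow {..<length vs}"
  then have A: "A \<subseteq> {..<length vs}" "finite A" using finite_subset by auto
  have "{i. i < length vs \<and> i \<in> A} = A" "{i. i < length vs \<and> i \<in> {..<length vs} - A} = {..<length vs} - A"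
    using A by auto
  then have "length (nths vs A) = card A" "length (nths vs ({..<length vs} - A)) = length vs - card A"
    using A by (simp_all add: length_nths card_Diff_subset)
  moreover have "card A \<le> length vs" using A(1) by (metis card_lessThan card_mono finite_lessThan)
  ultimately have "length (nths vs A) \<noteq> 2 \<or> length (nths vs ({..<length vs} - A)) \<noteq> 2"
    using assms(2) by linarith
  then have "\<alpha> x (nths vs A) = 0 \<or> \<alpha> x (nths vs ({..<length vs} - A)) = 0"
    using assms(1) by blast
  then show "(- 1) ^ card {(i, j). i \<in> A \<and> j \<in> {..<length vs} - A \<and> j < i} *
      \<alpha> x (nths vs A) * \<alpha> x (nths vs ({..<length vs} - A)) = 0"
    by (elim disjE) simp_all
qed

definition orthonormal :: "pt \<Rightarrow> pt \<Rightarrow> pt \<Rightarrow> pt \<Rightarrow> bool" where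
  "orthonormal a b d e \<longleftrightarrow> dot4 a a = 1 \<and> dot4 a b = 0 \<and> dot4 a d = 0 \<and> dot4 a e = 0 \<and> dot4 b b = 1
     \<and> dot4 b d = 0 \<and> dot4 b e = 0 \<and> dot4 d d = 1 \<and> dot4 d e = 0 \<and> dot4 e e = 1"

text \<open>
  The linear map sending the coordinate frame to an orthonormal frame is injective, hence bijective, and
  so its left inverse, given by the inner products with the frame, is also its right inverse.
\<close>

lemma orthonormal_expansion:
  fixes a b d e :: pt
  assumes "orthonormal a b d e"
  shows "dot4 a p *\<^sub>R a + dot4 b p *\<^sub>R b + dot4 d p *\<^sub>R d + dot4 e p *\<^sub>R e = p"
proof -
  define T where "T v = X1 v *\<^sub>R a + X2 v *\<^sub>R b + X3 v *\<^sub>R d + X4 v *\<^sub>R e" for v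
  define T' where "T' q = dot4 a q *\<^sub>R e1 + dot4 b q *\<^sub>R e2 + dot4 d q *\<^sub>R e3 + dot4 e q *\<^sub>R e4" for q
  have lin: "linear T" by (rule linearI) (simp_all add: T_def algebra_simps)
  have dotT: "dot4 q (T v) = X1 v * dot4 q a + X2 v * dot4 q b + X3 v * dot4 q d + X4 v * dot4 q e" for q v
    by (simp add: T_def dot4_def algebra_simps)
  have sym: "dot4 b a = 0" "dot4 d a = 0" "dot4 e a = 0" "dot4 d b = 0" "dot4 e b = 0" "dot4 e d = 0"
    using assms by (simp_all add: orthonormal_def dot4_def mult.commute)
  have T'T: "T' (T v) = v" for v
    by (subst (2) pt_expand[of v]) (use assms in \<open>simp add: orthonormal_def T'_def dotT sym\<close>)
  have "inj T" by (metis T'T injI)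
  then have "surj T" using lin linear_injective_imp_surjective by blast
  then obtain v where v: "p = T v" by blast
  have "T (T' p) = p" by (simp add: v T'T)
  then show ?thesis by (simp add: T_def T'_def)
qed

definition std_sum :: "(pt \<Rightarrow> complex) \<Rightarrow> complex" where
  "std_sum h = h e1 + h e2 + h e3 + h e4"

text \<open>
  Expanding \<open>f\<close> in coordinates leaves, for each coordinate vector, the image under \<open>g\<close> of the orthonormal
  expansion of that vector.
\<close>

lemma frame_trace:
  fixes f g :: "pt \<Rightarrow> complex"
  assumes o: "orthonormal a b d e"
    and f: "linear f" and g: "linear g"
  shows "f a * g a + f b * g b + f d * g d + f e * g e = std_sum (\<lambda>p. f p * g p)"
proof -
  have G: "of_real (dot4 a p) * g a + of_real (dot4 b p) * g b + of_real (dot4 d p) * g d + of_real (dot4 e p) * g e = g p" for p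
    using arg_cong[OF orthonormal_expansion[OF o, of p], of g]
    by (simp only: linear_add[OF g] linear_cmul[OF g] scaleR_conv_of_real)
  have dots: "dot4 v e1 = X1 v" "dot4 v e2 = X2 v" "dot4 v e3 = X3 v" "dot4 v e4 = X4 v" for v
    by (simp_all add: dot4_def)
  have "std_sum (\<lambda>p. f p * g p) = f e1 * g e1 + f e2 * g e2 + f e3 * g e3 + f e4 * g e4"
    by (simp add: std_sum_def)
  also have "\<dots> = f a * g a + f b * g b + f d * g d + f e * g e"
    unfolding G[of e1, symmetric] G[of e2, symmetric] G[of e3, symmetric] G[of e4, symmetric] dots
      linear_expand[OF f, of a] linear_expand[OF f, of b] linear_expand[OF f, of d] linear_expand[OF f, of e]
    by (simp only: scaleR_conv_of_real algebra_simps)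
  finally show ?thesis by simp
qed


lemma linear_alt:
  "linear (\<lambda>p. alt2 a12 a13 a14 a23 a24 a34 p v)" "linear (\<lambda>p. alt2 a12 a13 a14 a23 a24 a34 u p)"
  "linear (\<lambda>p. alt3 t1 t2 t3 t4 p v w)" "linear (\<lambda>p. alt3 t1 t2 t3 t4 u p w)" "linear (\<lambda>p. alt3 t1 t2 t3 t4 u v p)"
  "linear (\<lambda>p. complex_of_real (vol4 p q r s))" "linear (\<lambda>q. complex_of_real (vol4 p q r s))"
  "linear (\<lambda>r. complex_of_real (vol4 p q r s))"
  by (rule linearI; simp add: alt_defs vol4_def algebra_simps scaleR_conv_of_real)+

lemma vol4_alternating: "vol4 q p r s = - vol4 p q r s" "vol4 p r q s = - vol4 p q r s" "vol4 p q s r = - vol4 p q r s"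
  by (simp_all add: vol4_def minor2_def algebra_simps)

lemma alt_alternating:
  "alt2 a12 a13 a14 a23 a24 a34 v u = - alt2 a12 a13 a14 a23 a24 a34 u v"
  "alt3 t1 t2 t3 t4 v u w = - alt3 t1 t2 t3 t4 u v w" "alt3 t1 t2 t3 t4 u w v = - alt3 t1 t2 t3 t4 u v w"
  by (simp_all add: alt_defs algebra_simps)

lemma alt_repeated:
  "alt2 a12 a13 a14 a23 a24 a34 u u = 0" "alt3 t1 t2 t3 t4 u u w = 0" "alt3 t1 t2 t3 t4 u w w = 0"
  by (simp_all add: alt_defs algebra_simps)

text \<open>
  The sum over increasing pairs of indices is half of an iterated trace and can therefore be evaluated
  in the coordinate frame.
\<close>

lemma hodge_frame_sum2:
  fixes a12 a13 a14 a23 a24 a34 :: complex and r s :: pt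
  assumes o: "orthonormal a b d e"
  defines "B \<equiv> \<lambda>p q. alt2 a12 a13 a14 a23 a24 a34 p q * of_real (vol4 p q r s)"
  shows "B a b + B a d + B a e + B b d + B b e + B d e = alt2 a34 (- a24) a23 a14 (- a13) a12 r s"
proof -
  have sym: "B q p = B p q" for p q
    unfolding B_def by (simp add: alt_alternating(1)[of _ _ _ _ _ _ q p] vol4_alternating(1)[of q p])
  have rep: "B p p = 0" for p by (simp add: B_def alt_repeated)
  have 1: "B a q + B b q + B d q + B e q = std_sum (\<lambda>p. B p q)" for q
    unfolding B_def by (rule frame_trace[OF o linear_alt(1) linear_alt(6)])
  have 2: "B p a + B p b + B p d + B p e = std_sum (\<lambda>q. B p q)" for p
    unfolding B_def by (rule frame_trace[OF o linear_alt(2) linear_alt(7)])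
  have "2 * (B a b + B a d + B a e + B b d + B b e + B d e) =
      (B a a + B b a + B d a + B e a) + (B a b + B b b + B d b + B e b)
      + (B a d + B b d + B d d + B e d) + (B a e + B b e + B d e + B e e)"
    by (simp add: rep sym[of b a] sym[of d a] sym[of e a] sym[of d b] sym[of e b] sym[of e d])
  also have "\<dots> = std_sum (\<lambda>p. std_sum (\<lambda>q. B p q))"
    unfolding 1 2[symmetric] by (simp add: std_sum_def)
  also have "\<dots> = 2 * (B e1 e2 + B e1 e3 + B e1 e4 + B e2 e3 + B e2 e4 + B e3 e4)"
    by (simp add: std_sum_def rep sym[of e2 e1] sym[of e3 e1] sym[of e4 e1] sym[of e3 e2] sym[of e4 e2] sym[of e4 e3])
  also have "B e1 e2 + B e1 e3 + B e1 e4 + B e2 e3 + B e2 e4 + B e3 e4 = alt2 a34 (- a24) a23 a14 (- a13) a12 r s"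
    by (simp add: B_def alt_defs vol4_def algebra_simps)
  finally show ?thesis by (rule mult_left_cancel[THEN iffD1, rotated]) simp
qed

text \<open>
  Likewise, the sum over increasing triples is a sixth of a threefold trace.
\<close>

lemma hodge_frame_sum3:
  fixes t1 t2 t3 t4 :: complex and s :: pt
  assumes o: "orthonormal a b d e"
  defines "B \<equiv> \<lambda>p q r. alt3 t1 t2 t3 t4 p q r * of_real (vol4 p q r s)"
  shows "B a b d + B a b e + B a d e + B b d e = alt1 (- t1) (- t2) (- t3) (- t4) s"
proof -
  define F where "F h = h a + h b + h d + h e" for h :: "pt \<Rightarrow> complex"
  have sym: "B q p r = B p q r" "B p r q = B p q r" for p q r
    unfolding B_def by (simp_all add: alt_alternating(2)[of _ _ _ _ q p] vol4_alternating(1)[of q p]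
      alt_alternating(3)[of _ _ _ _ _ r q] vol4_alternating(2)[of _ r q])
  have rep: "B p p r = 0" "B r p p = 0" "B p r p = 0" for p r
    using sym(1)[of r p p] by (simp_all add: B_def alt_repeated)
  have 1: "F (\<lambda>p. B p q r) = std_sum (\<lambda>p. B p q r)" for q r
    unfolding B_def F_def by (rule frame_trace[OF o linear_alt(3) linear_alt(6)])
  have 2: "F (\<lambda>q. B p q r) = std_sum (\<lambda>q. B p q r)" for p r
    unfolding B_def F_def by (rule frame_trace[OF o linear_alt(4) linear_alt(7)])
  have 3: "F (\<lambda>r. B p q r) = std_sum (\<lambda>r. B p q r)" for p q
    unfolding B_def F_def by (rule frame_trace[OF o linear_alt(5) linear_alt(8)])
  have swap: "F (\<lambda>q. std_sum (\<lambda>p. h p q)) = std_sum (\<lambda>p. F (\<lambda>q. h p q))" for h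
    by (simp add: F_def std_sum_def)
  have "6 * (B a b d + B a b e + B a d e + B b d e) = F (\<lambda>r. F (\<lambda>q. F (\<lambda>p. B p q r)))"
    by (simp add: F_def rep sym(1)[of b a] sym(1)[of d a] sym(1)[of e a] sym(1)[of d b] sym(1)[of e b] sym(1)[of e d]
      sym(2)[of _ b a] sym(2)[of _ d a] sym(2)[of _ e a] sym(2)[of _ d b] sym(2)[of _ e b] sym(2)[of _ e d])
  also have "\<dots> = std_sum (\<lambda>p. std_sum (\<lambda>q. std_sum (\<lambda>r. B p q r)))"
    unfolding 1 swap 2 3 by (rule refl)
  also have "\<dots> = 6 * (B e1 e2 e3 + B e1 e2 e4 + B e1 e3 e4 + B e2 e3 e4)"
    by (simp add: std_sum_def rep sym(1)[of e2 e1] sym(1)[of e3 e1] sym(1)[of e4 e1] sym(1)[of e3 e2] sym(1)[of e4 e2] sym(1)[of e4 e3]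
      sym(2)[of _ e2 e1] sym(2)[of _ e3 e1] sym(2)[of _ e4 e1] sym(2)[of _ e3 e2] sym(2)[of _ e4 e2] sym(2)[of _ e4 e3])
  also have "B e1 e2 e3 + B e1 e2 e4 + B e1 e3 e4 + B e2 e3 e4 = alt1 (- t1) (- t2) (- t3) (- t4) s"
  proof -
    have "vol4 e1 e2 e3 s = X4 s" "vol4 e1 e2 e4 s = - X3 s" "vol4 e1 e3 e4 s = X2 s" "vol4 e2 e3 e4 s = - X1 s"
      by (simp_all add: vol4_def minor2_def)
    moreover have "alt3 t1 t2 t3 t4 e1 e2 e3 = - t4" "alt3 t1 t2 t3 t4 e1 e2 e4 = t3"
      "alt3 t1 t2 t3 t4 e1 e3 e4 = - t2" "alt3 t1 t2 t3 t4 e2 e3 e4 = t1"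
      by (simp_all add: alt3_def minor2_def minor3_def)
    ultimately show ?thesis by (simp add: B_def alt1_def)
  qed
  finally show ?thesis by (rule mult_left_cancel[THEN iffD1, rotated]) simp
qed

lemma om_eval: "om c S x [u, v] = of_real (c x * (minor2 X1 X2 u v + minor2 X3 X4 u v) + S x * (minor2 X1 X3 u v - minor2 X2 X4 u v))"
  by (simp add: om_def alt2_def algebra_simps)

lemma om_degree: "length vs \<noteq> 2 \<Longrightarrow> om c S x vs = 0"
  unfolding om_def by (rule form_wrong_length)

context
  fixes c S :: "pt \<Rightarrow> real"
  assumes cs: "\<And>x. (c x)\<^sup>2 + (S x)\<^sup>2 = 1"
begin

text \<open>
  For the two self-dual forms \<open>A\<close> and \<open>B\<close> of which \<open>\<omega>\<close> is composed, \<open>A \<and> A = B \<and> B\<close> is twice the volume form and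
  \<open>A \<and> B = 0\<close>.
\<close>

lemma vol_om: "vol (om c S) x [p, q, r, s] = of_real (vol4 p q r s)"
proof -
  define A where "A u v = minor2 X1 X2 u v + minor2 X3 X4 u v" for u v
  define B where "B u v = minor2 X1 X3 u v - minor2 X2 X4 u v" for u v
  have AA: "A p q * A r s - A p r * A q s + A p s * A q r = vol4 p q r s"
    by (simp add: A_def vol4_def minor2_def algebra_simps)
  have BB: "B p q * B r s - B p r * B q s + B p s * B q r = vol4 p q r s"
    by (simp add: B_def vol4_def minor2_def algebra_simps)
  have AB: "A p q * B r s - A p r * B q s + A p s * B q r + B p q * A r s - B p r * A q s + B p s * A q r = 0"
    by (simp add: A_def B_def minor2_def algebra_simps)
  have ev: "om c S x [u, v] = of_real (c x * A u v + S x * B u v)" for u v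
    unfolding om_eval A_def B_def by (rule refl)
  have w: "wedge (om c S) (om c S) x [p, q, r, s] = 2 * of_real ((c x * A p q + S x * B p q) * (c x * A r s + S x * B r s)
    - (c x * A p r + S x * B p r) * (c x * A q s + S x * B q s) + (c x * A p s + S x * B p s) * (c x * A q r + S x * B q r))"
    by (subst wedge_2_2) (rule om_degree, assumption, simp only: ev of_real_mult of_real_add of_real_diff)
  have "vol (om c S) x [p, q, r, s] = of_real ((c x * A p q + S x * B p q) * (c x * A r s + S x * B r s)
    - (c x * A p r + S x * B p r) * (c x * A q s + S x * B q s) + (c x * A p s + S x * B p s) * (c x * A q r + S x * B q r))"
    unfolding vol_def w by (rule nonzero_mult_div_cancel_left) simp
  also have "(c x * A p q + S x * B p q) * (c x * A r s + S x * B r s)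
    - (c x * A p r + S x * B p r) * (c x * A q s + S x * B q s) + (c x * A p s + S x * B p s) * (c x * A q r + S x * B q r)
    = (c x)\<^sup>2 * (A p q * A r s - A p r * A q s + A p s * A q r) + (S x)\<^sup>2 * (B p q * B r s - B p r * B q s + B p s * B q r)
     + c x * S x * (A p q * B r s - A p r * B q s + A p s * B q r + B p q * A r s - B p r * A q s + B p s * A q r)"
    by (simp add: algebra_simps power2_eq_square)
  also have "\<dots> = ((c x)\<^sup>2 + (S x)\<^sup>2) * vol4 p q r s" unfolding AA BB AB by (simp add: algebra_simps)
  also have "\<dots> = vol4 p q r s" by (simp add: cs)
  finally show ?thesis .
qed

lemma vol_om_length: "length vs \<noteq> 4 \<Longrightarrow> vol (om c S) x vs = 0"
  by (simp add: vol_def wedge_2_2_length om_degree)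

lemma metric_eq: "metric (Jst c S) (om c S) x u v = dot4 u v"
proof -
  have "metric (Jst c S) (om c S) x u v = ((c x)\<^sup>2 + (S x)\<^sup>2) * dot4 u v"
    unfolding metric_def om_eval by (simp add: minor2_def dot4_def algebra_simps power2_eq_square)
  then show ?thesis by (simp add: cs)
qed

lemma orthonormal_frame_exists:
  obtains a b d e where "(SOME f. orthonormal_frame (Jst c S) (om c S) x f) = [a, b, d, e]"
   "orthonormal a b d e"
proof -
  let ?f = "SOME f. orthonormal_frame (Jst c S) (om c S) x f"
  have "orthonormal_frame (Jst c S) (om c S) x [e1, e2, e3, e4]"
    by (auto simp: orthonormal_frame_def metric_eq dot4_def eval_nat_numeral less_Suc_eq)
  then have f: "orthonormal_frame (Jst c S) (om c S) x ?f" by (rule someI)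
  then have "length ?f = 4" by (simp add: orthonormal_frame_def)
  then obtain a b d e where abde: "?f = [a, b, d, e]" using list_cases_length(4) by blast
  have *: "dot4 (?f ! i) (?f ! j) = (if i = j then 1 else 0)" if "i < 4" "j < 4" for i j
    using f that by (simp add: orthonormal_frame_def metric_eq)
  show thesis
    using *[of 0 0] *[of 0 1] *[of 0 2] *[of 0 3] *[of 1 1] *[of 1 2] *[of 1 3] *[of 2 2] *[of 2 3] *[of 3 3]
    unfolding abde by (intro that[OF abde]) (simp add: orthonormal_def)
qed

lemma hodge_form2:
  "hodge (Jst c S) (om c S) (form2 a12 a13 a14 a23 a24 a34) =
     form2 a34 (\<lambda>x. - a24 x) a23 a14 (\<lambda>x. - a13 x) a12"
proof (rule form_eqI2)
  let ?h = "hodge (Jst c S) (om c S) (form2 a12 a13 a14 a23 a24 a34)"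
  fix x
  obtain a b d e where f: "(SOME f. orthonormal_frame (Jst c S) (om c S) x f) = [a, b, d, e]"
    and o: "orthonormal a b d e"
    by (rule orthonormal_frame_exists)
  have four: "{..<4::nat} = {0, 1, 2, 3}" by auto
  have h: "?h x vs = alt2 (a12 x) (a13 x) (a14 x) (a23 x) (a24 x) (a34 x) a b * vol (om c S) x ([a, b] @ vs)
    + alt2 (a12 x) (a13 x) (a14 x) (a23 x) (a24 x) (a34 x) a d * vol (om c S) x ([a, d] @ vs)
    + alt2 (a12 x) (a13 x) (a14 x) (a23 x) (a24 x) (a34 x) a e * vol (om c S) x ([a, e] @ vs)
    + alt2 (a12 x) (a13 x) (a14 x) (a23 x) (a24 x) (a34 x) b d * vol (om c S) x ([b, d] @ vs)
    + alt2 (a12 x) (a13 x) (a14 x) (a23 x) (a24 x) (a34 x) b e * vol (om c S) x ([b, e] @ vs)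
    + alt2 (a12 x) (a13 x) (a14 x) (a23 x) (a24 x) (a34 x) d e * vol (om c S) x ([d, e] @ vs)" for vs
    unfolding hodge_def f Let_def four
    by (simp add: sum_Pow_insert nths_Cons form_wrong_length)
  show "?h x vs = 0" if "length vs \<noteq> 2" for vs
    unfolding h using that by (simp add: vol_om_length)
  show "?h x [r, s] = alt2 (a34 x) (- a24 x) (a23 x) (a14 x) (- a13 x) (a12 x) r s" for r s
    unfolding h append_Cons append_Nil vol_om by (rule hodge_frame_sum2[OF o])
qed

lemma hodge_form3:
  "hodge (Jst c S) (om c S) (form3 t1 t2 t3 t4) =
     form1 (\<lambda>x. - t1 x) (\<lambda>x. - t2 x) (\<lambda>x. - t3 x) (\<lambda>x. - t4 x)"
proof (rule form_eqI1)
  let ?h = "hodge (Jst c S) (om c S) (form3 t1 t2 t3 t4)"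
  fix x
  obtain a b d e where f: "(SOME f. orthonormal_frame (Jst c S) (om c S) x f) = [a, b, d, e]"
    and o: "orthonormal a b d e"
    by (rule orthonormal_frame_exists)
  have four: "{..<4::nat} = {0, 1, 2, 3}" by auto
  have h: "?h x vs = alt3 (t1 x) (t2 x) (t3 x) (t4 x) a b d * vol (om c S) x ([a, b, d] @ vs)
    + alt3 (t1 x) (t2 x) (t3 x) (t4 x) a b e * vol (om c S) x ([a, b, e] @ vs)
    + alt3 (t1 x) (t2 x) (t3 x) (t4 x) a d e * vol (om c S) x ([a, d, e] @ vs)
    + alt3 (t1 x) (t2 x) (t3 x) (t4 x) b d e * vol (om c S) x ([b, d, e] @ vs)" for vs
    unfolding hodge_def f Let_def four
    by (simp add: sum_Pow_insert nths_Cons form_wrong_length)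
  show "?h x vs = 0" if "length vs \<noteq> 1" for vs
    unfolding h using that by (simp add: vol_om_length)
  show "?h x [s] = alt1 (- t1 x) (- t2 x) (- t3 x) (- t4 x) s" for s
    unfolding h append_Cons append_Nil vol_om by (rule hodge_frame_sum3[OF o])
qed

end

section \<open>Harmonic forms and the energy identity\<close>

lemma gmul_translation:
  assumes "e \<in> {e1, e2, e3, e4}"
  shows "gmul (2 *\<^sub>R e) = (\<lambda>x. x + 2 *\<^sub>R e)" "2 *\<^sub>R e \<in> Gamma"
proof -
  have "exp (2 * (\<i> * complex_of_real pi)) = 1"
    using exp_two_pi_i by (simp add: mult.commute mult.left_commute)
  then have E: "exp (\<i> * of_real pi * ((snd (2 *\<^sub>R e) + cnj (snd (2 *\<^sub>R e))) / 2)) = 1"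
    using assms by (auto simp: e1_def e2_def e3_def e4_def scaleR_conv_of_real)
  show "gmul (2 *\<^sub>R e) = (\<lambda>x. x + 2 *\<^sub>R e)"
    unfolding gmul_def E by (intro ext) (simp add: prod_eq_iff add.commute)
  show "2 *\<^sub>R e \<in> Gamma"
    using assms by (auto simp: Gamma_def e1_def e2_def e3_def e4_def)
qed

text \<open>
  For the elements \<open>2e\<^sub>i\<close> of \<open>\<Gamma>\<close>, the action is a translation, whose derivative does not change the arguments.
\<close>

lemma M_form_periodic:
  assumes "M_form k \<alpha>"
  shows "periodic (\<lambda>x. \<alpha> x vs)"
  unfolding periodic_def
proof (intro conjI allI ballI)
  show "smooth (\<lambda>x. \<alpha> x vs)" using assms unfolding M_form_def by (blast intro: kform_smooth)
next
  fix x e assume e: "e \<in> {e1, e2, e3, e4}"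
  have "((\<lambda>x. x + 2 *\<^sub>R e) has_derivative (\<lambda>v. v)) (at x)" by (auto intro!: derivative_eq_intros)
  then have d: "frechet_derivative (gmul (2 *\<^sub>R e)) (at x) = (\<lambda>v. v)"
    unfolding gmul_translation(1)[OF e] by (rule frechet_derivative_at[symmetric])
  have "pullback (gmul (2 *\<^sub>R e)) \<alpha> = \<alpha>"
    using assms gmul_translation(2)[OF e] unfolding M_form_def by blast
  then have "pullback (gmul (2 *\<^sub>R e)) \<alpha> x vs = \<alpha> x vs" by simp
  then show "\<alpha> (x + 2 *\<^sub>R e) vs = \<alpha> x vs"
    unfolding pullback_def d unfolding gmul_translation(1)[OF e] by simp
qed

definition normsq :: "cfun \<Rightarrow> cfun \<Rightarrow> cfun \<Rightarrow> cfun \<Rightarrow> pt \<Rightarrow> real" where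
  "normsq P1 P2 P3 P4 x = (cmod (P1 x))\<^sup>2 + (cmod (P2 x))\<^sup>2 + (cmod (P3 x))\<^sup>2 + (cmod (P4 x))\<^sup>2"

text \<open>The pointwise Hermitian products of \<open>dP\<close> with a \<open>2\<close>-form \<open>a\<close>, and of \<open>P\<close> with the codifferential of \<open>a\<close>.\<close>

definition d_pairing :: "cfun \<Rightarrow> cfun \<Rightarrow> cfun \<Rightarrow> cfun \<Rightarrow> cfun \<Rightarrow> cfun \<Rightarrow> cfun \<Rightarrow> cfun \<Rightarrow> cfun \<Rightarrow> cfun \<Rightarrow> cfun" where
  "d_pairing P1 P2 P3 P4 a12 a13 a14 a23 a24 a34 x =
     (pd e1 P2 x - pd e2 P1 x) * cnj (a12 x) + (pd e1 P3 x - pd e3 P1 x) * cnj (a13 x)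
     + (pd e1 P4 x - pd e4 P1 x) * cnj (a14 x) + (pd e2 P3 x - pd e3 P2 x) * cnj (a23 x)
     + (pd e2 P4 x - pd e4 P2 x) * cnj (a24 x) + (pd e3 P4 x - pd e4 P3 x) * cnj (a34 x)"

definition codiff_pairing :: "cfun \<Rightarrow> cfun \<Rightarrow> cfun \<Rightarrow> cfun \<Rightarrow> cfun \<Rightarrow> cfun \<Rightarrow> cfun \<Rightarrow> cfun \<Rightarrow> cfun \<Rightarrow> cfun \<Rightarrow> cfun" where
  "codiff_pairing P1 P2 P3 P4 a12 a13 a14 a23 a24 a34 x =
     P1 x * cnj (pd e2 a12 x + pd e3 a13 x + pd e4 a14 x)
     + P2 x * cnj (- pd e1 a12 x + pd e3 a23 x + pd e4 a24 x)
     + P3 x * cnj (- pd e1 a13 x - pd e2 a23 x + pd e4 a34 x)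
     + P4 x * cnj (- pd e1 a14 x - pd e2 a24 x - pd e3 a34 x)"

text \<open>
  The Leibniz rule: the fields \<open>V\<close> are the coefficients of the contraction of \<open>cnj a\<close> with \<open>P\<close>.
\<close>

lemma d_pairing_by_parts:
  fixes P1 P2 P3 P4 a12 a13 a14 a23 a24 a34 :: cfun
  assumes P: "periodic P1" "periodic P2" "periodic P3" "periodic P4"
    and a: "periodic a12" "periodic a13" "periodic a14" "periodic a23" "periodic a24" "periodic a34"
  obtains V1 V2 V3 V4 :: cfun where "periodic V1" "periodic V2" "periodic V3" "periodic V4"
    "\<forall>x. d_pairing P1 P2 P3 P4 a12 a13 a14 a23 a24 a34 x = pd e1 V1 x + pd e2 V2 x + pd e3 V3 x + pd e4 V4 x
       + codiff_pairing P1 P2 P3 P4 a12 a13 a14 a23 a24 a34 x"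
proof (rule that)
  let ?V1 = "\<lambda>x. P2 x * cnj (a12 x) + P3 x * cnj (a13 x) + P4 x * cnj (a14 x)"
  let ?V2 = "\<lambda>x. P3 x * cnj (a23 x) + P4 x * cnj (a24 x) - P1 x * cnj (a12 x)"
  let ?V3 = "\<lambda>x. P4 x * cnj (a34 x) - P1 x * cnj (a13 x) - P2 x * cnj (a23 x)"
  let ?V4 = "\<lambda>x. - (P1 x * cnj (a14 x)) - P2 x * cnj (a24 x) - P3 x * cnj (a34 x)"
  show "periodic ?V1" "periodic ?V2" "periodic ?V3" "periodic ?V4"
    by (intro periodic_intros P a)+
  show "\<forall>x. d_pairing P1 P2 P3 P4 a12 a13 a14 a23 a24 a34 x = pd e1 ?V1 x + pd e2 ?V2 x + pd e3 ?V3 x + pd e4 ?V4 x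
       + codiff_pairing P1 P2 P3 P4 a12 a13 a14 a23 a24 a34 x"
    unfolding d_pairing_def codiff_pairing_def
    by (simp add: pd_simps P[THEN periodic_smooth] a[THEN periodic_smooth] smooth_intros algebra_simps)
qed

lemma sum_squares_zero:
  assumes "(cmod a)\<^sup>2 + (cmod b)\<^sup>2 + (cmod d)\<^sup>2 + (cmod e)\<^sup>2 = 0"
  shows "a = 0 \<and> b = 0 \<and> d = 0 \<and> e = 0"
proof -
  have "(cmod a)\<^sup>2 \<le> 0" "(cmod b)\<^sup>2 \<le> 0" "(cmod d)\<^sup>2 \<le> 0" "(cmod e)\<^sup>2 \<le> 0"
    unfolding assms[symmetric] by simp_all
  then show ?thesis by simp
qed

text \<open>
  The \<open>1\<close>-forms \<open>P\<close> and \<open>Q\<close> stand for the codifferentials of a \<open>2\<close>-form \<open>a\<close> and, up to sign, of its Hodge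
  dual, or for parts of pure type of these; the first equation is the Laplace equation, paired with \<open>a\<close>.
\<close>

lemma energy_zero:
  fixes P1 P2 P3 P4 Q1 Q2 Q3 Q4 a12 a13 a14 a23 a24 a34 :: cfun
  assumes P: "periodic P1" "periodic P2" "periodic P3" "periodic P4"
    and Q: "periodic Q1" "periodic Q2" "periodic Q3" "periodic Q4"
    and a: "periodic a12" "periodic a13" "periodic a14" "periodic a23" "periodic a24" "periodic a34"
    and lap: "\<And>x. d_pairing P1 P2 P3 P4 a12 a13 a14 a23 a24 a34 x
      = d_pairing Q1 Q2 Q3 Q4 a34 (\<lambda>x. - a24 x) a23 a14 (\<lambda>x. - a13 x) a12 x"
    and normP: "\<And>x. codiff_pairing P1 P2 P3 P4 a12 a13 a14 a23 a24 a34 x = of_real (normsq P1 P2 P3 P4 x)"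
    and normQ: "\<And>x. codiff_pairing Q1 Q2 Q3 Q4 a34 (\<lambda>x. - a24 x) a23 a14 (\<lambda>x. - a13 x) a12 x
      = - of_real (normsq Q1 Q2 Q3 Q4 x)"
  shows "P1 x = 0 \<and> P2 x = 0 \<and> P3 x = 0 \<and> P4 x = 0 \<and> Q1 x = 0 \<and> Q2 x = 0 \<and> Q3 x = 0 \<and> Q4 x = 0"
proof -
  obtain Y1 Y2 Y3 Y4 where Y: "periodic Y1" "periodic Y2" "periodic Y3" "periodic Y4"
    and dY: "\<forall>x. d_pairing P1 P2 P3 P4 a12 a13 a14 a23 a24 a34 x = pd e1 Y1 x + pd e2 Y2 x + pd e3 Y3 x + pd e4 Y4 x
       + codiff_pairing P1 P2 P3 P4 a12 a13 a14 a23 a24 a34 x"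
    by (rule d_pairing_by_parts[OF P a])
  obtain Z1 Z2 Z3 Z4 where Z: "periodic Z1" "periodic Z2" "periodic Z3" "periodic Z4"
    and dZ: "\<forall>x. d_pairing Q1 Q2 Q3 Q4 a34 (\<lambda>x. - a24 x) a23 a14 (\<lambda>x. - a13 x) a12 x
       = pd e1 Z1 x + pd e2 Z2 x + pd e3 Z3 x + pd e4 Z4 x
       + codiff_pairing Q1 Q2 Q3 Q4 a34 (\<lambda>x. - a24 x) a23 a14 (\<lambda>x. - a13 x) a12 x"
    by (rule d_pairing_by_parts[OF Q a(6) periodic_uminus[OF a(5)] a(4) a(3) periodic_uminus[OF a(2)] a(1)])
  have eq: "Re (pd e1 (\<lambda>x. Z1 x - Y1 x) x + pd e2 (\<lambda>x. Z2 x - Y2 x) x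
      + pd e3 (\<lambda>x. Z3 x - Y3 x) x + pd e4 (\<lambda>x. Z4 x - Y4 x) x) = normsq P1 P2 P3 P4 x + normsq Q1 Q2 Q3 Q4 x" for x
  proof -
    have "(pd e1 Z1 x + pd e2 Z2 x + pd e3 Z3 x + pd e4 Z4 x) - (pd e1 Y1 x + pd e2 Y2 x + pd e3 Y3 x + pd e4 Y4 x)
       = of_real (normsq P1 P2 P3 P4 x + normsq Q1 Q2 Q3 Q4 x)"
      using lap[of x] unfolding dY[rule_format] dZ[rule_format] normP normQ by (simp add: algebra_simps)
    then show ?thesis
      using Y[THEN periodic_smooth] Z[THEN periodic_smooth]
      by (simp add: pd_diff complex_eq_iff algebra_simps)
  qed
  have "normsq P1 P2 P3 P4 x + normsq Q1 Q2 Q3 Q4 x = 0"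
    by (rule divergence_nonneg_zero[of "\<lambda>x. Z1 x - Y1 x" "\<lambda>x. Z2 x - Y2 x"
          "\<lambda>x. Z3 x - Y3 x" "\<lambda>x. Z4 x - Y4 x", OF _ _ _ _ eq])
      (intro periodic_intros Y Z | simp add: normsq_def)+
  moreover have "normsq P1 P2 P3 P4 x \<ge> 0" "normsq Q1 Q2 Q3 Q4 x \<ge> 0" by (simp_all add: normsq_def)
  ultimately have "normsq P1 P2 P3 P4 x = 0" "normsq Q1 Q2 Q3 Q4 x = 0" by linarith+
  then show ?thesis unfolding normsq_def by (blast dest: sum_squares_zero)
qed

lemma periodic_divide: "periodic f \<Longrightarrow> periodic (\<lambda>x. f x / c)" for f :: cfun
  using periodic_mult[OF _ periodic_const, of f "inverse c"] by (simp add: divide_inverse)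

lemma periodic_tp:
  assumes "periodic c" "periodic S" "periodic b1" "periodic b2" "periodic b3" "periodic b4"
  shows "periodic (tp1 k c S b1 b2 b3 b4)" "periodic (tp2 k c S b1 b2 b3 b4)"
    "periodic (tp3 k c S b1 b2 b3 b4)" "periodic (tp4 k c S b1 b2 b3 b4)"
  unfolding tp_defs by (intro periodic_divide periodic_intros assms)+

lemma tp_uminus:
  "tp1 k c S (\<lambda>x. - b1 x) (\<lambda>x. - b2 x) (\<lambda>x. - b3 x) (\<lambda>x. - b4 x) = (\<lambda>x. - tp1 k c S b1 b2 b3 b4 x)"
  "tp2 k c S (\<lambda>x. - b1 x) (\<lambda>x. - b2 x) (\<lambda>x. - b3 x) (\<lambda>x. - b4 x) = (\<lambda>x. - tp2 k c S b1 b2 b3 b4 x)"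
  "tp3 k c S (\<lambda>x. - b1 x) (\<lambda>x. - b2 x) (\<lambda>x. - b3 x) (\<lambda>x. - b4 x) = (\<lambda>x. - tp3 k c S b1 b2 b3 b4 x)"
  "tp4 k c S (\<lambda>x. - b1 x) (\<lambda>x. - b2 x) (\<lambda>x. - b3 x) (\<lambda>x. - b4 x) = (\<lambda>x. - tp4 k c S b1 b2 b3 b4 x)"
  unfolding tp_defs by (auto simp: fun_eq_iff field_simps)

lemma form11_degree: "length vs \<noteq> 2 \<Longrightarrow> form11 c S f u v w x vs = 0"
  unfolding form11_def by (rule form_wrong_length)

lemma form1_type_degree: "length vs \<noteq> 1 \<Longrightarrow> form1_type k c S b1 b2 b3 b4 x vs = 0"
  unfolding form1_type_def by (rule form_wrong_length)

lemma form1_type_uminus: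
  "- form1_type k c S b1 b2 b3 b4 = form1_type k c S (\<lambda>x. - b1 x) (\<lambda>x. - b2 x) (\<lambda>x. - b3 x) (\<lambda>x. - b4 x)"
  unfolding form1_type_def form_uminus tp_uminus by (rule refl)

context
  fixes c S :: "pt \<Rightarrow> real"
  assumes cs: "\<And>x. (c x)\<^sup>2 + (S x)\<^sup>2 = 1"
begin

text \<open>The two types are orthogonal to each other for the Hermitian product, since \<open>J\<close> is skew-symmetric.\<close>

lemma tp_norm:
  assumes "k = \<i> \<or> k = - \<i>"
  shows "tp1 k c S b1 b2 b3 b4 x * cnj (b1 x) + tp2 k c S b1 b2 b3 b4 x * cnj (b2 x)
    + tp3 k c S b1 b2 b3 b4 x * cnj (b3 x) + tp4 k c S b1 b2 b3 b4 x * cnj (b4 x)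
  = of_real (normsq (tp1 k c S b1 b2 b3 b4) (tp2 k c S b1 b2 b3 b4) (tp3 k c S b1 b2 b3 b4) (tp4 k c S b1 b2 b3 b4) x)"
proof -
  have SS: "y * (z * (complex_of_real (S x) * complex_of_real (S x))) = y * z - y * (z * (complex_of_real (c x) * complex_of_real (c x)))" for y z
    unfolding cs_complex(1)[where c = c and S = S, OF cs] by (simp add: algebra_simps)
  show ?thesis
    unfolding normsq_def of_real_add complex_norm_square
    using assms
    by (elim disjE; simp add: tp_defs algebra_simps add_divide_distrib diff_divide_distrib; simp add: SS diff_divide_distrib)
qed

lemma form11_eq_0_iff: "form11 c S f u v w = 0 \<longleftrightarrow> (\<forall>x. f x = 0 \<and> u x = 0 \<and> v x = 0 \<and> w x = 0)"
proof
  assume 0: "form11 c S f u v w = 0"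
  show "\<forall>x. f x = 0 \<and> u x = 0 \<and> v x = 0 \<and> w x = 0"
  proof
    fix x
    have *: "f x * c x + u x = 0" "f x * c x - u x = 0" "f x * S x + v x = 0" "v x - f x * S x = 0" "w x = 0"
      using 0 unfolding form_zero(2)[symmetric] form11_def form2_eq_iff by meson+
    have "2 * u x = (f x * c x + u x) - (f x * c x - u x)" "2 * v x = (f x * S x + v x) + (v x - f x * S x)" by simp_all
    then have uv: "u x = 0" "v x = 0" unfolding * by simp_all
    then have fc: "f x * c x = 0" "f x * S x = 0" using * by simp_all
    have "f x = 0"
    proof (rule ccontr)
      assume "f x \<noteq> 0"
      then have "c x = 0" "S x = 0" using fc by auto
      then show False using cs[of x] by simp
    qed
    with uv *(5) show "f x = 0 \<and> u x = 0 \<and> v x = 0 \<and> w x = 0" by simp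
  qed
next
  assume "\<forall>x. f x = 0 \<and> u x = 0 \<and> v x = 0 \<and> w x = 0"
  then have "f = (\<lambda>x. 0)" "u = (\<lambda>x. 0)" "v = (\<lambda>x. 0)" "w = (\<lambda>x. 0)" by blast+
  then show "form11 c S f u v w = 0" by (simp add: form11_def form_zero)
qed

lemma hodge_form11: "hodge (Jst c S) (om c S) (form11 c S f u v w) = form11 c S f (\<lambda>x. - u x) (\<lambda>x. - v x) (\<lambda>x. - w x)"
  unfolding form11_def hodge_form2[OF cs] form2_eq_iff by (auto simp: fun_eq_iff)

lemma del_delbar_form11:
  "del (Jst c S) (form11 c S f u v w) = bideg_proj (Jst c S) 2 1 (ext_d (form11 c S f u v w))"
  "delbar (Jst c S) (form11 c S f u v w) = bideg_proj (Jst c S) 1 2 (ext_d (form11 c S f u v w))"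
  by (rule del_delbar_of_type_11[OF form11_degree bideg_form11[OF cs]]; assumption)+

lemma delbar_form1_type:
  "delbar (Jst c S) (form1_type (- \<i>) c S b1 b2 b3 b4) = bideg_proj (Jst c S) 1 1 (ext_d (form1_type (- \<i>) c S b1 b2 b3 b4))"
proof (rule delbar_of_type_10)
  show "bideg_proj (Jst c S) 1 0 (form1_type (- \<i>) c S b1 b2 b3 b4) = form1_type (- \<i>) c S b1 b2 b3 b4"
    by (subst (1) form1_type_def) (simp only: bideg_form1 tp_idem[OF cs, of "- \<i>", simplified])
  show "bideg_proj (Jst c S) 0 1 (form1_type (- \<i>) c S b1 b2 b3 b4) = 0"
    by (subst (1) form1_type_def) (simp only: bideg_form1 tp_idem[OF cs, of "- \<i>", simplified])
qed (rule form1_type_degree)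

lemma del_form1_type:
  "del (Jst c S) (form1_type \<i> c S b1 b2 b3 b4) = bideg_proj (Jst c S) 1 1 (ext_d (form1_type \<i> c S b1 b2 b3 b4))"
proof (rule del_of_type_01)
  show "bideg_proj (Jst c S) 0 1 (form1_type \<i> c S b1 b2 b3 b4) = form1_type \<i> c S b1 b2 b3 b4"
    by (subst (1) form1_type_def) (simp only: bideg_form1 tp_idem[OF cs, of \<i>, simplified])
  show "bideg_proj (Jst c S) 1 0 (form1_type \<i> c S b1 b2 b3 b4) = 0"
    by (subst (1) form1_type_def) (simp only: bideg_form1 tp_idem[OF cs, of \<i>, simplified])
qed (rule form1_type_degree)

lemma hodge_form3_type:
  "hodge (Jst c S) (om c S) (form3_type k c S b1 b2 b3 b4) = - form1_type k c S b1 b2 b3 b4"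
  unfolding form3_type_def form1_type_def hodge_form3[OF cs] form_uminus by (rule refl)

end

text \<open>
  In the application, \<open>D\<close> is the codifferential of \<open>f \<omega>\<close> and \<open>- C\<close> that of the anti-self-dual part of a \<open>(1,1)\<close>-form.
  That \<open>D - C\<close> has type \<open>(0,1)\<close> and \<open>D + C\<close> type \<open>(1,0)\<close> means \<open>C = - \<i> (D \<circ> J)\<close>, and \<open>D \<circ> J = - df + p f dt\<^sub>4\<close>.
\<close>

lemma type_equations:
  fixes c S f f1 f2 f3 f4 p C1 C2 C3 C4 :: complex
  assumes cs: "c * c + S * S = 1"
  defines "D1 \<equiv> f2 * c + f3 * S" and "D2 \<equiv> - (f1 * c) + f * S * p - f4 * S"
    and "D3 \<equiv> - (f1 * S) - f * c * p + f4 * c" and "D4 \<equiv> f2 * S - f3 * c"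
  shows "(D1 - C1) + (- \<i>) * (c * (D2 - C2) + S * (D3 - C3)) = 0 \<and> (D2 - C2) - (- \<i>) * (c * (D1 - C1) + S * (D4 - C4)) = 0 \<and>
      (D3 - C3) + (- \<i>) * (c * (D4 - C4) - S * (D1 - C1)) = 0 \<and> (D4 - C4) + (- \<i>) * (S * (D2 - C2) - c * (D3 - C3)) = 0 \<and>
      (D1 + C1) + \<i> * (c * (D2 + C2) + S * (D3 + C3)) = 0 \<and> (D2 + C2) - \<i> * (c * (D1 + C1) + S * (D4 + C4)) = 0 \<and>
      (D3 + C3) + \<i> * (c * (D4 + C4) - S * (D1 + C1)) = 0 \<and> (D4 + C4) + \<i> * (S * (D2 + C2) - c * (D3 + C3)) = 0
    \<longleftrightarrow> C1 = \<i> * f1 \<and> C2 = \<i> * f2 \<and> C3 = \<i> * f3 \<and> C4 = \<i> * (f4 - p * f)"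
    (is "?T \<longleftrightarrow> ?H")
proof -
  have SS: "S * S = 1 - c * c" using cs by (simp add: algebra_simps)
  have SSy: "S * (S * y) = y - c * (c * y)" for y
    by (simp only: mult.assoc[symmetric] SS left_diff_distrib mult_1)
  have XJ: "c * D2 + S * D3 = - f1" "c * D1 + S * D4 = f2" "c * D4 - S * D1 = - f3" "S * D2 - c * D3 = p * f - f4"
    unfolding D1_def D2_def D3_def D4_def by (simp_all add: algebra_simps SS SSy)
  have JXJ: "c * f2 + S * f3 = D1" "- (c * f1) - S * (f4 - p * f) = D2" "c * (f4 - p * f) - S * f1 = D3" "S * f2 - c * f3 = D4"
    unfolding D1_def D2_def D3_def D4_def by (simp_all add: algebra_simps)
  show ?thesis
  proof
    assume T: ?T
    note t = T[THEN conjunct1]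
      T[THEN conjunct2, THEN conjunct1]
      T[THEN conjunct2, THEN conjunct2, THEN conjunct1]
      T[THEN conjunct2, THEN conjunct2, THEN conjunct2, THEN conjunct1]
      T[THEN conjunct2, THEN conjunct2, THEN conjunct2, THEN conjunct2, THEN conjunct1]
      T[THEN conjunct2, THEN conjunct2, THEN conjunct2, THEN conjunct2, THEN conjunct2, THEN conjunct1]
      T[THEN conjunct2, THEN conjunct2, THEN conjunct2, THEN conjunct2, THEN conjunct2, THEN conjunct2, THEN conjunct1]
      T[THEN conjunct2, THEN conjunct2, THEN conjunct2, THEN conjunct2, THEN conjunct2, THEN conjunct2, THEN conjunct2]
    have "2 * C1 = 2 * (\<i> * f1)"
    proof -
      have "2 * C1 = ((D1 + C1) + \<i> * (c * (D2 + C2) + S * (D3 + C3))) - ((D1 - C1) + (- \<i>) * (c * (D2 - C2) + S * (D3 - C3))) - 2 * \<i> * (c * D2 + S * D3)"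
        by (simp add: algebra_simps)
      then show ?thesis unfolding t XJ by simp
    qed
    moreover have "2 * C2 = 2 * (\<i> * f2)"
    proof -
      have "2 * C2 = ((D2 + C2) - \<i> * (c * (D1 + C1) + S * (D4 + C4))) - ((D2 - C2) - (- \<i>) * (c * (D1 - C1) + S * (D4 - C4))) + 2 * \<i> * (c * D1 + S * D4)"
        by (simp add: algebra_simps)
      then show ?thesis unfolding t XJ by simp
    qed
    moreover have "2 * C3 = 2 * (\<i> * f3)"
    proof -
      have "2 * C3 = ((D3 + C3) + \<i> * (c * (D4 + C4) - S * (D1 + C1))) - ((D3 - C3) + (- \<i>) * (c * (D4 - C4) - S * (D1 - C1))) - 2 * \<i> * (c * D4 - S * D1)"
        by (simp add: algebra_simps)
      then show ?thesis unfolding t XJ by simp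
    qed
    moreover have "2 * C4 = 2 * (\<i> * (f4 - p * f))"
    proof -
      have "2 * C4 = ((D4 + C4) + \<i> * (S * (D2 + C2) - c * (D3 + C3))) - ((D4 - C4) + (- \<i>) * (S * (D2 - C2) - c * (D3 - C3))) - 2 * \<i> * (S * D2 - c * D3)"
        by (simp add: algebra_simps)
      then show ?thesis unfolding t XJ by (simp add: algebra_simps)
    qed
    ultimately show ?H by simp
  next
    assume ?H
    then have C: "C1 = \<i> * f1" "C2 = \<i> * f2" "C3 = \<i> * f3" "C4 = \<i> * (f4 - p * f)" by blast+
    have CJ: "c * C2 + S * C3 = \<i> * D1" "c * C1 + S * C4 = - (\<i> * D2)" "c * C4 - S * C1 = \<i> * D3" "S * C2 - c * C3 = \<i> * D4"
      unfolding C JXJ[symmetric] by (simp_all add: algebra_simps)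
    have lin: "k * (a - a') + l * (b - b') = (k * a + l * b) - (k * a' + l * b')"
      "k * (a - a') - l * (b - b') = (k * a - l * b) - (k * a' - l * b')"
      "k * (a + a') + l * (b + b') = (k * a + l * b) + (k * a' + l * b')"
      "k * (a + a') - l * (b + b') = (k * a - l * b) + (k * a' - l * b')" for k l a a' b b' :: complex
      by (simp_all add: algebra_simps)
    have e: "c * (D2 - C2) + S * (D3 - C3) = - f1 - \<i> * D1" "c * (D1 - C1) + S * (D4 - C4) = f2 + \<i> * D2"
      "c * (D4 - C4) - S * (D1 - C1) = - f3 - \<i> * D3" "S * (D2 - C2) - c * (D3 - C3) = p * f - f4 - \<i> * D4"
      "c * (D2 + C2) + S * (D3 + C3) = - f1 + \<i> * D1" "c * (D1 + C1) + S * (D4 + C4) = f2 - \<i> * D2"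
      "c * (D4 + C4) - S * (D1 + C1) = - f3 + \<i> * D3" "S * (D2 + C2) - c * (D3 + C3) = p * f - f4 + \<i> * D4"
      unfolding lin CJ XJ by simp_all
    show ?T unfolding e unfolding C by (simp add: algebra_simps)
  qed
qed

context
  fixes c S :: "pt \<Rightarrow> real"
  assumes cs: "\<And>x. (c x)\<^sup>2 + (S x)\<^sup>2 = 1"
begin

lemma ext_d_hodge_form2:
  assumes a: "smooth a12" "smooth a13" "smooth a14" "smooth a23" "smooth a24" "smooth a34"
  shows "ext_d (hodge (Jst c S) (om c S) (form2 a12 a13 a14 a23 a24 a34)) = form3
    (\<lambda>x. pd e2 a12 x + pd e3 a13 x + pd e4 a14 x) (\<lambda>x. - pd e1 a12 x + pd e3 a23 x + pd e4 a24 x)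
    (\<lambda>x. - pd e1 a13 x - pd e2 a23 x + pd e4 a34 x) (\<lambda>x. - pd e1 a14 x - pd e2 a24 x - pd e3 a34 x)"
  unfolding hodge_form2[OF cs]
  by (subst ext_d_form2) (simp_all add: a smooth_intros pd_uminus)

lemma ext_d_adj_form2:
  assumes a: "smooth a12" "smooth a13" "smooth a14" "smooth a23" "smooth a24" "smooth a34"
  shows "ext_d_adj (Jst c S) (om c S) (form2 a12 a13 a14 a23 a24 a34) = form1
    (\<lambda>x. pd e2 a12 x + pd e3 a13 x + pd e4 a14 x) (\<lambda>x. - pd e1 a12 x + pd e3 a23 x + pd e4 a24 x)
    (\<lambda>x. - pd e1 a13 x - pd e2 a23 x + pd e4 a34 x) (\<lambda>x. - pd e1 a14 x - pd e2 a24 x - pd e3 a34 x)"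
  unfolding ext_d_adj_def ext_d_hodge_form2[OF a] hodge_form3[OF cs] form_uminus minus_minus by (rule refl)

lemma ext_d_adj_form3:
  assumes "smooth t1" "smooth t2" "smooth t3" "smooth t4"
  shows "ext_d_adj (Jst c S) (om c S) (form3 t1 t2 t3 t4) = - hodge (Jst c S) (om c S) (ext_d
    (form1 (\<lambda>x. - t1 x) (\<lambda>x. - t2 x) (\<lambda>x. - t3 x) (\<lambda>x. - t4 x)))"
  unfolding ext_d_adj_def hodge_form3[OF cs] by (rule refl)

text \<open>
  The case of \<open>energy_zero\<close> where \<open>P\<close> is the codifferential of the form itself and \<open>Q\<close>, up to sign, that of
  its Hodge dual.
\<close>

lemma d_harmonic_coclosed:
  assumes a: "periodic a12" "periodic a13" "periodic a14" "periodic a23" "periodic a24" "periodic a34"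
    and h: "d_laplacian (Jst c S) (om c S) (form2 a12 a13 a14 a23 a24 a34) = 0"
  shows "pd e2 a12 x + pd e3 a13 x + pd e4 a14 x = 0" "- pd e1 a12 x + pd e3 a23 x + pd e4 a24 x = 0"
    "- pd e1 a13 x - pd e2 a23 x + pd e4 a34 x = 0" "- pd e1 a14 x - pd e2 a24 x - pd e3 a34 x = 0"
proof -
  note sa = a[THEN periodic_smooth]
  define A1 where "A1 = (\<lambda>x. pd e2 a12 x + pd e3 a13 x + pd e4 a14 x)"
  define A2 where "A2 = (\<lambda>x. - pd e1 a12 x + pd e3 a23 x + pd e4 a24 x)"
  define A3 where "A3 = (\<lambda>x. - pd e1 a13 x - pd e2 a23 x + pd e4 a34 x)"
  define A4 where "A4 = (\<lambda>x. - pd e1 a14 x - pd e2 a24 x - pd e3 a34 x)"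
  define B1 where "B1 = (\<lambda>x. pd e2 a34 x - pd e3 a24 x + pd e4 a23 x)"
  define B2 where "B2 = (\<lambda>x. - pd e1 a34 x + pd e3 a14 x - pd e4 a13 x)"
  define B3 where "B3 = (\<lambda>x. pd e1 a24 x - pd e2 a14 x + pd e4 a12 x)"
  define B4 where "B4 = (\<lambda>x. - pd e1 a23 x + pd e2 a13 x - pd e3 a12 x)"
  have A: "periodic A1" "periodic A2" "periodic A3" "periodic A4"
    unfolding A1_def A2_def A3_def A4_def by (intro periodic_intros a)+
  have B: "periodic B1" "periodic B2" "periodic B3" "periodic B4"
    unfolding B1_def B2_def B3_def B4_def by (intro periodic_intros a)+
  note sA = A[THEN periodic_smooth] and sB = B[THEN periodic_smooth]
  have "d_laplacian (Jst c S) (om c S) (form2 a12 a13 a14 a23 a24 a34) =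
     ext_d (form1 A1 A2 A3 A4) - hodge (Jst c S) (om c S) (ext_d (form1 (\<lambda>x. - B1 x) (\<lambda>x. - B2 x) (\<lambda>x. - B3 x) (\<lambda>x. - B4 x)))"
    unfolding d_laplacian_def ext_d_adj_form2[OF sa] ext_d_form2[OF sa] A1_def[symmetric] A2_def[symmetric] A3_def[symmetric]
      A4_def[symmetric] B1_def[symmetric] B2_def[symmetric] B3_def[symmetric] B4_def[symmetric] ext_d_adj_form3[OF sB]
    by simp
  then have eq: "ext_d (form1 A1 A2 A3 A4) = hodge (Jst c S) (om c S) (ext_d (form1 (\<lambda>x. - B1 x) (\<lambda>x. - B2 x) (\<lambda>x. - B3 x) (\<lambda>x. - B4 x)))"
    using h by simp
  note eq = eq[unfolded ext_d_form1[OF sA] ext_d_form1[OF smooth_uminus[OF sB(1)] smooth_uminus[OF sB(2)]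
        smooth_uminus[OF sB(3)] smooth_uminus[OF sB(4)]] hodge_form2[OF cs] form2_eq_iff]
  define Q1 Q2 Q3 Q4 where "Q1 = (\<lambda>x. - B1 x)" and "Q2 = (\<lambda>x. - B2 x)" and "Q3 = (\<lambda>x. - B3 x)" and "Q4 = (\<lambda>x. - B4 x)"
  note Qd = Q1_def Q2_def Q3_def Q4_def
  have Q: "periodic Q1" "periodic Q2" "periodic Q3" "periodic Q4"
    unfolding Qd by (intro periodic_intros B)+
  note eq = eq[folded Qd]
  have e: "pd e1 A2 x - pd e2 A1 x = pd e3 Q4 x - pd e4 Q3 x" "pd e1 A3 x - pd e3 A1 x = - (pd e2 Q4 x - pd e4 Q2 x)"
    "pd e1 A4 x - pd e4 A1 x = pd e2 Q3 x - pd e3 Q2 x" "pd e2 A3 x - pd e3 A2 x = pd e1 Q4 x - pd e4 Q1 x"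
    "pd e2 A4 x - pd e4 A2 x = - (pd e1 Q3 x - pd e3 Q1 x)" "pd e3 A4 x - pd e4 A3 x = pd e1 Q2 x - pd e2 Q1 x" for x
    using eq by meson+
  have "A1 x = 0 \<and> A2 x = 0 \<and> A3 x = 0 \<and> A4 x = 0 \<and> Q1 x = 0 \<and> Q2 x = 0 \<and> Q3 x = 0 \<and> Q4 x = 0"
  proof (rule energy_zero[OF A Q a])
    fix x
    show "d_pairing A1 A2 A3 A4 a12 a13 a14 a23 a24 a34 x
      = d_pairing Q1 Q2 Q3 Q4 a34 (\<lambda>x. - a24 x) a23 a14 (\<lambda>x. - a13 x) a12 x"
      unfolding d_pairing_def e by (simp add: algebra_simps)
    show "codiff_pairing A1 A2 A3 A4 a12 a13 a14 a23 a24 a34 x = of_real (normsq A1 A2 A3 A4 x)"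
      unfolding codiff_pairing_def normsq_def of_real_add complex_norm_square A1_def A2_def A3_def A4_def by (rule refl)
    show "codiff_pairing Q1 Q2 Q3 Q4 a34 (\<lambda>x. - a24 x) a23 a14 (\<lambda>x. - a13 x) a12 x = - of_real (normsq Q1 Q2 Q3 Q4 x)"
      unfolding codiff_pairing_def normsq_def of_real_add complex_norm_square Qd B1_def B2_def B3_def B4_def
      by (simp add: pd_uminus sa algebra_simps)
  qed
  then show "pd e2 a12 x + pd e3 a13 x + pd e4 a14 x = 0" "- pd e1 a12 x + pd e3 a23 x + pd e4 a24 x = 0"
    "- pd e1 a13 x - pd e2 a23 x + pd e4 a34 x = 0" "- pd e1 a14 x - pd e2 a24 x - pd e3 a34 x = 0"
    by (simp_all add: A1_def A2_def A3_def A4_def)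
qed

text \<open>
  In the following, \<open>a\<^sub>i\<^sub>j\<close> are the coefficients of a \<open>(1,1)\<close>-form \<open>\<alpha>\<close>, \<open>A\<close> is its codifferential, and \<open>B\<close> represents \<open>d\<alpha>\<close> by
  contraction of the volume form; \<open>A\<close> represents \<open>d (* \<alpha>)\<close> in the same way.
\<close>

context
  fixes f u v w a12 a13 a14 a23 a24 a34 A1 A2 A3 A4 B1 B2 B3 B4 :: cfun
  assumes per: "periodic c" "periodic S" "periodic f" "periodic u" "periodic v" "periodic w"
  defines "a12 \<equiv> \<lambda>x. f x * c x + u x" and "a13 \<equiv> \<lambda>x. f x * S x + v x" and "a14 \<equiv> w"
    and "a23 \<equiv> \<lambda>x. - w x" and "a24 \<equiv> \<lambda>x. v x - f x * S x" and "a34 \<equiv> \<lambda>x. f x * c x - u x"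
  defines "A1 \<equiv> \<lambda>x. pd e2 a12 x + pd e3 a13 x + pd e4 a14 x"
    and "A2 \<equiv> \<lambda>x. - pd e1 a12 x + pd e3 a23 x + pd e4 a24 x"
    and "A3 \<equiv> \<lambda>x. - pd e1 a13 x - pd e2 a23 x + pd e4 a34 x"
    and "A4 \<equiv> \<lambda>x. - pd e1 a14 x - pd e2 a24 x - pd e3 a34 x"
    and "B1 \<equiv> \<lambda>x. pd e2 a34 x - pd e3 a24 x + pd e4 a23 x"
    and "B2 \<equiv> \<lambda>x. - pd e1 a34 x + pd e3 a14 x - pd e4 a13 x"
    and "B3 \<equiv> \<lambda>x. pd e1 a24 x - pd e2 a14 x + pd e4 a12 x"
    and "B4 \<equiv> \<lambda>x. - pd e1 a23 x + pd e2 a13 x - pd e3 a12 x"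
begin

lemma a_periodic: "periodic a12" "periodic a13" "periodic a14" "periodic a23" "periodic a24" "periodic a34"
  unfolding a12_def a13_def a14_def a23_def a24_def a34_def by (intro periodic_intros per)+

lemmas a_smooth = a_periodic[THEN periodic_smooth]

lemma AB_periodic: "periodic A1" "periodic A2" "periodic A3" "periodic A4" "periodic B1" "periodic B2" "periodic B3" "periodic B4"
  unfolding A1_def A2_def A3_def A4_def B1_def B2_def B3_def B4_def by (intro periodic_intros a_periodic)+

lemma form11_a: "form11 c S f u v w = form2 a12 a13 a14 a23 a24 a34"
  unfolding form11_def a12_def a13_def a14_def a23_def a24_def a34_def by (rule refl)

lemma delbar_adj_form11:
  "delbar_adj (Jst c S) (om c S) (form11 c S f u v w) = form1_type (- \<i>) c S A1 A2 A3 A4"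
proof -
  have "del (Jst c S) (hodge (Jst c S) (om c S) (form11 c S f u v w))
      = bideg_proj (Jst c S) 2 1 (ext_d (hodge (Jst c S) (om c S) (form11 c S f u v w)))"
    unfolding hodge_form11[OF cs] by (rule del_delbar_form11(1)[OF cs])
  also have "\<dots> = form3_type (- \<i>) c S A1 A2 A3 A4"
    unfolding form11_a ext_d_hodge_form2[OF a_smooth] bideg_form3[OF cs] A1_def A2_def A3_def A4_def by (rule refl)
  finally show ?thesis
    unfolding delbar_adj_def by (simp add: hodge_form3_type[OF cs])
qed

lemma delbar_form11: "delbar (Jst c S) (form11 c S f u v w) = form3_type \<i> c S B1 B2 B3 B4"
  unfolding del_delbar_form11(2)[OF cs]
  unfolding form11_a ext_d_form2[OF a_smooth] bideg_form3[OF cs] B1_def B2_def B3_def B4_def by (rule refl)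

lemma delbar_laplacian_form11:
  "delbar_laplacian (Jst c S) (om c S) (form11 c S f u v w) =
    bideg_proj (Jst c S) 1 1 (ext_d (form1_type (- \<i>) c S A1 A2 A3 A4))
    - hodge (Jst c S) (om c S) (bideg_proj (Jst c S) 1 1
        (ext_d (form1_type \<i> c S (\<lambda>x. - B1 x) (\<lambda>x. - B2 x) (\<lambda>x. - B3 x) (\<lambda>x. - B4 x))))"
  unfolding delbar_laplacian_def delbar_form11 delbar_adj_form11 delbar_form1_type[OF cs]
  unfolding delbar_adj_def hodge_form3_type[OF cs] form1_type_uminus del_form1_type[OF cs]
  by simp

lemma delbar_harmonic_if:
  assumes "form1_type (- \<i>) c S A1 A2 A3 A4 = 0" "form1_type \<i> c S B1 B2 B3 B4 = 0"
  shows "delbar_laplacian (Jst c S) (om c S) (form11 c S f u v w) = 0"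
  unfolding delbar_laplacian_form11 assms(1) form1_type_uminus[symmetric] assms(2)
  by (simp add: ext_d_zero bideg_proj_zero hodge_zero)

text \<open>
  The case of \<open>energy_zero\<close> where \<open>P\<close> is the \<open>(1,0)\<close>-part of \<open>A\<close> and \<open>Q\<close> is minus the \<open>(0,1)\<close>-part of \<open>B\<close>. The
  projection to type \<open>(1,1)\<close> in the Laplacian can be dropped in the pairing because \<open>\<alpha>\<close> has that type.
\<close>

lemma delbar_harmonicD:
  assumes h: "delbar_laplacian (Jst c S) (om c S) (form11 c S f u v w) = 0"
  shows "tp1 (- \<i>) c S A1 A2 A3 A4 x = 0 \<and> tp2 (- \<i>) c S A1 A2 A3 A4 x = 0
    \<and> tp3 (- \<i>) c S A1 A2 A3 A4 x = 0 \<and> tp4 (- \<i>) c S A1 A2 A3 A4 x = 0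
    \<and> tp1 \<i> c S B1 B2 B3 B4 x = 0 \<and> tp2 \<i> c S B1 B2 B3 B4 x = 0
    \<and> tp3 \<i> c S B1 B2 B3 B4 x = 0 \<and> tp4 \<i> c S B1 B2 B3 B4 x = 0"
proof -
  define P1 P2 P3 P4 where "P1 = tp1 (- \<i>) c S A1 A2 A3 A4" and "P2 = tp2 (- \<i>) c S A1 A2 A3 A4"
    and "P3 = tp3 (- \<i>) c S A1 A2 A3 A4" and "P4 = tp4 (- \<i>) c S A1 A2 A3 A4"
  define Q1 Q2 Q3 Q4 where "Q1 = (\<lambda>x. - tp1 \<i> c S B1 B2 B3 B4 x)" and "Q2 = (\<lambda>x. - tp2 \<i> c S B1 B2 B3 B4 x)"
    and "Q3 = (\<lambda>x. - tp3 \<i> c S B1 B2 B3 B4 x)" and "Q4 = (\<lambda>x. - tp4 \<i> c S B1 B2 B3 B4 x)"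
  note Pd = P1_def P2_def P3_def P4_def and Qd = Q1_def Q2_def Q3_def Q4_def
  have P: "periodic P1" "periodic P2" "periodic P3" "periodic P4"
    unfolding Pd by (intro periodic_tp per AB_periodic)+
  have Q: "periodic Q1" "periodic Q2" "periodic Q3" "periodic Q4"
    unfolding Qd by (intro periodic_uminus periodic_tp per AB_periodic)+
  note sP = P[THEN periodic_smooth] and sQ = Q[THEN periodic_smooth]
  have L: "bideg_proj (Jst c S) 1 1 (ext_d (form1 P1 P2 P3 P4))
    = hodge (Jst c S) (om c S) (bideg_proj (Jst c S) 1 1 (ext_d (form1 Q1 Q2 Q3 Q4)))"
    using h unfolding delbar_laplacian_form11 unfolding form1_type_def tp_uminus Pd[symmetric] Qd[symmetric] by simp
  define X12 X13 X14 X23 X24 X34 where "X12 = (\<lambda>x. pd e1 P2 x - pd e2 P1 x)" and "X13 = (\<lambda>x. pd e1 P3 x - pd e3 P1 x)"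
    and "X14 = (\<lambda>x. pd e1 P4 x - pd e4 P1 x)" and "X23 = (\<lambda>x. pd e2 P3 x - pd e3 P2 x)"
    and "X24 = (\<lambda>x. pd e2 P4 x - pd e4 P2 x)" and "X34 = (\<lambda>x. pd e3 P4 x - pd e4 P3 x)"
  define Y12 Y13 Y14 Y23 Y24 Y34 where "Y12 = (\<lambda>x. pd e1 Q2 x - pd e2 Q1 x)" and "Y13 = (\<lambda>x. pd e1 Q3 x - pd e3 Q1 x)"
    and "Y14 = (\<lambda>x. pd e1 Q4 x - pd e4 Q1 x)" and "Y23 = (\<lambda>x. pd e2 Q3 x - pd e3 Q2 x)"
    and "Y24 = (\<lambda>x. pd e2 Q4 x - pd e4 Q2 x)" and "Y34 = (\<lambda>x. pd e3 Q4 x - pd e4 Q3 x)"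
  note XY = X12_def X13_def X14_def X23_def X24_def X34_def Y12_def Y13_def Y14_def Y23_def Y24_def Y34_def
  have zero: "form11 c S
      (\<lambda>x. (c x * (X12 x + X34 x) + S x * (X13 x - X24 x)) / 2 - (c x * (Y12 x + Y34 x) + S x * (Y13 x - Y24 x)) / 2)
      (\<lambda>x. (X12 x - X34 x) / 2 + (Y12 x - Y34 x) / 2) (\<lambda>x. (X13 x + X24 x) / 2 + (Y13 x + Y24 x) / 2)
      (\<lambda>x. (X14 x - X23 x) / 2 + (Y14 x - Y23 x) / 2) = 0"
  proof -
    have eq1: "form11 c S (\<lambda>x. (c x * (X12 x + X34 x) + S x * (X13 x - X24 x)) / 2)
        (\<lambda>x. (X12 x - X34 x) / 2) (\<lambda>x. (X13 x + X24 x) / 2) (\<lambda>x. (X14 x - X23 x) / 2)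
      = form11 c S (\<lambda>x. (c x * (Y12 x + Y34 x) + S x * (Y13 x - Y24 x)) / 2)
        (\<lambda>x. - ((Y12 x - Y34 x) / 2)) (\<lambda>x. - ((Y13 x + Y24 x) / 2)) (\<lambda>x. - ((Y14 x - Y23 x) / 2))"
      using L unfolding ext_d_form1[OF sP] ext_d_form1[OF sQ] XY[symmetric] bideg_form2[OF cs] hodge_form11[OF cs] .
    have diff: "form11 c S (\<lambda>x. f1 x - f2 x) (\<lambda>x. u1 x + u2 x) (\<lambda>x. v1 x + v2 x) (\<lambda>x. w1 x + w2 x) = 0"
      if eq: "form11 c S f1 u1 v1 w1 = form11 c S f2 (\<lambda>x. - u2 x) (\<lambda>x. - v2 x) (\<lambda>x. - w2 x)" for f1 u1 v1 w1 f2 u2 v2 w2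
    proof -
      have e: "f1 x * c x + u1 x = f2 x * c x + - u2 x" "f1 x * S x + v1 x = f2 x * S x + - v2 x" "w1 x = - w2 x"
        "- w1 x = - (- w2 x)" "v1 x - f1 x * S x = - v2 x - f2 x * S x" "f1 x * c x - u1 x = f2 x * c x - (- u2 x)" for x
        using eq unfolding form11_def form2_eq_iff by meson+
      have "(f1 x - f2 x) * c x + (u1 x + u2 x) = 0" "(f1 x - f2 x) * S x + (v1 x + v2 x) = 0" "w1 x + w2 x = 0"
        "- (w1 x + w2 x) = 0" "(v1 x + v2 x) - (f1 x - f2 x) * S x = 0" "(f1 x - f2 x) * c x - (u1 x + u2 x) = 0" for x
        using e[of x] by (simp_all add: algebra_simps)
      then show ?thesis
        unfolding form11_def form_zero(2)[symmetric] form2_eq_iff by (intro conjI ext)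
    qed
    show ?thesis by (rule diff[OF eq1])
  qed
  have z: "(c x * (X12 x + X34 x) + S x * (X13 x - X24 x)) / 2 - (c x * (Y12 x + Y34 x) + S x * (Y13 x - Y24 x)) / 2 = 0"
    "(X12 x - X34 x) / 2 + (Y12 x - Y34 x) / 2 = 0" "(X13 x + X24 x) / 2 + (Y13 x + Y24 x) / 2 = 0"
    "(X14 x - X23 x) / 2 + (Y14 x - Y23 x) / 2 = 0" for x
    using zero unfolding form11_eq_0_iff[OF cs] by meson+
  have Ae: "pd e2 a12 x + pd e3 a13 x + pd e4 a14 x = A1 x" "- pd e1 a12 x + pd e3 a23 x + pd e4 a24 x = A2 x"
    "- pd e1 a13 x - pd e2 a23 x + pd e4 a34 x = A3 x" "- pd e1 a14 x - pd e2 a24 x - pd e3 a34 x = A4 x" for x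
    by (simp_all only: A1_def A2_def A3_def A4_def)
  have Be: "pd e2 a34 x + pd e3 (\<lambda>x. - a24 x) x + pd e4 a23 x = B1 x" "- pd e1 a34 x + pd e3 a14 x + pd e4 (\<lambda>x. - a13 x) x = B2 x"
    "- pd e1 (\<lambda>x. - a24 x) x - pd e2 a14 x + pd e4 a12 x = B3 x" "- pd e1 a23 x - pd e2 (\<lambda>x. - a13 x) x - pd e3 a12 x = B4 x" for x
    by (simp_all add: B1_def B2_def B3_def B4_def pd_uminus a_smooth)
  have XYe: "pd e1 P2 x - pd e2 P1 x = X12 x" "pd e1 P3 x - pd e3 P1 x = X13 x" "pd e1 P4 x - pd e4 P1 x = X14 x"
    "pd e2 P3 x - pd e3 P2 x = X23 x" "pd e2 P4 x - pd e4 P2 x = X24 x" "pd e3 P4 x - pd e4 P3 x = X34 x"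
    "pd e1 Q2 x - pd e2 Q1 x = Y12 x" "pd e1 Q3 x - pd e3 Q1 x = Y13 x" "pd e1 Q4 x - pd e4 Q1 x = Y14 x"
    "pd e2 Q3 x - pd e3 Q2 x = Y23 x" "pd e2 Q4 x - pd e4 Q2 x = Y24 x" "pd e3 Q4 x - pd e4 Q3 x = Y34 x" for x
    by (simp_all only: XY)
  have "P1 x = 0 \<and> P2 x = 0 \<and> P3 x = 0 \<and> P4 x = 0 \<and> Q1 x = 0 \<and> Q2 x = 0 \<and> Q3 x = 0 \<and> Q4 x = 0"
  proof (rule energy_zero[OF P Q a_periodic])
    fix x
    have "d_pairing P1 P2 P3 P4 a12 a13 a14 a23 a24 a34 x
       - d_pairing Q1 Q2 Q3 Q4 a34 (\<lambda>x. - a24 x) a23 a14 (\<lambda>x. - a13 x) a12 x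
      = 2 * (cnj (f x) * ((c x * (X12 x + X34 x) + S x * (X13 x - X24 x)) / 2 - (c x * (Y12 x + Y34 x) + S x * (Y13 x - Y24 x)) / 2)
        + cnj (u x) * ((X12 x - X34 x) / 2 + (Y12 x - Y34 x) / 2) + cnj (v x) * ((X13 x + X24 x) / 2 + (Y13 x + Y24 x) / 2)
        + cnj (w x) * ((X14 x - X23 x) / 2 + (Y14 x - Y23 x) / 2))"
      unfolding d_pairing_def XYe a12_def a13_def a14_def a23_def a24_def a34_def
      by (simp add: algebra_simps add_divide_distrib diff_divide_distrib)
    also have "\<dots> = 0" unfolding z by simp
    finally show "d_pairing P1 P2 P3 P4 a12 a13 a14 a23 a24 a34 x
       = d_pairing Q1 Q2 Q3 Q4 a34 (\<lambda>x. - a24 x) a23 a14 (\<lambda>x. - a13 x) a12 x" by simp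
    show "codiff_pairing P1 P2 P3 P4 a12 a13 a14 a23 a24 a34 x = of_real (normsq P1 P2 P3 P4 x)"
      unfolding codiff_pairing_def Ae Pd by (rule tp_norm[where c = c and S = S, OF cs]) simp
    have "normsq Q1 Q2 Q3 Q4 x = normsq (tp1 \<i> c S B1 B2 B3 B4) (tp2 \<i> c S B1 B2 B3 B4) (tp3 \<i> c S B1 B2 B3 B4) (tp4 \<i> c S B1 B2 B3 B4) x"
      by (simp add: normsq_def Qd)
    then have "- of_real (normsq Q1 Q2 Q3 Q4 x) = - (tp1 \<i> c S B1 B2 B3 B4 x * cnj (B1 x) + tp2 \<i> c S B1 B2 B3 B4 x * cnj (B2 x)
        + tp3 \<i> c S B1 B2 B3 B4 x * cnj (B3 x) + tp4 \<i> c S B1 B2 B3 B4 x * cnj (B4 x))"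
      using tp_norm[where c = c and S = S, OF cs, of \<i> B1 B2 B3 B4 x] by simp
    then show "codiff_pairing Q1 Q2 Q3 Q4 a34 (\<lambda>x. - a24 x) a23 a14 (\<lambda>x. - a13 x) a12 x = - of_real (normsq Q1 Q2 Q3 Q4 x)"
      unfolding codiff_pairing_def Be by (simp add: Qd)
  qed
  then show ?thesis by (simp add: Pd Qd)
qed

text \<open>
  The hypotheses say that \<open>(c, S) = (cos s, sin s)\<close> for a local angle \<open>s\<close> that depends on \<open>t\<^sub>1\<close> only and has
  derivative \<open>p\<close>. Then \<open>type_equations\<close> applies at every point.
\<close>

lemma delbar_harmonic_iff:
  fixes p :: "pt \<Rightarrow> real"
  assumes dc: "pd e1 c = (\<lambda>x. - (S x * p x))" "pd e2 c = (\<lambda>x. 0)" "pd e3 c = (\<lambda>x. 0)" "pd e4 c = (\<lambda>x. 0)"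
    and dS: "pd e1 S = (\<lambda>x. c x * p x)" "pd e2 S = (\<lambda>x. 0)" "pd e3 S = (\<lambda>x. 0)" "pd e4 S = (\<lambda>x. 0)"
  shows "delbar_laplacian (Jst c S) (om c S) (form11 c S f u v w) = 0 \<longleftrightarrow>
    (\<forall>x. - pd e2 u x - pd e3 v x - pd e4 w x = \<i> * pd e1 f x
       \<and> pd e1 u x + pd e3 w x - pd e4 v x = \<i> * pd e2 f x
       \<and> pd e1 v x - pd e2 w x + pd e4 u x = \<i> * pd e3 f x
       \<and> pd e1 w x + pd e2 v x - pd e3 u x = \<i> * (pd e4 f x - p x * f x))"
proof -
  note sm = per[THEN periodic_smooth]
  have X: "A1 x = (pd e2 f x * c x + pd e3 f x * S x) - (- pd e2 u x - pd e3 v x - pd e4 w x)"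
    "A2 x = (- (pd e1 f x * c x) + f x * S x * p x - pd e4 f x * S x) - (pd e1 u x + pd e3 w x - pd e4 v x)"
    "A3 x = (- (pd e1 f x * S x) - f x * c x * p x + pd e4 f x * c x) - (pd e1 v x - pd e2 w x + pd e4 u x)"
    "A4 x = (pd e2 f x * S x - pd e3 f x * c x) - (pd e1 w x + pd e2 v x - pd e3 u x)"
    "B1 x = (pd e2 f x * c x + pd e3 f x * S x) + (- pd e2 u x - pd e3 v x - pd e4 w x)"
    "B2 x = (- (pd e1 f x * c x) + f x * S x * p x - pd e4 f x * S x) + (pd e1 u x + pd e3 w x - pd e4 v x)"
    "B3 x = (- (pd e1 f x * S x) - f x * c x * p x + pd e4 f x * c x) + (pd e1 v x - pd e2 w x + pd e4 u x)"
    "B4 x = (pd e2 f x * S x - pd e3 f x * c x) + (pd e1 w x + pd e2 v x - pd e3 u x)" for x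
    unfolding A1_def A2_def A3_def A4_def B1_def B2_def B3_def B4_def a12_def a13_def a14_def a23_def a24_def a34_def
    by (simp_all add: pd_simps sm smooth_intros dc dS algebra_simps)
  have half: "z / 2 = 0 \<longleftrightarrow> z = 0" for z :: complex by simp
  have cs': "complex_of_real (c x) * complex_of_real (c x) + complex_of_real (S x) * complex_of_real (S x) = 1" for x
    unfolding cs_complex(1)[where c = c and S = S, OF cs] by simp
  have "tp1 (- \<i>) c S A1 A2 A3 A4 x = 0 \<and> tp2 (- \<i>) c S A1 A2 A3 A4 x = 0
    \<and> tp3 (- \<i>) c S A1 A2 A3 A4 x = 0 \<and> tp4 (- \<i>) c S A1 A2 A3 A4 x = 0
    \<and> tp1 \<i> c S B1 B2 B3 B4 x = 0 \<and> tp2 \<i> c S B1 B2 B3 B4 x = 0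
    \<and> tp3 \<i> c S B1 B2 B3 B4 x = 0 \<and> tp4 \<i> c S B1 B2 B3 B4 x = 0
   \<longleftrightarrow> - pd e2 u x - pd e3 v x - pd e4 w x = \<i> * pd e1 f x
       \<and> pd e1 u x + pd e3 w x - pd e4 v x = \<i> * pd e2 f x
       \<and> pd e1 v x - pd e2 w x + pd e4 u x = \<i> * pd e3 f x
       \<and> pd e1 w x + pd e2 v x - pd e3 u x = \<i> * (pd e4 f x - p x * f x)" (is "?T x \<longleftrightarrow> ?H x") for x
    unfolding tp_defs half X by (rule type_equations[OF cs'])
  note TH = this
  have "?T x" if "delbar_laplacian (Jst c S) (om c S) (form11 c S f u v w) = 0" for x
    by (rule delbar_harmonicD[OF that])
  moreover have "delbar_laplacian (Jst c S) (om c S) (form11 c S f u v w) = 0" if T: "\<forall>x. ?T x"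
  proof (rule delbar_harmonic_if)
    have "tp1 (- \<i>) c S A1 A2 A3 A4 = (\<lambda>x. 0)" "tp2 (- \<i>) c S A1 A2 A3 A4 = (\<lambda>x. 0)"
      "tp3 (- \<i>) c S A1 A2 A3 A4 = (\<lambda>x. 0)" "tp4 (- \<i>) c S A1 A2 A3 A4 = (\<lambda>x. 0)"
      using T by blast+
    then show "form1_type (- \<i>) c S A1 A2 A3 A4 = 0" unfolding form1_type_def by (simp only: form_zero)
    have "tp1 \<i> c S B1 B2 B3 B4 = (\<lambda>x. 0)" "tp2 \<i> c S B1 B2 B3 B4 = (\<lambda>x. 0)"
      "tp3 \<i> c S B1 B2 B3 B4 = (\<lambda>x. 0)" "tp4 \<i> c S B1 B2 B3 B4 = (\<lambda>x. 0)"
      using T by blast+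
    then show "form1_type \<i> c S B1 B2 B3 B4 = 0" unfolding form1_type_def by (simp only: form_zero)
  qed
  ultimately show ?thesis unfolding TH[symmetric] by blast
qed

end

end

section \<open>Solving the harmonicity equations\<close>

lemma constant_if_pd_zero:
  fixes f :: cfun
  assumes f: "smooth f" and z: "\<And>x. pd e1 f x = 0 \<and> pd e2 f x = 0 \<and> pd e3 f x = 0 \<and> pd e4 f x = 0"
  shows "f x = f 0"
proof -
  have "pd v f x = 0" for v x using pd_expand[OF f, of v x] z[of x] by simp
  then have "(f has_derivative (\<lambda>v. 0)) (at x within UNIV)" for x
    using has_derivative_pd[OF smooth_differentiable[OF f], of x] by simp
  then have "\<exists>c. \<forall>x\<in>UNIV. f x = c"
    by (intro has_derivative_zero_constant[OF convex_UNIV]) auto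
  then show ?thesis by (metis UNIV_I)
qed

lemma harmonic_function_constant:
  fixes u :: cfun
  assumes u: "periodic u" and lap: "\<And>x. pd e1 (pd e1 u) x + pd e2 (pd e2 u) x + pd e3 (pd e3 u) x + pd e4 (pd e4 u) x = 0"
  shows "u x = u 0"
proof (rule constant_if_pd_zero[OF periodic_smooth[OF u]])
  fix x
  define q where "q x = (cmod (pd e1 u x))\<^sup>2 + (cmod (pd e2 u x))\<^sup>2 + (cmod (pd e3 u x))\<^sup>2 + (cmod (pd e4 u x))\<^sup>2" for x
  have "q x = 0"
  proof (rule divergence_nonneg_zero[of "\<lambda>x. cnj (u x) * pd e1 u x" "\<lambda>x. cnj (u x) * pd e2 u x"
        "\<lambda>x. cnj (u x) * pd e3 u x" "\<lambda>x. cnj (u x) * pd e4 u x"])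
    fix x
    have "pd e1 (\<lambda>x. cnj (u x) * pd e1 u x) x + pd e2 (\<lambda>x. cnj (u x) * pd e2 u x) x
        + pd e3 (\<lambda>x. cnj (u x) * pd e3 u x) x + pd e4 (\<lambda>x. cnj (u x) * pd e4 u x) x
      = cnj (u x) * (pd e1 (pd e1 u) x + pd e2 (pd e2 u) x + pd e3 (pd e3 u) x + pd e4 (pd e4 u) x) + of_real (q x)"
      unfolding q_def of_real_add complex_norm_square
      by (simp add: pd_simps smooth_intros periodic_smooth[OF u] algebra_simps)
    then show "Re (pd e1 (\<lambda>x. cnj (u x) * pd e1 u x) x + pd e2 (\<lambda>x. cnj (u x) * pd e2 u x) x
        + pd e3 (\<lambda>x. cnj (u x) * pd e3 u x) x + pd e4 (\<lambda>x. cnj (u x) * pd e4 u x) x) = q x"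
      by (simp add: lap)
  qed (auto intro!: periodic_intros u simp: q_def)
  then show "pd e1 u x = 0 \<and> pd e2 u x = 0 \<and> pd e3 u x = 0 \<and> pd e4 u x = 0"
    unfolding q_def by (rule sum_squares_zero)
qed

text \<open>
  The divergence of anti-self-dual forms is an operator of Dirac type: composed with its formal adjoint
  it gives the Laplacian on each coefficient.
\<close>

lemma closed_asd_constant:
  fixes u v w :: cfun
  assumes per: "periodic u" "periodic v" "periodic w"
    and C: "\<And>x. - pd e2 u x - pd e3 v x - pd e4 w x = 0" "\<And>x. pd e1 u x + pd e3 w x - pd e4 v x = 0"
      "\<And>x. pd e1 v x - pd e2 w x + pd e4 u x = 0" "\<And>x. pd e1 w x + pd e2 v x - pd e3 u x = 0"
  shows "u x = u 0 \<and> v x = v 0 \<and> w x = w 0"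
proof -
  note sm = per[THEN periodic_smooth]
  have "(\<lambda>x. - pd e2 u x - pd e3 v x - pd e4 w x) = (\<lambda>x. 0)" using C(1) by blast
  then have "pd e (\<lambda>x. - pd e2 u x - pd e3 v x - pd e4 w x) x = 0" for e x by (simp add: pd_const)
  then have D1: "- pd e (pd e2 u) x - pd e (pd e3 v) x - pd e (pd e4 w) x = 0" for e x
    by (simp add: pd_simps smooth_intros sm)
  have "(\<lambda>x. pd e1 u x + pd e3 w x - pd e4 v x) = (\<lambda>x. 0)" using C(2) by blast
  then have "pd e (\<lambda>x. pd e1 u x + pd e3 w x - pd e4 v x) x = 0" for e x by (simp add: pd_const)
  then have D2: "pd e (pd e1 u) x + pd e (pd e3 w) x - pd e (pd e4 v) x = 0" for e x
    by (simp add: pd_simps smooth_intros sm)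
  have "(\<lambda>x. pd e1 v x - pd e2 w x + pd e4 u x) = (\<lambda>x. 0)" using C(3) by blast
  then have "pd e (\<lambda>x. pd e1 v x - pd e2 w x + pd e4 u x) x = 0" for e x by (simp add: pd_const)
  then have D3: "pd e (pd e1 v) x - pd e (pd e2 w) x + pd e (pd e4 u) x = 0" for e x
    by (simp add: pd_simps smooth_intros sm)
  have "(\<lambda>x. pd e1 w x + pd e2 v x - pd e3 u x) = (\<lambda>x. 0)" using C(4) by blast
  then have "pd e (\<lambda>x. pd e1 w x + pd e2 v x - pd e3 u x) x = 0" for e x by (simp add: pd_const)
  then have D4: "pd e (pd e1 w) x + pd e (pd e2 v) x - pd e (pd e3 u) x = 0" for e x
    by (simp add: pd_simps smooth_intros sm)
  note com = pd_commute[OF sm(1)] pd_commute[OF sm(2)] pd_commute[OF sm(3)]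
  have eu: "pd e1 (pd e1 u) x + pd e2 (pd e2 u) x + pd e3 (pd e3 u) x + pd e4 (pd e4 u) x = 0" for x
  proof -
    have "pd e1 (pd e1 u) x + pd e2 (pd e2 u) x + pd e3 (pd e3 u) x + pd e4 (pd e4 u) x
      = (pd e1 (pd e1 u) x + pd e1 (pd e3 w) x - pd e1 (pd e4 v) x) - (- pd e2 (pd e2 u) x - pd e2 (pd e3 v) x - pd e2 (pd e4 w) x)
      - (pd e3 (pd e1 w) x + pd e3 (pd e2 v) x - pd e3 (pd e3 u) x) + (pd e4 (pd e1 v) x - pd e4 (pd e2 w) x + pd e4 (pd e4 u) x)"
      unfolding com(2)[of e3 e2] com(2)[of e4 e1] com(3)[of e3 e1] com(3)[of e4 e2] by simp
    then show ?thesis unfolding D1 D2 D3 D4 by simp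
  qed
  have ev: "pd e1 (pd e1 v) x + pd e2 (pd e2 v) x + pd e3 (pd e3 v) x + pd e4 (pd e4 v) x = 0" for x
  proof -
    have "pd e1 (pd e1 v) x + pd e2 (pd e2 v) x + pd e3 (pd e3 v) x + pd e4 (pd e4 v) x
      = (pd e1 (pd e1 v) x - pd e1 (pd e2 w) x + pd e1 (pd e4 u) x) - (- pd e3 (pd e2 u) x - pd e3 (pd e3 v) x - pd e3 (pd e4 w) x)
      + (pd e2 (pd e1 w) x + pd e2 (pd e2 v) x - pd e2 (pd e3 u) x) - (pd e4 (pd e1 u) x + pd e4 (pd e3 w) x - pd e4 (pd e4 v) x)"
      unfolding com(1)[of e3 e2] com(1)[of e4 e1] com(3)[of e2 e1] com(3)[of e4 e3] by simp
    then show ?thesis unfolding D1 D2 D3 D4 by simp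
  qed
  have ew: "pd e1 (pd e1 w) x + pd e2 (pd e2 w) x + pd e3 (pd e3 w) x + pd e4 (pd e4 w) x = 0" for x
  proof -
    have "pd e1 (pd e1 w) x + pd e2 (pd e2 w) x + pd e3 (pd e3 w) x + pd e4 (pd e4 w) x
      = (pd e1 (pd e1 w) x + pd e1 (pd e2 v) x - pd e1 (pd e3 u) x) - (- pd e4 (pd e2 u) x - pd e4 (pd e3 v) x - pd e4 (pd e4 w) x)
      - (pd e2 (pd e1 v) x - pd e2 (pd e2 w) x + pd e2 (pd e4 u) x) + (pd e3 (pd e1 u) x + pd e3 (pd e3 w) x - pd e3 (pd e4 v) x)"
      unfolding com(1)[of e3 e1] com(1)[of e4 e2] com(2)[of e2 e1] com(2)[of e4 e3] by simp
    then show ?thesis unfolding D1 D2 D3 D4 by simp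
  qed
  show ?thesis
    using harmonic_function_constant[OF per(1) eu] harmonic_function_constant[OF per(2) ev]
      harmonic_function_constant[OF per(3) ew] by blast
qed

text \<open>
  The divergence of an anti-self-dual form is divergence free. Hence the function \<open>f\<close> below solves
  the elliptic equation \<open>\<Delta>f = p \<partial>\<^sub>4f\<close>, whose first-order term drops out of the energy.
\<close>

lemma trace_part_constant:
  fixes f u v w :: cfun and p :: "pt \<Rightarrow> real"
  assumes per: "periodic f" "periodic u" "periodic v" "periodic w" "periodic p" and p4: "pd e4 p = (\<lambda>x. 0)"
    and C: "\<And>x. - pd e2 u x - pd e3 v x - pd e4 w x = \<i> * pd e1 f x"
      "\<And>x. pd e1 u x + pd e3 w x - pd e4 v x = \<i> * pd e2 f x"
      "\<And>x. pd e1 v x - pd e2 w x + pd e4 u x = \<i> * pd e3 f x"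
      "\<And>x. pd e1 w x + pd e2 v x - pd e3 u x = \<i> * (pd e4 f x - p x * f x)"
  shows "f x = f 0"
proof (rule constant_if_pd_zero[OF periodic_smooth[OF per(1)]])
  fix x
  note sm = per[THEN periodic_smooth]
  define F1 F2 F3 F4 where "F1 = pd e1 f" and "F2 = pd e2 f" and "F3 = pd e3 f" and "F4 = pd e4 f"
  have sF: "smooth F1" "smooth F2" "smooth F3" "smooth F4"
    unfolding F1_def F2_def F3_def F4_def by (intro smooth_intros sm)+
  have pF: "periodic F1" "periodic F2" "periodic F3" "periodic F4"
    unfolding F1_def F2_def F3_def F4_def by (intro periodic_intros per)+
  have com: "pd e2 F1 = pd e1 F2" "pd e3 F1 = pd e1 F3" "pd e4 F1 = pd e1 F4" "pd e3 F2 = pd e2 F3" "pd e4 F2 = pd e2 F4" "pd e4 F3 = pd e3 F4"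
    unfolding F1_def F2_def F3_def F4_def by (rule pd_commute[OF sm(1)])+
  define q where "q x = (cmod (F1 x))\<^sup>2 + (cmod (F2 x))\<^sup>2 + (cmod (F3 x))\<^sup>2 + (cmod (F4 x))\<^sup>2" for x
  \<comment> \<open>\<open>V\<close> is \<open>- \<i>\<close> times the contraction of the anti-self-dual part with the gradient of \<open>cnj f\<close>; the term added
    to \<open>V4\<close> cancels the real part of \<open>p f (\<partial>\<^sub>4 (cnj f))\<close>, as \<open>p\<close> is independent of \<open>t\<^sub>4\<close>\<close>
  define h :: complex where "h = 1 / 2"
  define V1 where "V1 = (\<lambda>x. - \<i> * (u x * cnj (F2 x) + v x * cnj (F3 x) + w x * cnj (F4 x)))"
  define V2 where "V2 = (\<lambda>x. - \<i> * (v x * cnj (F4 x) - u x * cnj (F1 x) - w x * cnj (F3 x)))"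
  define V3 where "V3 = (\<lambda>x. - \<i> * (w x * cnj (F2 x) - v x * cnj (F1 x) - u x * cnj (F4 x)))"
  define V4 where "V4 = (\<lambda>x. - \<i> * (u x * cnj (F3 x) - w x * cnj (F1 x) - v x * cnj (F2 x)) + of_real (p x) * (f x * cnj (f x)) * h)"
  have "q x = 0"
  proof (rule divergence_nonneg_zero[of V1 V2 V3 V4])
    show "periodic V1" "periodic V2" "periodic V3" "periodic V4"
      unfolding V1_def V2_def V3_def V4_def by (intro periodic_intros per pF)+
    fix x
    have d: "pd e1 V1 x + pd e2 V2 x + pd e3 V3 x + pd e4 V4 x =
      - \<i> * ((- pd e2 u x - pd e3 v x - pd e4 w x) * cnj (F1 x) + (pd e1 u x + pd e3 w x - pd e4 v x) * cnj (F2 x)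
       + (pd e1 v x - pd e2 w x + pd e4 u x) * cnj (F3 x) + (pd e1 w x + pd e2 v x - pd e3 u x) * cnj (F4 x))
       + of_real (p x) * (f x * cnj (F4 x) + F4 x * cnj (f x)) * h"
      unfolding V1_def V2_def V3_def V4_def
      by (simp add: pd_simps smooth_intros sm sF com p4 F4_def[symmetric] algebra_simps)
    have "pd e1 V1 x + pd e2 V2 x + pd e3 V3 x + pd e4 V4 x =
      of_real (q x) - of_real (p x) * (f x * cnj (F4 x)) + of_real (p x) * (f x * cnj (F4 x) + F4 x * cnj (f x)) * h"
      unfolding d C q_def of_real_add complex_norm_square F1_def F2_def F3_def F4_def
      by (simp add: algebra_simps)
    then have "Re (pd e1 V1 x + pd e2 V2 x + pd e3 V3 x + pd e4 V4 x) =
      q x - p x * Re (f x * cnj (F4 x)) + p x * (Re (f x * cnj (F4 x)) + Re (F4 x * cnj (f x))) / 2"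
      by (simp add: h_def)
    also have "Re (F4 x * cnj (f x)) = Re (f x * cnj (F4 x))" by simp
    finally show "Re (pd e1 V1 x + pd e2 V2 x + pd e3 V3 x + pd e4 V4 x) = q x" by simp
  qed (simp add: q_def)
  then have "F1 x = 0 \<and> F2 x = 0 \<and> F3 x = 0 \<and> F4 x = 0"
    unfolding q_def by (rule sum_squares_zero)
  then show "pd e1 f x = 0 \<and> pd e2 f x = 0 \<and> pd e3 f x = 0 \<and> pd e4 f x = 0"
    by (simp add: F1_def F2_def F3_def F4_def)
qed

text \<open>
  With \<open>p = m + \<partial>\<^sub>1\<sigma>\<close>, the mean \<open>m\<close> of \<open>p\<close> is the obstruction to solving \<open>\<partial>\<^sub>1w = - \<i> p f\<close> with constant \<open>f \<noteq> 0\<close> by a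
  periodic \<open>w\<close>.
\<close>

lemma harmonic_system_solution:
  fixes f u v w :: cfun and p \<sigma> :: "pt \<Rightarrow> real"
  assumes per: "periodic f" "periodic u" "periodic v" "periodic w" "periodic \<sigma>"
    and \<sigma>: "pd e2 \<sigma> = (\<lambda>x. 0)" "pd e3 \<sigma> = (\<lambda>x. 0)" "pd e4 \<sigma> = (\<lambda>x. 0)"
    and m: "0 \<le> m" and p: "p = (\<lambda>x. m + pd e1 \<sigma> x)"
    and C: "\<And>x. - pd e2 u x - pd e3 v x - pd e4 w x = \<i> * pd e1 f x"
      "\<And>x. pd e1 u x + pd e3 w x - pd e4 v x = \<i> * pd e2 f x"
      "\<And>x. pd e1 v x - pd e2 w x + pd e4 u x = \<i> * pd e3 f x"
      "\<And>x. pd e1 w x + pd e2 v x - pd e3 u x = \<i> * (pd e4 f x - p x * f x)"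
  obtains f0 u0 v0 w0 where "of_real m * f0 = 0" "f = (\<lambda>x. f0)" "u = (\<lambda>x. u0)" "v = (\<lambda>x. v0)"
    "w = (\<lambda>x. w0 - \<i> * f0 * \<sigma> x)"
proof -
  note sm = per[THEN periodic_smooth]
  define f0 where "f0 = f 0"
  have perp: "periodic p" unfolding p by (intro periodic_intros per)
  have p4: "pd e4 p = (\<lambda>x. 0)"
    unfolding p using sm by (simp add: pd_simps smooth_intros pd_commute[of \<sigma> e4 e1] \<sigma>)
  have f: "f = (\<lambda>x. f0)"
    unfolding f0_def using trace_part_constant[OF per(1-4) perp p4 C] by blast
  have C': "- pd e2 u x - pd e3 v x - pd e4 w x = 0" "pd e1 u x + pd e3 w x - pd e4 v x = 0"
      "pd e1 v x - pd e2 w x + pd e4 u x = 0" "pd e1 w x + pd e2 v x - pd e3 u x = - \<i> * p x * f0" for x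
    using C[of x] unfolding f by (simp_all add: pd_const)
  \<comment> \<open>the last equation times \<open>\<i> (cnj f0)\<close>, with \<open>\<partial>\<^sub>1\<sigma>\<close> moved to the divergence\<close>
  define V1 where "V1 = (\<lambda>x. \<i> * cnj f0 * w x - f0 * cnj f0 * \<sigma> x)"
  define V2 where "V2 = (\<lambda>x. \<i> * cnj f0 * v x)"
  define V3 where "V3 = (\<lambda>x. - (\<i> * cnj f0 * u x))"
  have "m * (cmod f0)\<^sup>2 = 0"
  proof (rule divergence_nonneg_zero[of V1 V2 V3 "\<lambda>x. 0" "\<lambda>x. m * (cmod f0)\<^sup>2" 0])
    show "periodic V1" "periodic V2" "periodic V3" "periodic (\<lambda>x. 0 :: complex)"
      unfolding V1_def V2_def V3_def by (intro periodic_intros per)+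
    fix x
    have "pd e1 V1 x + pd e2 V2 x + pd e3 V3 x + pd e4 (\<lambda>x. 0) x
      = \<i> * cnj f0 * (pd e1 w x + pd e2 v x - pd e3 u x) - f0 * cnj f0 * pd e1 \<sigma> x"
      unfolding V1_def V2_def V3_def by (simp add: pd_simps smooth_intros sm algebra_simps)
    also have "\<dots> = of_real m * (f0 * cnj f0)"
      unfolding C' p by (simp add: algebra_simps)
    finally show "Re (pd e1 V1 x + pd e2 V2 x + pd e3 V3 x + pd e4 (\<lambda>x. 0) x) = m * (cmod f0)\<^sup>2"
      by (simp add: complex_norm_square[symmetric] del: of_real_power)
  qed (simp add: m)
  then have m0: "of_real m * f0 = 0" by simp
  \<comment> \<open>subtracting the particular solution leaves a closed anti-self-dual form\<close>
  define w' where "w' = (\<lambda>x. w x + \<i> * f0 * \<sigma> x)"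
  have w': "periodic w'" unfolding w'_def by (intro periodic_intros per)
  have d: "pd e w' x = pd e w x + \<i> * f0 * pd e \<sigma> x" for e x
    unfolding w'_def by (simp add: pd_simps smooth_intros sm)
  have "u x = u 0 \<and> v x = v 0 \<and> w' x = w' 0" for x
  proof (rule closed_asd_constant[OF per(2,3) w'])
    fix x
    show "- pd e2 u x - pd e3 v x - pd e4 w' x = 0" "pd e1 u x + pd e3 w' x - pd e4 v x = 0"
      "pd e1 v x - pd e2 w' x + pd e4 u x = 0"
      using C'[of x] unfolding d \<sigma> by simp_all
    have "pd e1 w' x + pd e2 v x - pd e3 u x = (pd e1 w x + pd e2 v x - pd e3 u x) + \<i> * f0 * pd e1 \<sigma> x"
      unfolding d by simp
    also have "\<dots> = - \<i> * (of_real m * f0)" unfolding C' p by (simp add: algebra_simps)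
    finally show "pd e1 w' x + pd e2 v x - pd e3 u x = 0" unfolding m0 by simp
  qed
  then have "u = (\<lambda>x. u 0)" "v = (\<lambda>x. v 0)" "w' = (\<lambda>x. w' 0)" by blast+
  moreover from this(3) have "w = (\<lambda>x. w' 0 - \<i> * f0 * \<sigma> x)"
    unfolding w'_def by (auto simp: fun_eq_iff algebra_simps)
  ultimately show thesis using that[OF m0 f] by blast
qed

section \<open>The action of the lattice\<close>

text \<open>
  For \<open>\<gamma> \<in> \<Gamma>\<close> the third coordinate is an integer, so \<open>sg\<close> is the character of \<open>\<Gamma>\<close> by which it acts on the first
  factor of \<open>\<complex>\<^sup>2\<close>.
\<close>

definition sg :: "pt \<Rightarrow> real" where "sg \<gamma> = cos (pi * X3 \<gamma>)"

definition twist :: "pt \<Rightarrow> pt \<Rightarrow> pt" where "twist \<gamma> v = (of_real (sg \<gamma>) * fst v, snd v)"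

lemma X_twist [simp]: "X1 (twist \<gamma> v) = sg \<gamma> * X1 v" "X2 (twist \<gamma> v) = sg \<gamma> * X2 v" "X3 (twist \<gamma> v) = X3 v" "X4 (twist \<gamma> v) = X4 v"
  by (simp_all add: twist_def X1_def X2_def X3_def X4_def)

lemma gmul_Gamma:
  assumes "\<gamma> \<in> Gamma"
  shows "gmul \<gamma> x = \<gamma> + twist \<gamma> x" "sg \<gamma> = 1 \<or> sg \<gamma> = - 1"
proof -
  have "X3 \<gamma> \<in> \<int>" using assms by (simp add: Gamma_def X3_def)
  then have sin: "sin (pi * X3 \<gamma>) = 0" by (metis sin_times_pi_eq_0 mult.commute)
  then have "(sg \<gamma>)\<^sup>2 = 1" using sin_cos_squared_add[of "pi * X3 \<gamma>"] by (simp add: sg_def)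
  then show "sg \<gamma> = 1 \<or> sg \<gamma> = - 1" by (simp add: power2_eq_1_iff)
  have "\<i> * of_real pi * ((snd \<gamma> + cnj (snd \<gamma>)) / 2) = \<i> * of_real (pi * X3 \<gamma>)"
    by (simp add: complex_add_cnj X3_def)
  then have "exp (\<i> * of_real pi * ((snd \<gamma> + cnj (snd \<gamma>)) / 2)) = of_real (sg \<gamma>)"
    using sin by (simp only: cis_conv_exp[symmetric]) (simp add: complex_eq_iff sg_def)
  then show "gmul \<gamma> x = \<gamma> + twist \<gamma> x"
    by (simp add: gmul_def twist_def prod_eq_iff)
qed

lemma X_gmul:
  assumes "\<gamma> \<in> Gamma"
  shows "X1 (gmul \<gamma> x) = X1 \<gamma> + sg \<gamma> * X1 x"
  by (simp add: gmul_Gamma(1)[OF assms])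

lemma frechet_derivative_gmul:
  assumes "\<gamma> \<in> Gamma"
  shows "frechet_derivative (gmul \<gamma>) (at x) = twist \<gamma>"
proof -
  have "(gmul \<gamma> has_derivative (\<lambda>v. twist \<gamma> v)) (at x)"
    unfolding gmul_Gamma(1)[OF assms, abs_def] twist_def
    by (auto intro!: derivative_eq_intros)
  then show ?thesis by (metis frechet_derivative_at)
qed

text \<open>
  The functions on \<open>G\<close> that descend to \<open>M\<close>, and the sections of the flat line bundle over \<open>M\<close> given by the
  character \<open>sg\<close>.
\<close>

definition inv_fun :: "(pt \<Rightarrow> 'b::real_vector) \<Rightarrow> bool" where
  "inv_fun a \<longleftrightarrow> (\<forall>\<gamma>\<in>Gamma. \<forall>x. a (gmul \<gamma> x) = a x)"

definition odd_fun :: "(pt \<Rightarrow> 'b::real_vector) \<Rightarrow> bool" where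
  "odd_fun a \<longleftrightarrow> (\<forall>\<gamma>\<in>Gamma. \<forall>x. a (gmul \<gamma> x) = sg \<gamma> *\<^sub>R a x)"

lemma inv_funD: "inv_fun a \<Longrightarrow> \<gamma> \<in> Gamma \<Longrightarrow> a (gmul \<gamma> x) = a x"
  and odd_funD: "odd_fun a \<Longrightarrow> \<gamma> \<in> Gamma \<Longrightarrow> a (gmul \<gamma> x) = sg \<gamma> *\<^sub>R a x"
  unfolding inv_fun_def odd_fun_def by blast+

lemma sg_basis: "e \<in> {e1, e2, e3, e4} \<Longrightarrow> sg (2 *\<^sub>R e) = 1"
  by (auto simp: sg_def mult.commute)

lemma inv_fun_periodic: "inv_fun a \<Longrightarrow> smooth a \<Longrightarrow> periodic a"
  and odd_fun_periodic: "odd_fun a \<Longrightarrow> smooth a \<Longrightarrow> periodic a"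
proof -
  have "a (x + 2 *\<^sub>R e) = a x" if "inv_fun a \<or> odd_fun a" "e \<in> {e1, e2, e3, e4}" for x e
    using that(1) inv_funD[OF _ gmul_translation(2)[OF that(2)], of a x]
      odd_funD[OF _ gmul_translation(2)[OF that(2)], of a x] sg_basis[OF that(2)] gmul_translation(1)[OF that(2)]
    by auto
  then show "inv_fun a \<Longrightarrow> smooth a \<Longrightarrow> periodic a" "odd_fun a \<Longrightarrow> smooth a \<Longrightarrow> periodic a"
    unfolding periodic_def by blast+
qed

text \<open>
  The element \<open>e\<^sub>3\<close> of \<open>\<Gamma>\<close> has sign \<open>- 1\<close>.
\<close>

lemma odd_constant_zero:
  fixes c :: complex
  assumes "odd_fun (\<lambda>x. c)"
  shows "c = 0"
proof -
  have G: "e3 \<in> Gamma" by (simp add: Gamma_def e3_def)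
  have "c = sg e3 *\<^sub>R c" using odd_funD[OF assms G] .
  then have "2 * c = 0" by (simp add: sg_def eq_neg_iff_add_eq_0)
  then show ?thesis by simp
qed

text \<open>
  The form \<open>dt\<^sub>i\<^sub>j\<close> picks up one factor \<open>sg\<close> for each of its indices \<open>1\<close> and \<open>2\<close>.
\<close>

lemma M_form2_iff:
  "M_form 2 (form2 a12 a13 a14 a23 a24 a34) \<longleftrightarrow>
     smooth a12 \<and> smooth a13 \<and> smooth a14 \<and> smooth a23 \<and> smooth a24 \<and> smooth a34 \<and>
     inv_fun a12 \<and> odd_fun a13 \<and> odd_fun a14 \<and> odd_fun a23 \<and> odd_fun a24 \<and> inv_fun a34"
proof
  let ?f = "form2 a12 a13 a14 a23 a24 a34"
  assume M: "M_form 2 ?f"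
  have k: "kform 2 ?f" using M unfolding M_form_def by blast
  have sm: "smooth a12" "smooth a13" "smooth a14" "smooth a23" "smooth a24" "smooth a34"
    using kform_smooth[OF k, of "[e1, e2]"] kform_smooth[OF k, of "[e1, e3]"] kform_smooth[OF k, of "[e1, e4]"]
      kform_smooth[OF k, of "[e2, e3]"] kform_smooth[OF k, of "[e2, e4]"] kform_smooth[OF k, of "[e3, e4]"]
    unfolding form2_coeffs by simp_all
  have P: "?f (gmul \<gamma> x) [twist \<gamma> u, twist \<gamma> v] = ?f x [u, v]" if "\<gamma> \<in> Gamma" for \<gamma> x u v
  proof -
    have "pullback (gmul \<gamma>) ?f = ?f" using M that unfolding M_form_def by blast
    then have "pullback (gmul \<gamma>) ?f x [u, v] = ?f x [u, v]" by simp
    then show ?thesis unfolding pullback_def frechet_derivative_gmul[OF that] by simp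
  qed
  have sq: "sg \<gamma> *\<^sub>R sg \<gamma> *\<^sub>R z = z" if "\<gamma> \<in> Gamma" for \<gamma> and z :: complex
    using gmul_Gamma(2)[OF that] by auto
  have c: "sg \<gamma> *\<^sub>R sg \<gamma> *\<^sub>R a12 (gmul \<gamma> x) = a12 x" "sg \<gamma> *\<^sub>R a13 (gmul \<gamma> x) = a13 x" "sg \<gamma> *\<^sub>R a14 (gmul \<gamma> x) = a14 x"
    "sg \<gamma> *\<^sub>R a23 (gmul \<gamma> x) = a23 x" "sg \<gamma> *\<^sub>R a24 (gmul \<gamma> x) = a24 x" "a34 (gmul \<gamma> x) = a34 x"
    if "\<gamma> \<in> Gamma" for \<gamma> x
    using P[OF that, of x e1 e2] P[OF that, of x e1 e3] P[OF that, of x e1 e4] P[OF that, of x e2 e3]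
      P[OF that, of x e2 e4] P[OF that, of x e3 e4]
    by (simp_all add: alt_defs scaleR_conv_of_real mult.commute mult.left_commute)
  have "odd_fun a" if "\<And>\<gamma> x. \<gamma> \<in> Gamma \<Longrightarrow> sg \<gamma> *\<^sub>R a (gmul \<gamma> x) = a x" for a :: cfun
    unfolding odd_fun_def using that sq by metis
  then show "smooth a12 \<and> smooth a13 \<and> smooth a14 \<and> smooth a23 \<and> smooth a24 \<and> smooth a34 \<and>
     inv_fun a12 \<and> odd_fun a13 \<and> odd_fun a14 \<and> odd_fun a23 \<and> odd_fun a24 \<and> inv_fun a34"
    using sm c sq unfolding inv_fun_def by simp
next
  let ?f = "form2 a12 a13 a14 a23 a24 a34"
  assume A: "smooth a12 \<and> smooth a13 \<and> smooth a14 \<and> smooth a23 \<and> smooth a24 \<and> smooth a34 \<and>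
     inv_fun a12 \<and> odd_fun a13 \<and> odd_fun a14 \<and> odd_fun a23 \<and> odd_fun a24 \<and> inv_fun a34"
  have "pullback (gmul \<gamma>) ?f = ?f" if "\<gamma> \<in> Gamma" for \<gamma>
  proof (rule form_eqI2)
    show "pullback (gmul \<gamma>) ?f x vs = 0" if "length vs \<noteq> 2" for x vs
      using that by (simp add: pullback_def form_wrong_length)
    have c: "a12 (gmul \<gamma> x) = a12 x" "a34 (gmul \<gamma> x) = a34 x" "a13 (gmul \<gamma> x) = sg \<gamma> *\<^sub>R a13 x"
      "a14 (gmul \<gamma> x) = sg \<gamma> *\<^sub>R a14 x" "a23 (gmul \<gamma> x) = sg \<gamma> *\<^sub>R a23 x" "a24 (gmul \<gamma> x) = sg \<gamma> *\<^sub>R a24 x" for x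
      using A inv_funD[OF _ that] odd_funD[OF _ that] by blast+
    show "pullback (gmul \<gamma>) ?f x [u, v] = alt2 (a12 x) (a13 x) (a14 x) (a23 x) (a24 x) (a34 x) u v" for x u v
      unfolding pullback_def frechet_derivative_gmul[OF that] list.map form_eval c
      using gmul_Gamma(2)[OF that] by (elim disjE) (simp_all add: alt2_def minor2_def algebra_simps)
  qed
  then show "M_form 2 ?f" unfolding M_form_def using A by (blast intro: kform_form2)
qed

section \<open>Two almost Hermitian structures\<close>

text \<open>
  The angle \<open>ang k\<close> winds \<open>k\<close> times around the circle over a period of \<open>t\<^sub>1\<close>, so the mean of its derivative \<open>pp k\<close> is
  \<open>2\<pi>k\<close>. The summand \<open>sig\<close> makes the derivative non-constant; as an odd function it is compatible with the
  action of \<open>\<Gamma>\<close>.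
\<close>

definition sig :: "pt \<Rightarrow> real" where "sig x = sin (2 * pi * X1 x)"
definition ang :: "nat \<Rightarrow> pt \<Rightarrow> real" where "ang k x = 2 * pi * real k * X1 x + sig x"
definition cc :: "nat \<Rightarrow> pt \<Rightarrow> real" where "cc k x = cos (ang k x)"
definition sn :: "nat \<Rightarrow> pt \<Rightarrow> real" where "sn k x = sin (ang k x)"
definition pp :: "nat \<Rightarrow> pt \<Rightarrow> real" where "pp k x = 2 * pi * real k + pd e1 sig x"

lemma bounded_linear_X1: "bounded_linear X1"
proof -
  have X1: "X1 = (\<lambda>v. Re (fst v))" by (simp add: fun_eq_iff X1_def)
  show ?thesis unfolding X1 by (rule bounded_linear_compose[OF bounded_linear_Re bounded_linear_fst])
qed

lemma smooth_X1: "smooth X1" by (rule smooth_id_linear[OF bounded_linear_X1])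

lemma pd_X1: "pd e X1 = (\<lambda>x. X1 e)"
  by (rule ext, rule pd_eqI) (rule bounded_linear_imp_has_derivative[OF bounded_linear_X1])

lemma sig_fun: "sig = (\<lambda>x. sin (2 * pi * X1 x))" by (simp add: fun_eq_iff sig_def)
lemma ang_fun: "ang k = (\<lambda>x. 2 * pi * real k * X1 x + sig x)" by (simp add: fun_eq_iff ang_def)
lemma cc_fun: "cc k = (\<lambda>x. cos (ang k x))" by (simp add: fun_eq_iff cc_def)
lemma sn_fun: "sn k = (\<lambda>x. sin (ang k x))" by (simp add: fun_eq_iff sn_def)

lemma smooth_sig: "smooth sig" unfolding sig_fun by (intro smooth_intros smooth_X1)
lemma smooth_ang: "smooth (ang k)" unfolding ang_fun by (intro smooth_intros smooth_X1 smooth_sig)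
lemma smooth_cc: "smooth (cc k)" unfolding cc_fun by (intro smooth_intros smooth_ang)
lemma smooth_sn: "smooth (sn k)" unfolding sn_fun by (intro smooth_intros smooth_ang)

lemma pd_sig: "pd e sig = (\<lambda>x. 2 * pi * X1 e * cos (2 * pi * X1 x))"
  unfolding sig_fun by (simp add: pd_simps pd_X1 smooth_intros smooth_X1 algebra_simps)

lemma pd_ang: "pd e (ang k) = (\<lambda>x. X1 e * pp k x)"
  unfolding ang_fun pp_def
  by (simp add: pd_simps pd_X1 smooth_intros smooth_X1 smooth_sig pd_sig algebra_simps)

lemma pd_cc: "pd e (cc k) = (\<lambda>x. - (sn k x * (X1 e * pp k x)))"
  unfolding cc_fun sn_def by (simp add: pd_cos smooth_ang pd_ang)

lemma pd_sn: "pd e (sn k) = (\<lambda>x. cc k x * (X1 e * pp k x))"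
  unfolding sn_fun cc_def by (simp add: pd_sin smooth_ang pd_ang)

lemma cc_sn_unit: "(cc k x)\<^sup>2 + (sn k x)\<^sup>2 = 1"
  by (simp add: cc_def sn_def)

lemma gmul_sig:
  assumes "\<gamma> \<in> Gamma"
  shows "sig (gmul \<gamma> x) = sg \<gamma> * sig x"
proof -
  obtain m where m: "X1 \<gamma> = of_int m" using assms by (auto simp: Gamma_def X1_def elim: Ints_cases)
  have "sig (gmul \<gamma> x) = sin (2 * pi * of_int m + sg \<gamma> * (2 * pi * X1 x))"
    by (simp add: sig_def X_gmul[OF assms] m algebra_simps)
  also have "\<dots> = sin (sg \<gamma> * (2 * pi * X1 x))" by (simp add: sin_add sin_int_2pin cos_int_2pin)
  also have "\<dots> = sg \<gamma> * sig x" using gmul_Gamma(2)[OF assms] by (auto simp: sig_def)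
  finally show ?thesis .
qed

lemma gmul_cc_sn:
  assumes "\<gamma> \<in> Gamma"
  shows "cc k (gmul \<gamma> x) = cc k x" "sn k (gmul \<gamma> x) = sg \<gamma> * sn k x"
proof -
  obtain m where m: "X1 \<gamma> = of_int m" using assms by (auto simp: Gamma_def X1_def elim: Ints_cases)
  have a: "ang k (gmul \<gamma> x) = 2 * pi * of_int (int k * m) + sg \<gamma> * ang k x"
    by (simp add: ang_def gmul_sig[OF assms] X_gmul[OF assms] m algebra_simps)
  have "cos (sg \<gamma> * ang k x) = cos (ang k x)" "sin (sg \<gamma> * ang k x) = sg \<gamma> * sin (ang k x)"
    using gmul_Gamma(2)[OF assms] by auto
  then show "cc k (gmul \<gamma> x) = cc k x" "sn k (gmul \<gamma> x) = sg \<gamma> * sn k x"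
    unfolding cc_def sn_def a by (simp_all only: sin_add cos_add sin_int_2pin cos_int_2pin)
qed

lemma inv_cc: "inv_fun (cc k)" and odd_sn: "odd_fun (sn k)" and odd_sig: "odd_fun sig"
  by (simp_all add: inv_fun_def odd_fun_def gmul_cc_sn gmul_sig)

lemma periodic_cs: "periodic (cc k)" "periodic (sn k)" "periodic sig"
  using inv_fun_periodic[OF inv_cc smooth_cc] odd_fun_periodic[OF odd_sn smooth_sn] odd_fun_periodic[OF odd_sig smooth_sig]
  by blast+

abbreviation "JJ k \<equiv> Jst (cc k) (sn k)"
abbreviation "\<omega>\<omega> k \<equiv> om (cc k) (sn k)"

lemma almost_complex_JJ: "almost_complex (JJ k)"
  unfolding almost_complex_def
proof (intro conjI allI ballI)
  show "linear (JJ k x)" for x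
    by (rule linearI; rule pt_eqI; simp add: algebra_simps)
  show "JJ k x (JJ k x v) = - v" for x v by (rule Jst_Jst[OF cc_sn_unit])
  show "smooth (\<lambda>x. JJ k x v)" for v
  proof -
    have "JJ k x v = cc k x *\<^sub>R (\<i> * fst v, \<i> * snd v) + sn k x *\<^sub>R (- cnj (snd v), cnj (fst v))" for x
      by (simp add: Jst_def scaleR_conv_of_real)
    then show ?thesis
      by (simp only:) (intro smooth_add smooth_bilinear[OF bounded_bilinear_scaleR] smooth_const smooth_cc smooth_sn)
  qed
  fix \<gamma> x v assume \<gamma>: "\<gamma> \<in> Gamma"
  show "JJ k (gmul \<gamma> x) (frechet_derivative (gmul \<gamma>) (at x) v) = frechet_derivative (gmul \<gamma>) (at x) (JJ k x v)"
    unfolding frechet_derivative_gmul[OF \<gamma>]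
    using gmul_Gamma(2)[OF \<gamma>] by (intro pt_eqI; elim disjE; simp add: gmul_cc_sn[OF \<gamma>])
qed

lemma om_form11: "om c S = form11 c S (\<lambda>x. 1) (\<lambda>x. 0) (\<lambda>x. 0) (\<lambda>x. 0)"
  unfolding om_def form11_def by simp

lemma M_form11:
  assumes "smooth f" "smooth u" "smooth v" "smooth w" "inv_fun f" "inv_fun u" "odd_fun v" "odd_fun w"
  shows "M_form 2 (form11 (cc k) (sn k) f u v w)"
proof -
  have "inv_fun (\<lambda>x. f x * cc k x + u x)" "inv_fun (\<lambda>x. f x * cc k x - u x)" "odd_fun (\<lambda>x. f x * sn k x + v x)"
    "odd_fun (\<lambda>x. v x - f x * sn k x)" "odd_fun (\<lambda>x. - w x)"
    using assms(5-8) by (auto simp: inv_fun_def odd_fun_def gmul_cc_sn algebra_simps scaleR_conv_of_real)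
  then show ?thesis
    unfolding form11_def M_form2_iff using assms
    by (auto intro!: smooth_intros smooth_cc smooth_sn)
qed

lemma A_forms_11I: "M_form 2 (form11 (cc k) (sn k) f u v w) \<Longrightarrow> form11 (cc k) (sn k) f u v w \<in> A_forms (JJ k) 1 1"
  using bideg_form11(1)[of "cc k" "sn k", OF cc_sn_unit] by (simp add: A_forms_def numeral_2_eq_2)

lemma almost_hermitian_JJ: "almost_hermitian (JJ k) (\<omega>\<omega> k)"
  unfolding almost_hermitian_def
proof (intro conjI allI impI)
  show "almost_complex (JJ k)" by (rule almost_complex_JJ)
  show "\<omega>\<omega> k \<in> A_forms (JJ k) 1 1"
    unfolding om_form11
    by (intro A_forms_11I M_form11 smooth_const) (simp_all add: inv_fun_def odd_fun_def)
  show "real_form (\<omega>\<omega> k)"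
    unfolding real_form_def om_def form2_def alt2_def by simp
  show "metric (JJ k) (\<omega>\<omega> k) x v v > 0" if "v \<noteq> 0" for x v
  proof -
    have "dot4 v v \<noteq> 0"
    proof
      assume "dot4 v v = 0"
      then have "X1 v * X1 v + X2 v * X2 v + X3 v * X3 v + X4 v * X4 v = 0" by (simp add: dot4_def)
      then have "X1 v = 0 \<and> X2 v = 0 \<and> X3 v = 0 \<and> X4 v = 0"
        by (smt (verit) mult_eq_0_iff zero_le_square)
      then have "v = 0" by (intro pt_eqI) (simp_all add: X1_def X2_def X3_def X4_def)
      with that show False by simp
    qed
    moreover have "dot4 v v \<ge> 0" by (simp add: dot4_def)
    ultimately show ?thesis unfolding metric_eq[of "cc k" "sn k", OF cc_sn_unit] by simp
  qed
qed

text \<open>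
  The components of \<open>d\<omega> = \<theta> \<and> \<omega>\<close> along \<open>e\<^sub>1, e\<^sub>3, e\<^sub>4\<close> and \<open>e\<^sub>1, e\<^sub>2, e\<^sub>4\<close> are linear equations with solution \<open>\<theta>(e\<^sub>1) = 0\<close> and
  \<open>\<theta>(e\<^sub>4) = - s'\<close>, so that \<open>d\<theta>(e\<^sub>1, e\<^sub>4) = - s''\<close>.
\<close>

lemma not_lcaK: "\<not> loc_conf_almost_kaehler (\<omega>\<omega> k)"
proof
  assume "loc_conf_almost_kaehler (\<omega>\<omega> k)"
  then obtain \<theta> where \<theta>: "M_form 1 \<theta>" "ext_d (\<omega>\<omega> k) = wedge \<theta> (\<omega>\<omega> k)" "ext_d \<theta> = 0"
    unfolding loc_conf_almost_kaehler_def by blast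
  have k1: "kform 1 \<theta>" using \<theta>(1) unfolding M_form_def by blast
  have len: "length vs \<noteq> 1 \<Longrightarrow> \<theta> x vs = 0" for x vs by (rule kform_length[OF k1])
  define T where "T i = (\<lambda>x. \<theta> x [i])" for i
  have w: "wedge \<theta> (\<omega>\<omega> k) x [p, q, r] = T p x * \<omega>\<omega> k x [q, r] - T q x * \<omega>\<omega> k x [p, r] + T r x * \<omega>\<omega> k x [p, q]" for x p q r
    unfolding T_def by (rule wedge_1_2[OF len om_degree])
  have d: "ext_d (\<omega>\<omega> k) x [e1, e3, e4] = - of_real (sn k x * pp k x)" "ext_d (\<omega>\<omega> k) x [e1, e2, e4] = - of_real (cc k x * pp k x)" for x
    unfolding om_def
    by (subst ext_d_form2; simp add: smooth_intros smooth_cc smooth_sn pd_simps pd_cc pd_sn alt_defs)+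
  have 1: "T e1 x * cc k x + T e4 x * sn k x = - of_real (sn k x * pp k x)" for x
    using w[of x e1 e3 e4] unfolding \<theta>(2)[symmetric] d om_eval by (simp add: minor2_def)
  have 2: "T e4 x * cc k x - T e1 x * sn k x = - of_real (cc k x * pp k x)" for x
    using w[of x e1 e2 e4] unfolding \<theta>(2)[symmetric] d om_eval by (simp add: minor2_def)
  note ccs = cs_complex[of "cc k" "sn k", OF cc_sn_unit]
  have t1: "T e1 x = 0" for x
  proof -
    have "T e1 x = cc k x * (T e1 x * cc k x + T e4 x * sn k x) - sn k x * (T e4 x * cc k x - T e1 x * sn k x)"
      by (simp add: algebra_simps ccs)
    also have "\<dots> = 0" unfolding 1 2 by (simp add: algebra_simps)
    finally show ?thesis .
  qed
  have t4: "T e4 x = - of_real (pp k x)" for x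
  proof -
    have "T e4 x = sn k x * (T e1 x * cc k x + T e4 x * sn k x) + cc k x * (T e4 x * cc k x - T e1 x * sn k x)"
      by (simp add: algebra_simps ccs)
    also have "\<dots> = - of_real (pp k x)" unfolding 1 2 by (simp add: algebra_simps ccs)
    finally show ?thesis .
  qed
  have "ext_d \<theta> x [e1, e4] = pd e1 (T e4) x - pd e4 (T e1) x" for x
    unfolding ext_d_eval1 T_def by (rule refl)
  then have "pd e1 (T e4) x - pd e4 (T e1) x = 0" for x unfolding \<theta>(3) by simp
  moreover have "T e1 = (\<lambda>x. 0)" "T e4 = (\<lambda>x. - of_real (pp k x))" using t1 t4 by blast+
  moreover have "smooth (pp k)"
    unfolding pp_def by (intro smooth_intros smooth_sig)
  ultimately have "pd e1 (pp k) x = 0" for x by (simp add: pd_simps smooth_intros)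
  moreover have "pd e1 (pp k) = (\<lambda>x. - (2 * pi * (2 * pi * sin (2 * pi * X1 x))))"
    unfolding pp_def by (simp add: pd_simps smooth_intros smooth_X1 smooth_sig pd_X1 pd_sig mult_ac)
  ultimately have "sin (2 * pi * X1 x) = 0" for x by simp
  \<comment> \<open>a point where the sine is \<open>1\<close>\<close>
  from this[of "(1 / 4) *\<^sub>R e1"] show False by simp
qed

section \<open>Non-integrability\<close>

lemma pd_cong_on:
  assumes "open U" "x \<in> U" "\<And>y. y \<in> U \<Longrightarrow> f y = g y" "f differentiable (at x)"
  shows "pd v f x = pd v g x"
  using has_derivative_transform_within_open[OF has_derivative_pd[OF assms(4)] assms(1,2), of g] assms(3)
  by (metis pd_eqI)

text \<open>
  In a holomorphic chart the second derivatives would be symmetric and at the same time, by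
  differentiating \<open>d\<phi> \<circ> J = \<i> d\<phi>\<close>, complex linear up to the derivative of \<open>J\<close>. Comparing four of
  these relations at the origin shows that \<open>d\<phi>\<close> kills \<open>(\<partial>\<^sub>1J) e\<^sub>3\<close>, a non-zero multiple of \<open>e\<^sub>1\<close>.
\<close>

lemma not_integrable: "\<not> integrable_acs (JJ k)"
proof
  assume "integrable_acs (JJ k)"
  then obtain U \<phi> where U: "open U" "0 \<in> U" and inj: "inj_on \<phi> U" and op: "open (\<phi> ` U)"
    and sm: "smooth_on U \<phi>" and smi: "smooth_on (\<phi> ` U) (inv_into U \<phi>)"
    and hol: "\<And>y v. y \<in> U \<Longrightarrow> frechet_derivative \<phi> (at y) (JJ k y v) =
           (\<i> * fst (frechet_derivative \<phi> (at y) v), \<i> * snd (frechet_derivative \<phi> (at y) v))"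
    unfolding integrable_acs_def by metis
  define M :: "pt \<Rightarrow> pt" where "M z = (\<i> * fst z, \<i> * snd z)" for z
  have M: "bounded_linear M"
    unfolding M_def by (intro bounded_linear_intros)
  have MM: "M (M z) = - z" for z by (simp add: M_def prod_eq_iff)
  note Mm = linear_neg[OF bounded_linear.linear[OF M]]
  have C2: "Ck_on 2 U \<phi>" using sm by (simp add: smooth_on_def)
  then have d1: "\<phi> differentiable (at y)" and d2: "pd v \<phi> differentiable (at y)" if "y \<in> U" for y v
    using that unfolding numeral_2_eq_2 Ck_on_Suc_pd by blast+
  have sym: "pd a (pd b \<phi>) 0 = pd b (pd a \<phi>) 0" for a b
    by (rule pd_commute_on[OF U C2])
  have hol': "pd (JJ k y v) \<phi> y = M (pd v \<phi> y)" if "y \<in> U" for y v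
    using hol[OF that] by (simp add: pd_def M_def)
  have lin: "linear (\<lambda>v. pd v \<phi> y)" if "y \<in> U" for y
    using has_derivative_linear[OF has_derivative_pd[OF d1[OF that]]] .
  have J3: "JJ k y e3 = (- sn k y) *\<^sub>R e1 + cc k y *\<^sub>R e4" and J1: "JJ k y e1 = cc k y *\<^sub>R e2 + sn k y *\<^sub>R e3" for y
    by (rule pt_eqI; simp)+
  have E3: "(- sn k y) *\<^sub>R pd e1 \<phi> y + cc k y *\<^sub>R pd e4 \<phi> y = M (pd e3 \<phi> y)" if "y \<in> U" for y
    using hol'[OF that, of e3] unfolding J3 by (simp only: linear_add[OF lin[OF that]] linear_cmul[OF lin[OF that]])
  have E1: "cc k y *\<^sub>R pd e2 \<phi> y + sn k y *\<^sub>R pd e3 \<phi> y = M (pd e1 \<phi> y)" if "y \<in> U" for y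
    using hol'[OF that, of e1] unfolding J1 by (simp only: linear_add[OF lin[OF that]] linear_cmul[OF lin[OF that]])
  have 0: "cc k 0 = 1" "sn k 0 = 0"
    by (simp_all add: cc_def sn_def ang_def sig_def X1_def)
  have dif: "(\<lambda>y. g y *\<^sub>R pd b \<phi> y) differentiable (at 0)" if "smooth g" for g b
    using bounded_bilinear.FDERIV[OF bounded_bilinear_scaleR has_derivative_pd has_derivative_pd,
        OF smooth_differentiable[OF that] d2[OF U(2)]] differentiableI by blast
  have difM: "(\<lambda>y. M (pd b \<phi> y)) differentiable (at 0)" for b
    by (rule differentiableI[OF bounded_linear.has_derivative[OF M has_derivative_pd[OF d2[OF U(2)]]]])
  have prod: "pd w (\<lambda>y. g y *\<^sub>R pd b \<phi> y + h y *\<^sub>R pd b' \<phi> y) 0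
    = (g 0 *\<^sub>R pd w (pd b \<phi>) 0 + pd w g 0 *\<^sub>R pd b \<phi> 0) + (h 0 *\<^sub>R pd w (pd b' \<phi>) 0 + pd w h 0 *\<^sub>R pd b' \<phi> 0)"
    if "smooth g" "smooth h" for g h w b b'
    using that by (simp add: pd_add_at dif pd_bilinear_at[OF bounded_bilinear_scaleR] smooth_differentiable d2[OF U(2)])
  have dE3: "pd w (\<lambda>y. (- sn k y) *\<^sub>R pd e1 \<phi> y + cc k y *\<^sub>R pd e4 \<phi> y) 0 = M (pd w (pd e3 \<phi>) 0)" for w
  proof -
    have "pd w (\<lambda>y. M (pd e3 \<phi> y)) 0 = pd w (\<lambda>y. (- sn k y) *\<^sub>R pd e1 \<phi> y + cc k y *\<^sub>R pd e4 \<phi> y) 0"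
      by (rule pd_cong_on[OF U]) (erule E3[symmetric], rule difM)
    then show ?thesis by (simp add: pd_linear_at[OF M d2[OF U(2)]])
  qed
  have dE1: "pd w (\<lambda>y. cc k y *\<^sub>R pd e2 \<phi> y + sn k y *\<^sub>R pd e3 \<phi> y) 0 = M (pd w (pd e1 \<phi>) 0)" for w
  proof -
    have "pd w (\<lambda>y. M (pd e1 \<phi> y)) 0 = pd w (\<lambda>y. cc k y *\<^sub>R pd e2 \<phi> y + sn k y *\<^sub>R pd e3 \<phi> y) 0"
      by (rule pd_cong_on[OF U]) (erule E1[symmetric], rule difM)
    then show ?thesis by (simp add: pd_linear_at[OF M d2[OF U(2)]])
  qed
  \<comment> \<open>at the origin \<open>c = 1\<close> and \<open>S = 0\<close>, and only \<open>\<partial>\<^sub>1S\<close> is non-zero among the derivatives of \<open>c\<close> and \<open>S\<close>\<close>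
  note dE3' = dE3[unfolded prod[OF smooth_uminus[OF smooth_sn] smooth_cc] pd_uminus[OF smooth_sn] pd_sn pd_cc 0]
  note dE1' = dE1[unfolded prod[OF smooth_cc smooth_sn] pd_sn pd_cc 0]
  have r1: "pd e1 (pd e4 \<phi>) 0 - pp k 0 *\<^sub>R pd e1 \<phi> 0 = M (pd e1 (pd e3 \<phi>) 0)" using dE3'[of e1] by simp
  have r2: "pd e2 (pd e4 \<phi>) 0 = M (pd e2 (pd e3 \<phi>) 0)" using dE3'[of e2] by simp
  have r3: "pd e3 (pd e2 \<phi>) 0 = M (pd e3 (pd e1 \<phi>) 0)" using dE1'[of e3] by simp
  have r4: "pd e4 (pd e2 \<phi>) 0 = M (pd e4 (pd e1 \<phi>) 0)" using dE1'[of e4] by simp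
  have "M (pd e1 (pd e4 \<phi>) 0) = pd e4 (pd e2 \<phi>) 0" using r4 by (simp add: sym[of e4 e1])
  also have "\<dots> = M (pd e2 (pd e3 \<phi>) 0)" using r2 by (simp add: sym[of e4 e2])
  also have "pd e2 (pd e3 \<phi>) 0 = M (pd e1 (pd e3 \<phi>) 0)" using r3 by (simp add: sym[of e3 e2] sym[of e3 e1])
  finally have "M (M (pd e1 (pd e4 \<phi>) 0)) = M (M (M (pd e1 (pd e3 \<phi>) 0)))" by simp
  then have "pd e1 (pd e4 \<phi>) 0 = M (pd e1 (pd e3 \<phi>) 0)" unfolding MM Mm by simp
  then have "pp k 0 *\<^sub>R pd e1 \<phi> 0 = 0" using r1 by simp
  moreover have "pp k 0 > 0"
  proof -
    have "X1 0 = 0" by (simp add: X1_def)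
    then show ?thesis by (simp add: pp_def pd_sig add_nonneg_pos)
  qed
  ultimately have e1z: "pd e1 \<phi> 0 = 0" by simp
  have "(inv_into U \<phi>) differentiable (at (\<phi> 0))"
    using smi U(2) unfolding smooth_on_def by (metis Ck_on_Suc_pd imageI)
  from has_derivative_compose[OF has_derivative_pd[OF d1[OF U(2)]] has_derivative_pd[OF this]]
  have "((\<lambda>y. inv_into U \<phi> (\<phi> y)) has_derivative (\<lambda>v. pd (pd v \<phi> 0) (inv_into U \<phi>) (\<phi> 0))) (at 0)" .
  moreover have "((\<lambda>y. inv_into U \<phi> (\<phi> y)) has_derivative (\<lambda>v. v)) (at 0)"
    by (rule has_derivative_transform_within_open[OF has_derivative_ident U]) (simp add: inj)
  ultimately have "(\<lambda>v. pd (pd v \<phi> 0) (inv_into U \<phi>) (\<phi> 0)) = (\<lambda>v. v)"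
    by (rule has_derivative_unique)
  then have "pd (pd e1 \<phi> 0) (inv_into U \<phi>) (\<phi> 0) = e1" by meson
  moreover have "pd 0 (inv_into U \<phi>) (\<phi> 0) = 0"
    using linear_0[OF has_derivative_linear[OF has_derivative_pd[OF \<open>(inv_into U \<phi>) differentiable (at (\<phi> 0))\<close>]]] .
  ultimately have "e1 = 0" unfolding e1z by simp
  then show False by (simp add: e1_def zero_prod_def)
qed

section \<open>The spaces of harmonic forms\<close>

text \<open>
  The form \<open>harm_om 0\<close> is the additional harmonic form: its last coefficient is the periodic solution \<open>w\<close> of
  \<open>\<partial>\<^sub>1w = - \<i> s'\<close>, which exists for \<open>k = 0\<close>.
\<close>

definition harm_om :: "nat \<Rightarrow> form" where
  "harm_om k = form11 (cc k) (sn k) (\<lambda>x. 1) (\<lambda>x. 0) (\<lambda>x. 0) (\<lambda>x. - \<i> * sig x)"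

definition harm_asd :: form where
  "harm_asd = form2 (\<lambda>x. 1) (\<lambda>x. 0) (\<lambda>x. 0) (\<lambda>x. 0) (\<lambda>x. 0) (\<lambda>x. - 1)"

lemma harm_combination:
  "cscale a (harm_om k) + cscale b harm_asd
    = form11 (cc k) (sn k) (\<lambda>x. a) (\<lambda>x. b) (\<lambda>x. 0) (\<lambda>x. - \<i> * a * sig x)"
proof (intro ext)
  fix x vs
  show "(cscale a (harm_om k) + cscale b harm_asd) x vs
     = form11 (cc k) (sn k) (\<lambda>x. a) (\<lambda>x. b) (\<lambda>x. 0) (\<lambda>x. - \<i> * a * sig x) x vs"
    by (simp add: cscale_def harm_om_def harm_asd_def form11_def form2_def alt2_def algebra_simps)
qed

lemma pd_cs_coords:
  "pd e1 (cc k) = (\<lambda>x. - (sn k x * pp k x))" "pd e2 (cc k) = (\<lambda>x. 0)" "pd e3 (cc k) = (\<lambda>x. 0)" "pd e4 (cc k) = (\<lambda>x. 0)"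
  "pd e1 (sn k) = (\<lambda>x. cc k x * pp k x)" "pd e2 (sn k) = (\<lambda>x. 0)" "pd e3 (sn k) = (\<lambda>x. 0)" "pd e4 (sn k) = (\<lambda>x. 0)"
  "pd e2 sig = (\<lambda>x. 0)" "pd e3 sig = (\<lambda>x. 0)" "pd e4 sig = (\<lambda>x. 0)"
  by (simp_all add: pd_cc pd_sn pd_sig)

lemmas harmonic_iff = delbar_harmonic_iff[of "cc k" "sn k" for k, OF cc_sn_unit periodic_cs(1,2) _ _ _ _ pd_cs_coords(1-8)]

text \<open>
  The condition \<open>k a = 0\<close> is where the two structures differ: it leaves \<open>a\<close> free for \<open>k = 0\<close> and forces \<open>a = 0\<close>
  for \<open>k > 0\<close>.
\<close>

lemma harmonic_delbar_eq:
  "harmonic_delbar (JJ k) (\<omega>\<omega> k) 1 1 = {cscale a (harm_om k) + cscale b harm_asd | a b. of_nat k * a = 0}"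
proof (intro equalityI subsetI)
  fix \<alpha> assume "\<alpha> \<in> harmonic_delbar (JJ k) (\<omega>\<omega> k) 1 1"
  then have M: "M_form 2 \<alpha>" and b: "bideg_proj (JJ k) 1 1 \<alpha> = \<alpha>" and lap: "delbar_laplacian (JJ k) (\<omega>\<omega> k) \<alpha> = 0"
    by (simp_all add: harmonic_delbar_def A_forms_def numeral_2_eq_2)
  define A where "A i j = (\<lambda>x. \<alpha> x [i, j])" for i j
  have pA: "periodic (A i j)" for i j unfolding A_def by (rule M_form_periodic[OF M])
  have "kform 2 \<alpha>" using M unfolding M_form_def by blast
  then have \<alpha>: "\<alpha> = form2 (A e1 e2) (A e1 e3) (A e1 e4) (A e2 e3) (A e2 e4) (A e3 e4)"
    unfolding A_def by (rule kform2_form2)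
  define f where "f = (\<lambda>x. (cc k x * (A e1 e2 x + A e3 e4 x) + sn k x * (A e1 e3 x - A e2 e4 x)) / 2)"
  define u where "u = (\<lambda>x. (A e1 e2 x - A e3 e4 x) / 2)"
  define v where "v = (\<lambda>x. (A e1 e3 x + A e2 e4 x) / 2)"
  define w where "w = (\<lambda>x. (A e1 e4 x - A e2 e3 x) / 2)"
  have \<alpha>': "\<alpha> = form11 (cc k) (sn k) f u v w"
    by (subst b[symmetric], subst \<alpha>) (simp only: bideg_form2[of "cc k" "sn k", OF cc_sn_unit] f_def u_def v_def w_def)
  have per: "periodic f" "periodic u" "periodic v" "periodic w"
    unfolding f_def u_def v_def w_def by (intro periodic_divide periodic_intros pA periodic_cs)+
  have odd: "odd_fun v" "odd_fun w"
  proof -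
    have "odd_fun (A e1 e3)" "odd_fun (A e2 e4)" "odd_fun (A e1 e4)" "odd_fun (A e2 e3)"
      using M by (subst (asm) \<alpha>, simp add: M_form2_iff)+
    then show "odd_fun v" "odd_fun w"
      unfolding odd_fun_def v_def w_def by (simp_all add: scaleR_conv_of_real algebra_simps add_divide_distrib diff_divide_distrib)
  qed
  have H: "- pd e2 u x - pd e3 v x - pd e4 w x = \<i> * pd e1 f x"
       "pd e1 u x + pd e3 w x - pd e4 v x = \<i> * pd e2 f x"
       "pd e1 v x - pd e2 w x + pd e4 u x = \<i> * pd e3 f x"
       "pd e1 w x + pd e2 v x - pd e3 u x = \<i> * (pd e4 f x - pp k x * f x)" for x
    using lap unfolding \<alpha>' harmonic_iff[OF per] by blast+
  have m: "0 \<le> 2 * pi * real k" by simp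
  have p: "pp k = (\<lambda>x. 2 * pi * real k + pd e1 sig x)" by (simp add: pp_def fun_eq_iff)
  obtain f0 u0 v0 w0 where s: "of_real (2 * pi * real k) * f0 = 0" "f = (\<lambda>x. f0)" "u = (\<lambda>x. u0)" "v = (\<lambda>x. v0)"
    "w = (\<lambda>x. w0 - \<i> * f0 * sig x)"
    by (rule harmonic_system_solution[OF per periodic_cs(3) pd_cs_coords(9-11) m p H])
  have v0: "v0 = 0" using odd(1) unfolding s by (rule odd_constant_zero)
  have "odd_fun (\<lambda>x. w0)"
    unfolding odd_fun_def
  proof (intro ballI allI)
    fix \<gamma> x assume \<gamma>: "\<gamma> \<in> Gamma"
    have "w0 - \<i> * f0 * of_real (sg \<gamma> * sig x) = sg \<gamma> *\<^sub>R (w0 - \<i> * f0 * sig x)"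
      using odd_funD[OF odd(2) \<gamma>, of x] unfolding s(5) gmul_sig[OF \<gamma>] .
    then show "w0 = sg \<gamma> *\<^sub>R w0" by (simp add: scaleR_conv_of_real algebra_simps)
  qed
  then have w0: "w0 = 0" by (rule odd_constant_zero)
  have "of_nat k * f0 = 0" using s(1) by simp
  moreover have "\<alpha> = cscale f0 (harm_om k) + cscale u0 harm_asd"
    unfolding \<alpha>' harm_combination s v0 w0 by simp
  ultimately show "\<alpha> \<in> {cscale a (harm_om k) + cscale b harm_asd | a b. of_nat k * a = 0}" by blast
next
  fix \<alpha> assume "\<alpha> \<in> {cscale a (harm_om k) + cscale b harm_asd | a b. of_nat k * a = 0}"
  then obtain a b where ka: "of_nat k * a = 0" and \<alpha>: "\<alpha> = cscale a (harm_om k) + cscale b harm_asd" by blast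
  define w :: cfun where "w = (\<lambda>x. - \<i> * a * sig x)"
  have \<alpha>': "\<alpha> = form11 (cc k) (sn k) (\<lambda>x. a) (\<lambda>x. b) (\<lambda>x. 0) w"
    unfolding \<alpha> harm_combination w_def by (rule refl)
  have sw: "smooth w" unfolding w_def by (intro smooth_intros smooth_sig)
  have ow: "odd_fun w" unfolding w_def odd_fun_def by (simp add: gmul_sig scaleR_conv_of_real)
  have M: "M_form 2 \<alpha>"
    unfolding \<alpha>' by (intro M_form11 smooth_const sw ow) (simp_all add: inv_fun_def odd_fun_def)
  have dw: "pd e w x = - \<i> * a * pd e sig x" for e x
    unfolding w_def by (simp add: pd_simps smooth_intros smooth_sig)
  have pw: "periodic w" by (rule odd_fun_periodic[OF ow sw])
  have "delbar_laplacian (JJ k) (\<omega>\<omega> k) \<alpha> = 0"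
    unfolding \<alpha>' harmonic_iff[OF periodic_const periodic_const periodic_const pw]
    using ka by (auto simp: dw pd_cs_coords pd_const pp_def algebra_simps)
  then show "\<alpha> \<in> harmonic_delbar (JJ k) (\<omega>\<omega> k) 1 1"
    using A_forms_11I[OF M[unfolded \<alpha>']] unfolding \<alpha>' harmonic_delbar_def by blast
qed

lemma harm_independent: "cscale a (harm_om k) + cscale b harm_asd = 0 \<Longrightarrow> a = 0 \<and> b = 0"
  unfolding harm_combination using form11_eq_0_iff[of "cc k" "sn k", OF cc_sn_unit] by metis

interpretation cform: vector_space cscale by (rule vector_space_cscale)
interpretation rform: vector_space rscale by (rule vector_space_rscale)

lemma h_delbar_0: "h_delbar 1 1 (JJ 0) (\<omega>\<omega> 0) = 2"
proof -
  have span: "harmonic_delbar (JJ 0) (\<omega>\<omega> 0) 1 1 = cform.span {harm_om 0, harm_asd}"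
    unfolding harmonic_delbar_eq cform.span_insert cform.span_singleton
    by (auto simp: algebra_simps)
  have ne: "harm_asd \<noteq> 0" using harm_independent[of 0 0 1] by (auto simp: cform.scale_zero_left)
  have "harm_om 0 \<notin> cform.span {harm_asd}"
  proof
    assume "harm_om 0 \<in> cform.span {harm_asd}"
    then obtain b where "harm_om 0 = cscale b harm_asd" unfolding cform.span_singleton by blast
    then have "cscale 1 (harm_om 0) + cscale (- b) harm_asd = 0" by simp
    then show False using harm_independent by fastforce
  qed
  then have ind: "cform.independent {harm_om 0, harm_asd}" and ne': "harm_om 0 \<noteq> harm_asd"
    using ne cform.span_base[of harm_asd "{harm_asd}"] by (auto simp: cform.independent_insert)
  have "cform.dim (cform.span {harm_om 0, harm_asd}) = card {harm_om 0, harm_asd}"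
    by (rule cform.dim_span_eq_card_independent[OF ind])
  then show ?thesis unfolding h_delbar_def span using ne' by (simp del: cform.dim_span)
qed

lemma h_delbar_pos:
  assumes "k > 0"
  shows "h_delbar 1 1 (JJ k) (\<omega>\<omega> k) = 1"
proof -
  have span: "harmonic_delbar (JJ k) (\<omega>\<omega> k) 1 1 = cform.span {harm_asd}"
    unfolding harmonic_delbar_eq cform.span_singleton using assms by auto
  have "harm_asd \<noteq> 0" using harm_independent[of 0 0 1] by auto
  then have "cform.independent {harm_asd}" by simp
  note cform.dim_span_eq_card_independent[OF this]
  then show ?thesis unfolding h_delbar_def span by (simp del: cform.dim_span)
qed

text \<open>
  Anti-self-duality leaves three coefficients. Coclosedness makes them constant, and the two odd ones vanish.
\<close>

lemma asd_harmonic_eq: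
  "{\<alpha>. M_form 2 \<alpha> \<and> real_form \<alpha> \<and> hodge (JJ k) (\<omega>\<omega> k) \<alpha> = - \<alpha> \<and> d_laplacian (JJ k) (\<omega>\<omega> k) \<alpha> = 0}
    = rform.span {harm_asd}" (is "?L = _")
  unfolding rform.span_singleton
proof (intro equalityI subsetI)
  fix \<alpha> assume "\<alpha> \<in> ?L"
  then have M: "M_form 2 \<alpha>" and re: "real_form \<alpha>" and asd: "hodge (JJ k) (\<omega>\<omega> k) \<alpha> = - \<alpha>"
    and lap: "d_laplacian (JJ k) (\<omega>\<omega> k) \<alpha> = 0" by auto
  define A where "A i j = (\<lambda>x. \<alpha> x [i, j])" for i j
  have pA: "periodic (A i j)" for i j unfolding A_def by (rule M_form_periodic[OF M])
  have "kform 2 \<alpha>" using M unfolding M_form_def by blast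
  then have \<alpha>: "\<alpha> = form2 (A e1 e2) (A e1 e3) (A e1 e4) (A e2 e3) (A e2 e4) (A e3 e4)"
    unfolding A_def by (rule kform2_form2)
  define \<beta> where "\<beta> = form2 (A e1 e2) (A e1 e3) (A e1 e4) (A e2 e3) (A e2 e4) (A e3 e4)"
  have \<alpha>\<beta>: "\<alpha> = \<beta>" unfolding \<beta>_def by (rule \<alpha>)
  note lap' = lap[unfolded \<alpha>\<beta> \<beta>_def] and asd' = asd[unfolded \<alpha>\<beta> \<beta>_def]
  have "form2 (A e3 e4) (\<lambda>x. - A e2 e4 x) (A e2 e3) (A e1 e4) (\<lambda>x. - A e1 e3 x) (A e1 e2)
    = form2 (\<lambda>x. - A e1 e2 x) (\<lambda>x. - A e1 e3 x) (\<lambda>x. - A e1 e4 x) (\<lambda>x. - A e2 e3 x) (\<lambda>x. - A e2 e4 x) (\<lambda>x. - A e3 e4 x)"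
    using asd'[unfolded hodge_form2[of "cc k" "sn k", OF cc_sn_unit] form_uminus] .
  then have p: "A e3 e4 x = - A e1 e2 x" "- A e2 e4 x = - A e1 e3 x" "A e2 e3 x = - A e1 e4 x" for x
    unfolding form2_eq_iff by meson+
  have eq: "A e3 e4 = (\<lambda>x. - A e1 e2 x)" "A e2 e4 = A e1 e3" "A e2 e3 = (\<lambda>x. - A e1 e4 x)"
    using p by (intro ext; simp)+
  note sA = pA[THEN periodic_smooth]
  have "A e1 e2 x = A e1 e2 0 \<and> A e1 e3 x = A e1 e3 0 \<and> A e1 e4 x = A e1 e4 0" for x
  proof (rule closed_asd_constant[OF pA pA pA])
    fix x
    note C = d_harmonic_coclosed[of "cc k" "sn k", OF cc_sn_unit pA pA pA pA pA pA lap', of x, unfolded eq pd_uminus[OF sA]]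
    show "- pd e2 (A e1 e2) x - pd e3 (A e1 e3) x - pd e4 (A e1 e4) x = 0"
    proof -
      have "- pd e2 (A e1 e2) x - pd e3 (A e1 e3) x - pd e4 (A e1 e4) x = - (pd e2 (A e1 e2) x + pd e3 (A e1 e3) x + pd e4 (A e1 e4) x)" by (simp add: algebra_simps)
      also have "\<dots> = 0" unfolding C(1) by simp
      finally show ?thesis .
    qed
    show "pd e1 (A e1 e2) x + pd e3 (A e1 e4) x - pd e4 (A e1 e3) x = 0"
    proof -
      have "pd e1 (A e1 e2) x + pd e3 (A e1 e4) x - pd e4 (A e1 e3) x = - (- pd e1 (A e1 e2) x + - pd e3 (A e1 e4) x + pd e4 (A e1 e3) x)" by (simp add: algebra_simps)
      also have "\<dots> = 0" unfolding C(2) by simp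
      finally show ?thesis .
    qed
    show "pd e1 (A e1 e3) x - pd e2 (A e1 e4) x + pd e4 (A e1 e2) x = 0"
    proof -
      have "pd e1 (A e1 e3) x - pd e2 (A e1 e4) x + pd e4 (A e1 e2) x = - (- pd e1 (A e1 e3) x - (- pd e2 (A e1 e4) x) + - pd e4 (A e1 e2) x)" by (simp add: algebra_simps)
      also have "\<dots> = 0" unfolding C(3) by simp
      finally show ?thesis .
    qed
    show "pd e1 (A e1 e4) x + pd e2 (A e1 e3) x - pd e3 (A e1 e2) x = 0"
    proof -
      have "pd e1 (A e1 e4) x + pd e2 (A e1 e3) x - pd e3 (A e1 e2) x = - (- pd e1 (A e1 e4) x - pd e2 (A e1 e3) x - (- pd e3 (A e1 e2) x))" by (simp add: algebra_simps)
      also have "\<dots> = 0" unfolding C(4) by simp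
      finally show ?thesis .
    qed
  qed
  then obtain a b d where abd: "A e1 e2 = (\<lambda>x. a)" "A e1 e3 = (\<lambda>x. b)" "A e1 e4 = (\<lambda>x. d)" by blast
  have "odd_fun (A e1 e3)" "odd_fun (A e1 e4)"
    using M by (subst (asm) \<alpha>, simp add: M_form2_iff)+
  then have "b = 0" "d = 0" unfolding abd by (blast intro: odd_constant_zero)+
  moreover have "a \<in> \<real>" using re fun_cong[OF abd(1), of 0] unfolding real_form_def A_def by metis
  then obtain r where "a = of_real r" by (auto elim: Reals_cases)
  ultimately have "\<alpha> = rscale r harm_asd"
    by (subst \<alpha>) (auto simp: eq abd rscale_def harm_asd_def form2_def alt2_def fun_eq_iff algebra_simps)
  then show "\<alpha> \<in> range (\<lambda>r. rscale r harm_asd)" by blast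
next
  fix \<alpha> assume "\<alpha> \<in> range (\<lambda>r. rscale r harm_asd)"
  then obtain r where "\<alpha> = rscale r harm_asd" by blast
  then have \<alpha>: "\<alpha> = form2 (\<lambda>x. of_real r) (\<lambda>x. 0) (\<lambda>x. 0) (\<lambda>x. 0) (\<lambda>x. 0) (\<lambda>x. - of_real r)"
    by (auto simp: rscale_def harm_asd_def form2_def alt2_def fun_eq_iff algebra_simps)
  have "M_form 2 \<alpha>" unfolding \<alpha> M_form2_iff by (auto simp: smooth_const inv_fun_def odd_fun_def)
  moreover have "real_form \<alpha>" unfolding \<alpha> real_form_def form2_def alt2_def by auto
  moreover have "hodge (JJ k) (\<omega>\<omega> k) \<alpha> = - \<alpha>"
    unfolding \<alpha> hodge_form2[of "cc k" "sn k", OF cc_sn_unit] form_uminus by simp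
  moreover have "d_laplacian (JJ k) (\<omega>\<omega> k) \<alpha> = 0"
  proof -
    have "ext_d_adj (JJ k) (\<omega>\<omega> k) \<alpha> = 0"
      unfolding \<alpha> by (subst ext_d_adj_form2[of "cc k" "sn k", OF cc_sn_unit]) (simp_all add: smooth_const pd_const form_zero)
    moreover have "ext_d \<alpha> = 0"
      unfolding \<alpha> by (subst ext_d_form2) (simp_all add: smooth_const pd_const form_zero)
    moreover have "ext_d_adj (JJ k) (\<omega>\<omega> k) 0 = 0" by (simp add: ext_d_adj_def hodge_zero ext_d_zero)
    ultimately show ?thesis unfolding d_laplacian_def by (simp add: ext_d_zero)
  qed
  ultimately show "\<alpha> \<in> ?L" by blast
qed

lemma b_minus_JJ: "b_minus (JJ k) (\<omega>\<omega> k) = 1"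
proof -
  have "harm_asd \<noteq> 0" using harm_independent[of 0 0 1] by auto
  then have "rform.independent {harm_asd}" by simp
  note rform.dim_span_eq_card_independent[OF this]
  then show ?thesis unfolding b_minus_def asd_harmonic_eq by (simp del: rform.dim_span)
qed

theorem theorem2p6:
  shows "\<exists>(J1 :: endo) (\<omega>1 :: form) (J2 :: endo) (\<omega>2 :: form).
    almost_hermitian J1 \<omega>1 \<and> \<not> integrable_acs J1 \<and> \<not> loc_conf_almost_kaehler \<omega>1 \<and>
    almost_hermitian J2 \<omega>2 \<and> \<not> integrable_acs J2 \<and> \<not> loc_conf_almost_kaehler \<omega>2 \<and>
    h_delbar 1 1 J1 \<omega>1 = 2 \<and> 2 = b_minus J1 \<omega>1 + 1 \<and>
    h_delbar 1 1 J2 \<omega>2 = 1 \<and> 1 = b_minus J2 \<omega>2"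
proof (intro exI conjI)
  show "almost_hermitian (JJ 0) (\<omega>\<omega> 0)" "almost_hermitian (JJ 1) (\<omega>\<omega> 1)" by (rule almost_hermitian_JJ)+
  show "\<not> integrable_acs (JJ 0)" "\<not> integrable_acs (JJ 1)" by (rule not_integrable)+
  show "\<not> loc_conf_almost_kaehler (\<omega>\<omega> 0)" "\<not> loc_conf_almost_kaehler (\<omega>\<omega> 1)" by (rule not_lcaK)+
  show "h_delbar 1 1 (JJ 0) (\<omega>\<omega> 0) = 2" by (rule h_delbar_0)
  show "h_delbar 1 1 (JJ 1) (\<omega>\<omega> 1) = 1" by (rule h_delbar_pos) simp
  show "2 = b_minus (JJ 0) (\<omega>\<omega> 0) + 1" "1 = b_minus (JJ 1) (\<omega>\<omega> 1)" by (simp_all add: b_minus_JJ)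
qed

end
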